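(* Assume that $$0<\varrho_0\in W^{1,\infty}(\mathbb R),\quad \underline J\le J_0\in L^\infty(\mathbb R),\quad \vartheta_0\ge 0,$$ $$\sqrt{\varrho_0}v_0,\ \sqrt{\varrho_0}v_0^2,\ \sqrt{\varrho_0}\vartheta_0,\ \sqrt{\varrho_0}J_0',\ v_0',\ \varrho_0^{3/2}\vartheta_0'\in L^2(\mathbb R),$$ where $\underline J$ is a positive constant, that $$\Big(\frac1{\sqrt{\varrho_0}}\Big)'\in L^\infty(\mathbb R),\quad \varrho_0\in L^1(\mathbb R),\quad \sqrt{\varrho_0}\vartheta_0'\in L^2(\mathbb R),\quad \frac{J_0'}{\sqrt{\varrho_0}}\in L^2(\mathbb R),$$ and that $$\Big(\frac1{\varrho_0}\Big)''\in L^\infty(\mathbb R).$$ Let $(J,v,\vartheta)$ be the unique global solution with initial data $(J_0,v_0,\vartheta_0)$ and let $s$ be its entropy. If $s$ is bounded from below at $t=0$, i.e. $\inf_{\mathbb R}s|_{t=0}>-\infty$, then for every $T\in(0,\infty)$ $$\inf_{(y,t)\in\mathbb R\times(0,T)}s(y,t)>-\infty .$$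
   Context: $\mu,\kappa,c_v,R,A$ are positive constants and $\gamma:=1+R/c_v>1$. The one-dimensional heat conductive compressible Navier--Stokes system in Lagrangian coordinates, for unknowns $(J,v,\vartheta)(y,t)$, $y\in\mathbb R$, with a given function $\varrho_0=\varrho_0(y)$ (the initial density), is $$J_t=v_y,\qquad \varrho_0v_t-\mu\Big(\frac{v_y}{J}\Big)_y+R\Big(\frac{\varrho_0}{J}\vartheta\Big)_y=0,\qquad c_v\varrho_0\vartheta_t-\kappa\Big(\frac{\vartheta_y}{J}\Big)_y+R\frac{\varrho_0}{J}\vartheta v_y=\mu\frac{|v_y|^2}{J},$$ with initial condition $(J,v,\vartheta)|_{t=0}=(J_0,v_0,\vartheta_0)$. A prime denotes $d/dy$. A triple $(J,v,\vartheta)$ is called a solution in $\mathbb R\times(0,\mathcal T)$ if $0<J,J^{-1}\in L^\infty(\mathbb R\times(0,\mathcal T))$, $\vartheta\ge0$, $$J_t,\ \sqrt{\varrho_0}J_y,\ \sqrt{\varrho_0}v,\ \sqrt{\varrho_0}v^2,\ v_y,\ \sqrt{\varrho_0}\vartheta,\ \varrho_0^{3/2}\vartheta_y\in L^\infty(0,\mathcal T;L^2(\mathbb R)),$$ $$\sqrt{\varrho_0}J_{yt},\ vv_y,\ \sqrt{\varrho_0}v_t,\ \sqrt{\varrho_0}v_{yy},\ \vartheta_y,\ \varrho_0\Big(\frac{\vartheta_y}{J}\Big)_y,\ \varrho_0^2\vartheta_t\in L^2(0,\mathcal T;L^2(\mathbb R)),$$ the equations hold a.e. in $\mathbb R\times(0,\mathcal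 T)$ and the initial condition is satisfied; it is global if it is a solution in $\mathbb R\times(0,\mathcal T)$ for every $\mathcal T<\infty$. Under the first two groups of hypotheses of the claim, a global solution exists and is unique. The entropy is $$s=c_v\Big(\log\frac RA+(\gamma-1)\log J+\log\vartheta-(\gamma-1)\log\varrho_0\Big)$$ (with $s=-\infty$ where $\vartheta=0$). *)

theory Defs
  imports "HOL-Analysis.Analysis" "HOL-Probability.Essential_Supremum"
begin

section \<open>Test functions and weak derivatives\<close>

primrec C_k :: "nat \<Rightarrow> ('a::euclidean_space \<Rightarrow> real) \<Rightarrow> bool" where
  "C_k 0 f \<longleftrightarrow> continuous_on UNIV f"
| "C_k (Suc k) f \<longleftrightarrow> f differentiable_on UNIV \<and>
     (\<forall>b\<in>Basis. C_k k (\<lambda>x. frechet_derivative f (at x) b))"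

definition test_function :: "'a::euclidean_space set \<Rightarrow> ('a \<Rightarrow> real) \<Rightarrow> bool" where
  "test_function \<Omega> \<phi> \<longleftrightarrow> (\<forall>k. C_k k \<phi>) \<and>
     (\<exists>K. compact K \<and> K \<subseteq> \<Omega> \<and> (\<forall>x. x \<notin> K \<longrightarrow> \<phi> x = 0))"

definition locally_integrable :: "'a::euclidean_space set \<Rightarrow> ('a \<Rightarrow> real) \<Rightarrow> bool" where
  "locally_integrable \<Omega> f \<longleftrightarrow> (\<forall>K. compact K \<longrightarrow> K \<subseteq> \<Omega> \<longrightarrow> set_integrable lborel K f)"

text \<open>\<open>weak_deriv \<Omega> b f g\<close>: on the open set \<open>\<Omega>\<close>, the function \<open>g\<close> is the distributional
  derivative of \<open>f\<close> in the coordinate direction \<open>b\<close>.\<close>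

definition weak_deriv ::
    "'a::euclidean_space set \<Rightarrow> 'a \<Rightarrow> ('a \<Rightarrow> real) \<Rightarrow> ('a \<Rightarrow> real) \<Rightarrow> bool" where
  "weak_deriv \<Omega> b f g \<longleftrightarrow> locally_integrable \<Omega> f \<and> locally_integrable \<Omega> g \<and>
     (\<forall>\<phi>. test_function \<Omega> \<phi> \<longrightarrow>
        (LINT x:\<Omega>|lborel. f x * frechet_derivative \<phi> (at x) b)
          = - (LINT x:\<Omega>|lborel. g x * \<phi> x))"

abbreviation weak_deriv1 :: "(real \<Rightarrow> real) \<Rightarrow> (real \<Rightarrow> real) \<Rightarrow> bool" where
  "weak_deriv1 \<equiv> weak_deriv UNIV 1"


section \<open>Lebesgue and Bochner spaces\<close>

text \<open>Membership is expressed through Borel measurable representatives.\<close>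

definition L_infty :: "'a::euclidean_space set \<Rightarrow> ('a \<Rightarrow> real) \<Rightarrow> bool" where
  "L_infty \<Omega> f \<longleftrightarrow> set_borel_measurable lborel \<Omega> f \<and>
     (\<exists>C. AE x in lborel. x \<in> \<Omega> \<longrightarrow> \<bar>f x\<bar> \<le> C)"

definition L2 :: "(real \<Rightarrow> real) \<Rightarrow> bool" where
  "L2 f \<longleftrightarrow> f \<in> borel_measurable lborel \<and> integrable lborel (\<lambda>y. (f y)\<^sup>2)"

text \<open>Points of space-time are pairs \<open>(y, t)\<close>.\<close>

definition strip :: "real \<Rightarrow> (real \<times> real) set" where
  "strip T = UNIV \<times> {0<..<T}"

definition L_infty_L2 :: "real \<Rightarrow> (real \<times> real \<Rightarrow> real) \<Rightarrow> bool" where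
  "L_infty_L2 T f \<longleftrightarrow> set_borel_measurable lborel (strip T) f \<and>
     (\<exists>C::real. AE t in lborel. t \<in> {0<..<T} \<longrightarrow>
        (\<integral>\<^sup>+ y. ennreal ((f (y, t))\<^sup>2) \<partial>lborel) \<le> ennreal C)"

definition L2_L2 :: "real \<Rightarrow> (real \<times> real \<Rightarrow> real) \<Rightarrow> bool" where
  "L2_L2 T f \<longleftrightarrow> set_borel_measurable lborel (strip T) f \<and>
     (\<integral>\<^sup>+ t\<in>{0<..<T}. (\<integral>\<^sup>+ y. ennreal ((f (y, t))\<^sup>2) \<partial>lborel) \<partial>lborel) < \<infinity>"

definition ess_inf :: "'a measure \<Rightarrow> ('a \<Rightarrow> ereal) \<Rightarrow> ereal" where
  "ess_inf M f = - esssup M (\<lambda>x. - f x)"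

lemma ess_inf_eq_INF:
  fixes f :: "'a::euclidean_space \<Rightarrow> ereal"
  assumes "open \<Omega>" and f: "continuous_on \<Omega> f"
  shows "ess_inf (restrict_space lborel \<Omega>) f = (INF x\<in>\<Omega>. f x)"
proof (rule antisym)
  have \<Omega>: "\<Omega> \<in> sets borel" using \<open>open \<Omega>\<close> by simp
  let ?M = "restrict_space lborel \<Omega>"
  have meas: "(\<lambda>x. - f x) \<in> borel_measurable ?M"
  proof -
    have "f \<in> borel_measurable (restrict_space borel \<Omega>)"
      by (rule borel_measurable_continuous_on_restrict[OF f])
    then have "f \<in> borel_measurable ?M"
      by (simp add: measurable_def sets_restrict_space space_restrict_space)
    then show ?thesis by simp
  qed
  have "esssup ?M (\<lambda>x. - f x) \<le> - (INF x\<in>\<Omega>. f x)"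
    by (rule esssup_I[OF meas]) (auto intro!: AE_I2 INF_lower simp: space_restrict_space)
  then show "(INF x\<in>\<Omega>. f x) \<le> ess_inf ?M f"
    unfolding ess_inf_def by (metis ereal_minus_le_minus ereal_uminus_uminus)
  define e where "e = ess_inf ?M f"
  have "AE x in ?M. - f x \<le> - e"
    using esssup_AE[of "\<lambda>x. - f x" ?M] by (simp add: e_def ess_inf_def)
  then have AE: "AE x in lborel. x \<in> \<Omega> \<longrightarrow> e \<le> f x"
    using \<Omega> by (simp add: AE_restrict_space_iff)
  have op: "open (f -` {..<e} \<inter> \<Omega>)"
    using f \<open>open \<Omega>\<close> by (simp add: continuous_on_open_vimage)
  have "f -` {..<e} \<inter> \<Omega> \<in> null_sets lborel"
    using AE op by (subst AE_iff_null_sets) (auto elim!: eventually_mono)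
  then have "f -` {..<e} \<inter> \<Omega> = {}"
    using op open_not_negligible[of "f -` {..<e} \<inter> \<Omega>"]
    by (auto simp: negligible_iff_null_sets null_sets_completionI)
  then show "ess_inf ?M f \<le> (INF x\<in>\<Omega>. f x)"
    unfolding e_def[symmetric] by (intro INF_greatest) (force simp: not_less[symmetric])
qed


section \<open>The Navier--Stokes system in Lagrangian coordinates\<close>

text \<open>Attainment of the initial value \<open>f0\<close>: essential limit in \<open>L\<^sup>2\<close> of bounded intervals
  as \<open>t\<close> tends to \<open>0\<close> from the right. Independent of the representative of \<open>f\<close>; for \<open>f\<close> with
  \<open>f\<^sub>t\<close> in \<open>L\<^sup>2((a,b) \<times> (0,T))\<close> for all \<open>a < b\<close>, it says that
  the representative in \<open>C([0,T]; L\<^sup>2(a,b))\<close> equals \<open>f0\<close> at \<open>t = 0\<close>.\<close>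

definition attains_initial :: "(real \<times> real \<Rightarrow> real) \<Rightarrow> (real \<Rightarrow> real) \<Rightarrow> bool" where
  "attains_initial f f0 \<longleftrightarrow> (\<forall>a b \<epsilon>::real. \<epsilon> > 0 \<longrightarrow>
     (\<exists>\<delta>>0. AE t in lborel. 0 < t \<and> t < \<delta> \<longrightarrow>
        (\<integral>\<^sup>+ y\<in>{a..b}. ennreal ((f (y, t) - f0 y)\<^sup>2) \<partial>lborel) < ennreal \<epsilon>))"

text \<open>The bound functions are the weak derivatives of the solution:
  \<open>Fy\<close> is \<open>(v\<^sub>y/J)\<^sub>y\<close>, \<open>Py\<close> is \<open>(\<rho>\<^sub>0\<theta>/J)\<^sub>y\<close>, \<open>Qy\<close> is \<open>(\<theta>\<^sub>y/J)\<^sub>y\<close>.\<close>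

definition NS_solution ::
    "real \<Rightarrow> real \<Rightarrow> real \<Rightarrow> real \<Rightarrow> (real \<Rightarrow> real) \<Rightarrow>
     (real \<Rightarrow> real) \<Rightarrow> (real \<Rightarrow> real) \<Rightarrow> (real \<Rightarrow> real) \<Rightarrow> real \<Rightarrow>
     (real \<times> real \<Rightarrow> real) \<Rightarrow> (real \<times> real \<Rightarrow> real) \<Rightarrow> (real \<times> real \<Rightarrow> real) \<Rightarrow> bool" where
  "NS_solution \<mu> \<kappa> cv R \<rho>0 J0 v0 \<theta>0 T J v \<theta> \<longleftrightarrow>
    (AE z in lborel. z \<in> strip T \<longrightarrow> 0 < J z) \<and>
    L_infty (strip T) J \<and> L_infty (strip T) (\<lambda>z. inverse (J z)) \<and>
    (AE z in lborel. z \<in> strip T \<longrightarrow> 0 \<le> \<theta> z) \<and>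
    (\<exists>Jt Jy Jyt vt vy vyy \<theta>t \<theta>y Fy Py Qy.
      weak_deriv (strip T) (0, 1) J Jt \<and>
      weak_deriv (strip T) (1, 0) J Jy \<and>
      weak_deriv (strip T) (0, 1) Jy Jyt \<and>
      weak_deriv (strip T) (0, 1) v vt \<and>
      weak_deriv (strip T) (1, 0) v vy \<and>
      weak_deriv (strip T) (1, 0) vy vyy \<and>
      weak_deriv (strip T) (0, 1) \<theta> \<theta>t \<and>
      weak_deriv (strip T) (1, 0) \<theta> \<theta>y \<and>
      weak_deriv (strip T) (1, 0) (\<lambda>z. vy z / J z) Fy \<and>
      weak_deriv (strip T) (1, 0) (\<lambda>(y, t). \<rho>0 y / J (y, t) * \<theta> (y, t)) Py \<and>
      weak_deriv (strip T) (1, 0) (\<lambda>z. \<theta>y z / J z) Qy \<and>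
      L_infty_L2 T Jt \<and>
      L_infty_L2 T (\<lambda>(y, t). sqrt (\<rho>0 y) * Jy (y, t)) \<and>
      L_infty_L2 T (\<lambda>(y, t). sqrt (\<rho>0 y) * v (y, t)) \<and>
      L_infty_L2 T (\<lambda>(y, t). sqrt (\<rho>0 y) * (v (y, t))\<^sup>2) \<and>
      L_infty_L2 T vy \<and>
      L_infty_L2 T (\<lambda>(y, t). sqrt (\<rho>0 y) * \<theta> (y, t)) \<and>
      L_infty_L2 T (\<lambda>(y, t). \<rho>0 y powr (3/2) * \<theta>y (y, t)) \<and>
      L2_L2 T (\<lambda>(y, t). sqrt (\<rho>0 y) * Jyt (y, t)) \<and>
      L2_L2 T (\<lambda>z. v z * vy z) \<and>
      L2_L2 T (\<lambda>(y, t). sqrt (\<rho>0 y) * vt (y, t)) \<and>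
      L2_L2 T (\<lambda>(y, t). sqrt (\<rho>0 y) * vyy (y, t)) \<and>
      L2_L2 T \<theta>y \<and>
      L2_L2 T (\<lambda>(y, t). \<rho>0 y * Qy (y, t)) \<and>
      L2_L2 T (\<lambda>(y, t). (\<rho>0 y)\<^sup>2 * \<theta>t (y, t)) \<and>
      (AE (y, t) in lborel. (y, t) \<in> strip T \<longrightarrow>
         Jt (y, t) = vy (y, t) \<and>
         \<rho>0 y * vt (y, t) - \<mu> * Fy (y, t) + R * Py (y, t) = 0 \<and>
         cv * \<rho>0 y * \<theta>t (y, t) - \<kappa> * Qy (y, t)
           + R * (\<rho>0 y / J (y, t)) * \<theta> (y, t) * vy (y, t)
           = \<mu> * (\<bar>vy (y, t)\<bar>\<^sup>2 / J (y, t)))) \<and>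
    attains_initial J J0 \<and> attains_initial v v0 \<and> attains_initial \<theta> \<theta>0"

definition NS_global_solution ::
    "real \<Rightarrow> real \<Rightarrow> real \<Rightarrow> real \<Rightarrow> (real \<Rightarrow> real) \<Rightarrow>
     (real \<Rightarrow> real) \<Rightarrow> (real \<Rightarrow> real) \<Rightarrow> (real \<Rightarrow> real) \<Rightarrow>
     (real \<times> real \<Rightarrow> real) \<Rightarrow> (real \<times> real \<Rightarrow> real) \<Rightarrow> (real \<times> real \<Rightarrow> real) \<Rightarrow> bool" where
  "NS_global_solution \<mu> \<kappa> cv R \<rho>0 J0 v0 \<theta>0 J v \<theta> \<longleftrightarrow>
     (\<forall>T>0. NS_solution \<mu> \<kappa> cv R \<rho>0 J0 v0 \<theta>0 T J v \<theta>)"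

definition adiabatic :: "real \<Rightarrow> real \<Rightarrow> real" where
  "adiabatic cv R = 1 + R / cv"

text \<open>Entropy as a function of the values \<open>r\<close>, \<open>j\<close>, \<open>th\<close> of \<open>\<rho>\<^sub>0\<close>, \<open>J\<close>, \<open>\<theta>\<close> at a point.\<close>

definition entropy :: "real \<Rightarrow> real \<Rightarrow> real \<Rightarrow> real \<Rightarrow> real \<Rightarrow> real \<Rightarrow> ereal" where
  "entropy cv R A r j th =
     (if th = 0 then - \<infinity>
      else ereal (cv * (ln (R / A) + (adiabatic cv R - 1) * ln j + ln th
                        - (adiabatic cv R - 1) * ln r)))"

end

theory Submission
  imports Defs
begin

text \<open>
  Put \<open>\<alpha> = R / c\<^sub>v\<close>. Since \<open>J\<close> is bounded above and below on the strip, the claim is a lower bound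
  \<open>\<theta> \<ge> c \<rho>\<^sub>0\<^sup>\<alpha>\<close>. Completing the square in the viscous heating shows
  \<open>c\<^sub>v \<rho>\<^sub>0 \<theta>\<^sub>t \<ge> \<kappa> (\<theta>\<^sub>y / J)\<^sub>y - R\<^sup>2 \<rho>\<^sub>0\<^sup>2 \<theta>\<^sup>2 / (4 \<mu> J)\<close>, and \<open>\<theta>\<close> is compared with
  \<open>w = \<delta> exp (- K t - E)\<close>, where \<open>E(y, t) = \<integral>\<^sub>0\<^sup>y J e\<close> for a fixed weight \<open>e = e(y)\<close>. Then
  \<open>(w\<^sub>y / J)\<^sub>y = w (J e\<^sup>2 - e')\<close> contains no derivative of \<open>J\<close>, and
  \<open>E\<^sub>t = \<integral>\<^sub>0\<^sup>y v\<^sub>y e\<close> is bounded by the Cauchy--Schwarz inequality as soon as \<open>\<bar>e\<bar> \<le> C \<surd>\<rho>\<^sub>0\<close>; if also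
  \<open>\<bar>e'\<bar> \<le> C \<rho>\<^sub>0\<close>, then \<open>w\<close> is a subsolution for large \<open>K\<close>. It remains to choose \<open>e\<close> such that
  \<open>\<integral>\<^sub>0\<^sup>y J\<^sub>0 e = - \<alpha> ln \<rho>\<^sub>0 + O(1)\<close>, which makes \<open>w\<close> comparable to \<open>\<rho>\<^sub>0\<^sup>\<alpha>\<close>. The comparison
  \<open>w \<le> \<theta>\<close> follows by testing with the square of the positive part of \<open>w - \<theta>\<close> times a spatial cutoff
  of width \<open>N\<close>, whose contribution is \<open>O(1 / N)\<close>.
\<close>

section \<open>Integrals over intervals\<close>

lemma set_integral_combine_ivl:
  fixes g :: "real \<Rightarrow> real"
  assumes "set_integrable lborel {a..c} g" "a \<le> b" "b \<le> c"
  shows "(LINT x:{a..c}|lborel. g x) = (LINT x:{a..b}|lborel. g x) + (LINT x:{b..c}|lborel. g x)"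
proof -
  have "set_integrable lborel {a..b} g" "set_integrable lborel {b..c} g"
    using assms by (auto intro: set_integrable_subset[OF assms(1)])
  then show ?thesis
    using assms Henstock_Kurzweil_Integration.integral_combine[of a b c g]
    by (simp add: set_borel_integral_eq_integral)
qed

lemma set_integral_abs_bound:
  fixes g :: "'a \<Rightarrow> real"
  assumes "set_integrable M A g"
  shows "\<bar>LINT x:A|M. g x\<bar> \<le> (LINT x:A|M. \<bar>g x\<bar>)"
  using set_integral_norm_bound[OF assms] by simp

lemma set_integrable_continuous_compact:
  fixes g :: "'a::euclidean_space \<Rightarrow> real"
  assumes "continuous_on UNIV g" "compact K"
  shows "set_integrable lborel K g"
  unfolding set_integrable_def
  using assms by (intro borel_integrable_compact) (auto intro: continuous_on_subset)

lemma set_integrable_AE_bounded: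
  fixes g :: "'a \<Rightarrow> real"
  assumes [measurable]: "g \<in> borel_measurable M" "A \<in> sets M"
    and "AE x in M. x \<in> A \<longrightarrow> \<bar>g x\<bar> \<le> c" "emeasure M A < \<infinity>"
  shows "set_integrable M A g"
  unfolding set_integrable_def
proof (rule Bochner_Integration.integrable_bound)
  show "integrable M (\<lambda>x. indicat_real A x * c)"
    using assms(2,4) by (intro integrable_mult_left integrable_real_indicator)
  show "(\<lambda>x. indicat_real A x *\<^sub>R g x) \<in> borel_measurable M" by measurable
  show "AE x in M. norm (indicat_real A x *\<^sub>R g x) \<le> norm (indicat_real A x * c)"
    using assms(3) by eventually_elim (auto simp: indicator_def)
qed

lemma set_integrable_mult_bounded:
  fixes g h :: "'a \<Rightarrow> real"
  assumes g: "set_integrable M A g" and h: "set_borel_measurable M A h" and bdd: "bounded (h ` A)"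
  shows "set_integrable M A (\<lambda>x. h x * g x)"
proof -
  obtain C where C: "\<And>x. x \<in> A \<Longrightarrow> \<bar>h x\<bar> \<le> C"
    using bdd by (auto simp: bounded_iff)
  have "(\<lambda>x. indicator A x *\<^sub>R (h x * g x)) = (\<lambda>x. (indicator A x *\<^sub>R h x) * (indicator A x *\<^sub>R g x))"
    by (auto simp: indicator_def)
  then have meas: "set_borel_measurable M A (\<lambda>x. h x * g x)"
    using g h unfolding set_borel_measurable_def set_integrable_def by simp
  show ?thesis
  proof (rule set_integrable_bound[OF set_integrable_mult_right[of C, OF g] meas])
    show "AE x in M. x \<in> A \<longrightarrow> norm (h x * g x) \<le> norm (C * g x)"
      by (intro AE_I2) (auto simp: abs_mult intro!: mult_right_mono order_trans[OF C])
  qed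
qed

lemma set_integrable_mult_continuous:
  fixes g h :: "'a::euclidean_space \<Rightarrow> real"
  assumes h: "continuous_on K h" and K: "compact K" and g: "set_integrable lborel K g"
  shows "set_integrable lborel K (\<lambda>x. h x * g x)"
proof (rule set_integrable_mult_bounded[OF g])
  show "set_borel_measurable lborel K h"
    using borel_measurable_continuous_on_indicator[OF borel_compact[OF K] h]
    unfolding set_borel_measurable_def by simp
  show "bounded (h ` K)" by (intro compact_imp_bounded compact_continuous_image h K)
qed

definition indefinite_integral :: "real \<Rightarrow> (real \<Rightarrow> real) \<Rightarrow> real \<Rightarrow> real" where
  "indefinite_integral c g x = (LBINT s=c..x. g s)"

lemma indefinite_integral_self [simp]: "indefinite_integral c g c = 0"
  by (simp add: indefinite_integral_def)

lemma indefinite_integral_ge: "c \<le> x \<Longrightarrow> indefinite_integral c g x = (LINT s:{c..x}|lborel. g s)"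
  by (simp add: indefinite_integral_def interval_integral_Icc)

lemma indefinite_integral_le: "x \<le> c \<Longrightarrow> indefinite_integral c g x = - (LINT s:{x..c}|lborel. g s)"
  unfolding indefinite_integral_def
  by (subst interval_integral_endpoints_reverse) (simp add: interval_integral_Icc)

text \<open>A formula without case distinction, suited to measurability and Fubini arguments.\<close>

lemma indefinite_integral_eq_LINT:
  "indefinite_integral c g x
    = (LINT s|lborel. (indicat_real {c<..<x} s - indicat_real {x<..<c} s) * g s)"
proof (cases "c \<le> x")
  case True
  then show ?thesis
    by (auto simp: indefinite_integral_def interval_lebesgue_integral_def set_lebesgue_integral_def)
next
  case False
  then have "{c<..<x} = {}" by auto
  then show ?thesis
    using False
    by (simp add: indefinite_integral_def interval_lebesgue_integral_def set_lebesgue_integral_def)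
qed

lemma indefinite_integral_cong_AE:
  assumes [measurable]: "g \<in> borel_measurable borel" "h \<in> borel_measurable borel"
    and eq: "AE s in lborel. g s = h s"
  shows "indefinite_integral c g x = indefinite_integral c h x"
  unfolding indefinite_integral_eq_LINT
  by (rule integral_cong_AE) (use eq in auto)

lemma abs_indefinite_integral_le:
  assumes g: "set_integrable lborel A g" and A: "A \<in> sets borel" "{min c x..max c x} \<subseteq> A"
  shows "\<bar>indefinite_integral c g x\<bar> \<le> (LINT s:A|lborel. \<bar>g s\<bar>)"
proof -
  define I where "I = {min c x..max c x}"
  have gI: "set_integrable lborel I g"
    using A unfolding I_def by (intro set_integrable_subset[OF g]) auto
  have "\<bar>indefinite_integral c g x\<bar> = \<bar>LINT s:I|lborel. g s\<bar>"
    unfolding I_def by (cases "c \<le> x") (simp_all add: indefinite_integral_ge indefinite_integral_le)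
  also have "\<dots> \<le> (LINT s:I|lborel. \<bar>g s\<bar>)" by (rule set_integral_abs_bound[OF gI])
  also have "\<dots> \<le> (LINT s:A|lborel. \<bar>g s\<bar>)"
    using set_integrable_abs[OF gI] set_integrable_abs[OF g] A(2)
    unfolding set_lebesgue_integral_def set_integrable_def I_def
    by (intro integral_mono) (auto simp: indicator_def)
  finally show ?thesis .
qed

lemma borel_measurable_indefinite_integral [measurable (raw)]:
  fixes g :: "'a \<Rightarrow> real \<Rightarrow> real"
  assumes [measurable]: "case_prod g \<in> borel_measurable (M \<Otimes>\<^sub>M borel)" "y \<in> borel_measurable M"
  shows "(\<lambda>z. indefinite_integral c (g z) (y z)) \<in> borel_measurable M"
proof -
  have "case_prod g \<in> borel_measurable (M \<Otimes>\<^sub>M lborel)"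
    using assms(1) by (subst measurable_cong_sets[OF sets_pair_measure_cong[OF refl sets_lborel] refl])
  note [measurable] = this
  have "indefinite_integral c (g z) (y z) = (LINT s|lborel.
      ((if c < s \<and> s < y z then 1 else 0) - (if y z < s \<and> s < c then 1 else 0)) * g z s)" for z
    unfolding indefinite_integral_eq_LINT
    by (intro Bochner_Integration.integral_cong refl) (auto simp: indicator_def)
  then show ?thesis by simp
qed

section \<open>Primitives of locally integrable functions\<close>

definition primitive_on :: "real set \<Rightarrow> (real \<Rightarrow> real) \<Rightarrow> (real \<Rightarrow> real) \<Rightarrow> bool" where
  "primitive_on I u g \<longleftrightarrow> (\<forall>a\<in>I. \<forall>b\<in>I. a \<le> b \<longrightarrow>
     set_integrable lborel {a..b} g \<and> u b - u a = (LINT x:{a..b}|lborel. g x))"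

lemma primitive_onI:
  assumes "\<And>a b. a \<in> I \<Longrightarrow> b \<in> I \<Longrightarrow> a \<le> b \<Longrightarrow> set_integrable lborel {a..b} g"
    and "\<And>a b. a \<in> I \<Longrightarrow> b \<in> I \<Longrightarrow> a \<le> b \<Longrightarrow> u b - u a = (LINT x:{a..b}|lborel. g x)"
  shows "primitive_on I u g"
  using assms unfolding primitive_on_def by blast

lemma primitive_onD:
  assumes "primitive_on I u g" "a \<in> I" "b \<in> I" "a \<le> b"
  shows "set_integrable lborel {a..b} g" "u b - u a = (LINT x:{a..b}|lborel. g x)"
  using assms unfolding primitive_on_def by auto

lemma primitive_on_subset: "primitive_on I u g \<Longrightarrow> K \<subseteq> I \<Longrightarrow> primitive_on K u g"
  unfolding primitive_on_def by blast

lemma is_interval_Icc_subset: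
  fixes I :: "real set"
  assumes "is_interval I" "a \<in> I" "b \<in> I"
  shows "{a..b} \<subseteq> I"
  using assms by (meson atLeastAtMost_iff is_interval_1 subsetI)

lemma primitive_on_cong:
  assumes I: "is_interval I" and u: "primitive_on I u g"
    and "\<And>x. x \<in> I \<Longrightarrow> u x = v x" "\<And>x. x \<in> I \<Longrightarrow> g x = h x"
  shows "primitive_on I v h"
proof (rule primitive_onI)
  fix a b assume ab: "a \<in> I" "b \<in> I" "a \<le> b"
  have gh: "g x = h x" if "x \<in> {a..b}" for x
    using is_interval_Icc_subset[OF I ab(1,2)] assms(4) that by blast
  have "set_integrable lborel {a..b} g \<longleftrightarrow> set_integrable lborel {a..b} h"
    by (rule set_integrable_cong) (auto simp: gh)
  then show "set_integrable lborel {a..b} h" using primitive_onD(1)[OF u ab] by simp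
  have "(LINT x:{a..b}|lborel. g x) = (LINT x:{a..b}|lborel. h x)"
    by (rule set_lebesgue_integral_cong) (auto simp: gh)
  then show "v b - v a = (LINT x:{a..b}|lborel. h x)"
    using primitive_onD(2)[OF u ab] assms(3) ab by simp
qed

lemma primitive_on_cong_deriv_AE:
  assumes I: "is_interval I" and u: "primitive_on I u g"
    and h: "\<And>a b. a \<in> I \<Longrightarrow> b \<in> I \<Longrightarrow> set_borel_measurable lborel {a..b} h"
    and eq: "AE x in lborel. x \<in> I \<longrightarrow> g x = h x"
  shows "primitive_on I u h"
proof -
  have "set_integrable lborel {a..b} h \<and> (LINT x:{a..b}|lborel. h x) = (LINT x:{a..b}|lborel. g x)"
    if ab: "a \<in> I" "b \<in> I" "a \<le> b" for a b
  proof -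
    have "AE x in lborel. indicator {a..b} x *\<^sub>R g x = indicator {a..b} x *\<^sub>R h x"
      using eq is_interval_Icc_subset[OF I ab(1,2)]
      by (auto elim!: eventually_mono simp: indicator_def)
    then show ?thesis
      using primitive_onD(1)[OF u ab] h[OF ab(1,2)] integrable_cong_AE integral_cong_AE
      unfolding set_integrable_def set_borel_measurable_def set_lebesgue_integral_def
      by (metis borel_measurable_integrable)
  qed
  then show ?thesis
    using primitive_onD(2)[OF u] by (intro primitive_onI) auto
qed

lemma primitive_on_indefinite_integral:
  assumes g: "\<And>a b. a \<in> I \<Longrightarrow> b \<in> I \<Longrightarrow> a \<le> b \<Longrightarrow> set_integrable lborel {a..b} g" and c: "c \<in> I"
  shows "primitive_on I (indefinite_integral c g) g"
proof (rule primitive_onI[OF g])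
  fix a b assume ab: "a \<in> I" "b \<in> I" "a \<le> b"
  consider (left) "c \<le> a" | (inside) "a \<le> c" "c \<le> b" | (right) "b \<le> c" by linarith
  then show "indefinite_integral c g b - indefinite_integral c g a = (LINT x:{a..b}|lborel. g x)"
  proof cases
    case left
    then show ?thesis
      using set_integral_combine_ivl[of c b g a] g[of c b] ab c by (simp add: indefinite_integral_ge)
  next
    case inside
    then show ?thesis
      using set_integral_combine_ivl[of a b g c] g[of a b] ab c
      by (simp add: indefinite_integral_ge indefinite_integral_le)
  next
    case right
    then show ?thesis
      using set_integral_combine_ivl[of a c g b] g[of a c] ab c by (simp add: indefinite_integral_le)
  qed
qed

lemma primitive_on_eq_indefinite_integral:
  assumes u: "primitive_on I u g" and "c \<in> I" "x \<in> I"
  shows "u x = u c + indefinite_integral c g x"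
proof (cases "c \<le> x")
  case True
  then show ?thesis using primitive_onD(2)[OF u assms(2,3)] by (simp add: indefinite_integral_ge)
next
  case False
  then show ?thesis using primitive_onD(2)[OF u assms(3,2)] by (simp add: indefinite_integral_le)
qed

lemma primitive_on_continuous_on_Icc:
  assumes u: "primitive_on I u g" and "{a..b} \<subseteq> I"
  shows "continuous_on {a..b} u"
proof (cases "a \<le> b")
  case True
  then have P: "primitive_on {a..b} u g" and a: "a \<in> {a..b}"
    using primitive_on_subset[OF u] assms(2) by auto
  have g: "set_integrable lborel {a..b} g" using primitive_onD(1)[OF P a] True by simp
  have "u x = u a + integral {a..x} g" if x: "x \<in> {a..b}" for x
    using primitive_onD[OF P a x] x by (simp add: set_borel_integral_eq_integral)
  moreover have "continuous_on {a..b} (\<lambda>x. u a + integral {a..x} g)"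
    using g by (intro continuous_intros indefinite_integral_continuous_1)
      (simp add: set_borel_integral_eq_integral)
  ultimately show ?thesis by (rule continuous_on_eq[rotated, OF sym])
qed simp

lemma primitive_on_continuous_on:
  assumes "primitive_on I u g" "open I"
  shows "continuous_on I u"
  unfolding continuous_on_eq_continuous_at[OF assms(2)]
proof
  fix x assume "x \<in> I"
  then obtain e where e: "e > 0" "cball x e \<subseteq> I"
    using assms(2) open_contains_cball by blast
  then have "continuous_on {x - e..x + e} u"
    using primitive_on_continuous_on_Icc[OF assms(1)] by (simp add: cball_eq_atLeastAtMost)
  then show "isCont u x"
    using e(1) by (intro continuous_on_interior[of "{x - e..x + e}"]) auto
qed

lemma primitive_on_lipschitz_on:
  assumes u: "primitive_on I u g" and I: "is_interval I"
    and M: "AE x in lborel. x \<in> I \<longrightarrow> \<bar>g x\<bar> \<le> M" "0 \<le> M"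
  shows "M-lipschitz_on I u"
proof -
  have le: "\<bar>u b - u a\<bar> \<le> M * (b - a)" if ab: "a \<in> I" "b \<in> I" "a \<le> b" for a b
  proof -
    note g = primitive_onD(1)[OF u ab]
    have "AE x in lborel. x \<in> {a..b} \<longrightarrow> \<bar>g x\<bar> \<le> M"
      using M(1) is_interval_Icc_subset[OF I ab(1,2)] by (auto elim!: eventually_mono)
    then have "(LINT x:{a..b}|lborel. \<bar>g x\<bar>) \<le> (LINT x:{a..b}|lborel. M)"
      by (intro set_integral_mono_AE set_integrable_abs[OF g] set_integrable_continuous_compact) auto
    then show ?thesis
      using set_integral_abs_bound[OF g] primitive_onD(2)[OF u ab] ab(3)
      by (simp add: set_lebesgue_integral_def mult.commute)
  qed
  show ?thesis
  proof (rule lipschitz_onI[OF _ M(2)])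
    fix x y assume "x \<in> I" "y \<in> I"
    then show "dist (u x) (u y) \<le> M * dist x y"
      using le[of x y] le[of y x] by (cases "x \<le> y") (auto simp: dist_real_def abs_minus_commute)
  qed
qed

lemma primitive_on_DERIV:
  assumes I: "is_interval I" and d: "\<And>x. x \<in> I \<Longrightarrow> (u has_real_derivative g x) (at x within I)"
    and g: "continuous_on I g"
  shows "primitive_on I u g"
proof -
  have "set_integrable lborel {a..b} g \<and> u b - u a = (LINT x:{a..b}|lborel. g x)"
    if ab: "a \<in> I" "b \<in> I" "a \<le> b" for a b
  proof -
    note sub = is_interval_Icc_subset[OF I ab(1,2)]
    have i: "set_integrable lborel {a..b} g"
      unfolding set_integrable_def
      by (rule borel_integrable_compact) (use continuous_on_subset[OF g sub] in auto)
    have "(g has_integral (u b - u a)) {a..b}"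
      using ab(3) DERIV_subset[OF d sub] sub
      by (intro fundamental_theorem_of_calculus)
        (auto simp: has_real_derivative_iff_has_vector_derivative[symmetric])
    then show ?thesis
      using i by (simp add: set_borel_integral_eq_integral integral_unique)
  qed
  then show ?thesis unfolding primitive_on_def by blast
qed

lemma indefinite_integral_DERIV:
  assumes g: "continuous_on UNIV g"
  shows "(indefinite_integral c g has_real_derivative g x) (at x)"
proof -
  define a b where "a = min c x - 1" and "b = max c x + 1"
  have "(indefinite_integral c g has_vector_derivative g x) (at x within {a..b})"
    unfolding indefinite_integral_def a_def b_def
    by (rule interval_integral_FTC2) (auto intro: continuous_on_subset[OF g])
  moreover have "x \<in> interior {a..b}" by (auto simp: a_def b_def)
  ultimately show ?thesis
    by (simp only: at_within_interior has_real_derivative_iff_has_vector_derivative)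
qed

lemma primitive_on_imp_DERIV:
  assumes u: "primitive_on UNIV u g" and g: "continuous_on UNIV g"
  shows "(u has_real_derivative g x) (at x)"
proof -
  have "((\<lambda>y. u 0 + indefinite_integral 0 g y) has_real_derivative g x) (at x)"
    using DERIV_add[OF DERIV_const indefinite_integral_DERIV[OF g]] by simp
  moreover have "(\<lambda>y. u 0 + indefinite_integral 0 g y) = u"
    using primitive_on_eq_indefinite_integral[OF u] by (intro ext) simp
  ultimately show ?thesis by simp
qed

lemma primitive_on_const: "primitive_on I (\<lambda>x. c) (\<lambda>x. 0)"
  unfolding primitive_on_def by (simp add: set_integrable_def)

lemma primitive_on_add:
  assumes "primitive_on I u g" "primitive_on I v h"
  shows "primitive_on I (\<lambda>x. u x + v x) (\<lambda>x. g x + h x)"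
  using primitive_onD[OF assms(1)] primitive_onD[OF assms(2)]
  by (intro primitive_onI) (auto simp: add_diff_add)

lemma primitive_on_cmult:
  assumes "primitive_on I u g"
  shows "primitive_on I (\<lambda>x. c * u x) (\<lambda>x. c * g x)"
  using primitive_onD[OF assms] by (intro primitive_onI) (auto simp flip: right_diff_distrib)

lemma primitive_on_minus:
  assumes "primitive_on I u g"
  shows "primitive_on I (\<lambda>x. - u x) (\<lambda>x. - g x)"
  using primitive_on_cmult[OF assms, of "-1"] by simp

lemma primitive_on_diff:
  assumes "primitive_on I u g" "primitive_on I v h"
  shows "primitive_on I (\<lambda>x. u x - v x) (\<lambda>x. g x - h x)"
  using primitive_on_add[OF assms(1) primitive_on_minus[OF assms(2)]] by simp

subsection \<open>The chain rule\<close>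

lemma additive_interval_function_eq_0:
  fixes F G :: "real \<Rightarrow> real \<Rightarrow> real"
  assumes ab: "a \<le> b"
    and F: "\<And>c d e. a \<le> c \<Longrightarrow> c \<le> d \<Longrightarrow> d \<le> e \<Longrightarrow> e \<le> b \<Longrightarrow> F c e = F c d + F d e"
    and G: "\<And>c d e. a \<le> c \<Longrightarrow> c \<le> d \<Longrightarrow> d \<le> e \<Longrightarrow> e \<le> b \<Longrightarrow> G c e = G c d + G d e"
    and small: "\<And>\<epsilon> x. 0 < \<epsilon> \<Longrightarrow> x \<in> {a..b} \<Longrightarrow> \<exists>\<delta>>0. \<forall>c e.
      a \<le> c \<longrightarrow> c \<le> x \<longrightarrow> x \<le> e \<longrightarrow> e \<le> b \<longrightarrow> e - c < \<delta> \<longrightarrow> \<bar>F c e\<bar> \<le> \<epsilon> * G c e"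
  shows "F a b = 0"
proof -
  have bound: "\<bar>F a b\<bar> \<le> \<epsilon> * G a b" if \<epsilon>: "0 < \<epsilon>" for \<epsilon>
  proof -
    define P where "P c e \<longleftrightarrow> (a \<le> c \<longrightarrow> e \<le> b \<longrightarrow> \<bar>F c e\<bar> \<le> \<epsilon> * G c e)" for c e
    have "P a b"
      using ab
    proof (induction rule: Bolzano)
      case (trans c d e)
      have "\<bar>F c e\<bar> \<le> \<epsilon> * G c e" if "a \<le> c" "e \<le> b"
      proof -
        have "\<bar>F c d\<bar> \<le> \<epsilon> * G c d" "\<bar>F d e\<bar> \<le> \<epsilon> * G d e"
          using trans that unfolding P_def by auto
        then show ?thesis
          using F[of c d e] G[of c d e] trans that by (simp add: distrib_left)
      qed
      then show ?case unfolding P_def by blast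
    next
      case (local x)
      then show ?case
        using small[OF \<epsilon>, of x] unfolding P_def by auto
    qed
    then show ?thesis unfolding P_def by simp
  qed
  have "\<bar>F a b\<bar> \<le> 0 + \<eta>" if \<eta>: "0 < \<eta>" for \<eta>
  proof -
    have "\<bar>F a b\<bar> \<le> \<eta> / (\<bar>G a b\<bar> + 1) * G a b"
      by (rule bound) (use \<eta> in \<open>simp add: add_nonneg_pos\<close>)
    also have "\<dots> \<le> \<eta> / (\<bar>G a b\<bar> + 1) * (\<bar>G a b\<bar> + 1)"
      using \<eta> by (intro mult_left_mono) auto
    finally show ?thesis by simp
  qed
  then have "\<bar>F a b\<bar> \<le> 0" by (rule field_le_epsilon)
  then show ?thesis by simp
qed

lemma DERIV_increment_mvt:
  fixes \<Phi> :: "real \<Rightarrow> real"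
  assumes "is_interval S" "p \<in> S" "q \<in> S"
    and \<Phi>: "\<And>r. r \<in> S \<Longrightarrow> (\<Phi> has_real_derivative \<phi> r) (at r)"
  obtains \<xi> where "\<xi> \<in> S" "\<Phi> q - \<Phi> p = \<phi> \<xi> * (q - p)"
proof -
  have less: "\<exists>\<xi>\<in>S. \<Phi> y - \<Phi> x = \<phi> \<xi> * (y - x)" if xy: "x \<in> S" "y \<in> S" "x < y" for x y
  proof -
    note sub = is_interval_Icc_subset[OF assms(1) xy(1,2)]
    obtain z where "x < z" "z < y" "\<Phi> y - \<Phi> x = (y - x) * \<phi> z"
      using MVT2[OF xy(3), of \<Phi> \<phi>] \<Phi> sub by (meson atLeastAtMost_iff subsetD)
    then show ?thesis using sub by (intro bexI[of _ z]) auto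
  qed
  consider (below) "p < q" | (above) "q < p" | (equal) "p = q" by linarith
  then show ?thesis
  proof cases
    case below
    then show ?thesis using less[of p q] assms that by blast
  next
    case above
    then obtain \<xi> where "\<xi> \<in> S" "\<Phi> p - \<Phi> q = \<phi> \<xi> * (p - q)" using less[of q p] assms by blast
    then show ?thesis by (intro that) (auto simp: algebra_simps)
  next
    case equal
    then show ?thesis using that[of p] assms by simp
  qed
qed

lemma chain_rule_defect_le:
  assumes ce: "c \<le> e" and u: "primitive_on {c..e} u g"
    and S: "is_interval S" "\<And>y. y \<in> {c..e} \<Longrightarrow> u y \<in> S"
    and \<Phi>: "\<And>r. r \<in> S \<Longrightarrow> (\<Phi> has_real_derivative \<phi> r) (at r)"
    and osc: "\<And>r s. r \<in> S \<Longrightarrow> s \<in> S \<Longrightarrow> \<bar>\<phi> r - \<phi> s\<bar> \<le> \<epsilon>"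
    and int: "set_integrable lborel {c..e} (\<lambda>y. \<phi> (u y) * g y)"
  shows "\<bar>\<Phi> (u e) - \<Phi> (u c) - (LINT y:{c..e}|lborel. \<phi> (u y) * g y)\<bar>
    \<le> \<epsilon> * (LINT y:{c..e}|lborel. \<bar>g y\<bar>)"
proof -
  have ends: "c \<in> {c..e}" "e \<in> {c..e}" using ce by auto
  note g = primitive_onD[OF u ends ce]
  obtain \<xi> where \<xi>: "\<xi> \<in> S" "\<Phi> (u e) - \<Phi> (u c) = \<phi> \<xi> * (u e - u c)"
    using DERIV_increment_mvt[OF S(1) S(2)[OF ends(1)] S(2)[OF ends(2)] \<Phi>] by blast
  have diff: "set_integrable lborel {c..e} (\<lambda>y. \<phi> \<xi> * g y - \<phi> (u y) * g y)"
    using g(1) int by simp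
  have "\<Phi> (u e) - \<Phi> (u c) - (LINT y:{c..e}|lborel. \<phi> (u y) * g y)
      = (LINT y:{c..e}|lborel. \<phi> \<xi> * g y - \<phi> (u y) * g y)"
    using g int \<xi>(2) by simp
  also have "\<bar>\<dots>\<bar> \<le> (LINT y:{c..e}|lborel. \<bar>\<phi> \<xi> * g y - \<phi> (u y) * g y\<bar>)"
    by (rule set_integral_abs_bound[OF diff])
  also have "\<dots> \<le> (LINT y:{c..e}|lborel. \<epsilon> * \<bar>g y\<bar>)"
  proof (rule set_integral_mono[OF set_integrable_abs[OF diff]])
    show "set_integrable lborel {c..e} (\<lambda>y. \<epsilon> * \<bar>g y\<bar>)"
      using set_integrable_abs[OF g(1)] by simp
    fix y assume "y \<in> {c..e}"
    then have "\<bar>\<phi> \<xi> - \<phi> (u y)\<bar> * \<bar>g y\<bar> \<le> \<epsilon> * \<bar>g y\<bar>"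
      using \<xi>(1) S(2) osc by (intro mult_right_mono) auto
    then show "\<bar>\<phi> \<xi> * g y - \<phi> (u y) * g y\<bar> \<le> \<epsilon> * \<bar>g y\<bar>"
      by (simp add: abs_mult[symmetric] left_diff_distrib)
  qed
  finally show ?thesis by simp
qed

lemma chain_rule_defect_locally_small:
  assumes u: "primitive_on {a..b} u g" and S: "open S" "\<And>y. y \<in> {a..b} \<Longrightarrow> u y \<in> S"
    and \<Phi>: "\<And>r. r \<in> S \<Longrightarrow> (\<Phi> has_real_derivative \<phi> r) (at r)" and \<phi>: "continuous_on S \<phi>"
    and int: "set_integrable lborel {a..b} (\<lambda>y. \<phi> (u y) * g y)"
    and \<epsilon>: "0 < \<epsilon>" and x: "x \<in> {a..b}"
  shows "\<exists>\<delta>>0. \<forall>c e. a \<le> c \<longrightarrow> c \<le> x \<longrightarrow> x \<le> e \<longrightarrow> e \<le> b \<longrightarrow> e - c < \<delta> \<longrightarrow>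
    \<bar>\<Phi> (u e) - \<Phi> (u c) - (LINT y:{c..e}|lborel. \<phi> (u y) * g y)\<bar> \<le> \<epsilon> * (LINT y:{c..e}|lborel. \<bar>g y\<bar>)"
proof -
  have "isCont \<phi> (u x)" using \<phi> S x by (simp add: continuous_on_eq_continuous_at)
  then obtain \<eta> where \<eta>: "0 < \<eta>" "\<And>r. dist r (u x) < \<eta> \<Longrightarrow> dist (\<phi> r) (\<phi> (u x)) < \<epsilon> / 2"
    using \<epsilon> unfolding continuous_at_eps_delta dist_real_def by (meson half_gt_zero)
  obtain \<eta>' where \<eta>': "0 < \<eta>'" "ball (u x) \<eta>' \<subseteq> S" using S x by (meson open_contains_ball)
  define B where "B = ball (u x) (min \<eta> \<eta>')"
  have B: "B \<subseteq> S" "is_interval B" using \<eta>' by (auto simp: B_def is_interval_ball_real)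
  have osc: "\<bar>\<phi> r - \<phi> s\<bar> \<le> \<epsilon>" if "r \<in> B" "s \<in> B" for r s
    using \<eta>(2)[of r] \<eta>(2)[of s] that dist_triangle_less_add[of "\<phi> r" "\<phi> (u x)" "\<epsilon> / 2" "\<phi> s" "\<epsilon> / 2"]
    by (simp add: B_def dist_commute dist_real_def)
  have "0 < min \<eta> \<eta>'" using \<eta>(1) \<eta>'(1) by simp
  with primitive_on_continuous_on_Icc[OF u order_refl] x
  have "\<exists>\<delta>>0. \<forall>y\<in>{a..b}. dist y x < \<delta> \<longrightarrow> dist (u y) (u x) < min \<eta> \<eta>'"
    unfolding continuous_on_iff by blast
  then obtain \<delta> where \<delta>: "0 < \<delta>" "\<And>y. y \<in> {a..b} \<Longrightarrow> dist y x < \<delta> \<Longrightarrow> u y \<in> B"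
    unfolding B_def mem_ball dist_commute[of "u x"] by blast
  have "\<bar>\<Phi> (u e) - \<Phi> (u c) - (LINT y:{c..e}|lborel. \<phi> (u y) * g y)\<bar> \<le> \<epsilon> * (LINT y:{c..e}|lborel. \<bar>g y\<bar>)"
    if ce: "a \<le> c" "c \<le> x" "x \<le> e" "e \<le> b" "e - c < \<delta>" for c e
  proof (rule chain_rule_defect_le[OF _ _ B(2) _ _ osc])
    show "c \<le> e" using ce by linarith
    show "primitive_on {c..e} u g" by (rule primitive_on_subset[OF u]) (use ce in auto)
    show "u y \<in> B" if "y \<in> {c..e}" for y
      using \<delta>(2)[of y] ce that by (auto simp: dist_real_def)
    show "(\<Phi> has_real_derivative \<phi> r) (at r)" if "r \<in> B" for r using \<Phi> B(1) that by blast
    show "set_integrable lborel {c..e} (\<lambda>y. \<phi> (u y) * g y)"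
      by (rule set_integrable_subset[OF int]) (use ce in auto)
  qed
  then show ?thesis using \<delta>(1) by blast
qed

lemma primitive_on_chain:
  assumes I: "is_interval I" and u: "primitive_on I u g"
    and S: "open S" "\<And>x. x \<in> I \<Longrightarrow> u x \<in> S"
    and \<Phi>: "\<And>r. r \<in> S \<Longrightarrow> (\<Phi> has_real_derivative \<phi> r) (at r)" and \<phi>: "continuous_on S \<phi>"
  shows "primitive_on I (\<lambda>x. \<Phi> (u x)) (\<lambda>x. \<phi> (u x) * g x)"
proof (rule primitive_onI)
  fix a b assume ab: "a \<in> I" "b \<in> I" "a \<le> b"
  note sub = is_interval_Icc_subset[OF I ab(1,2)]
  have u_ab: "primitive_on {a..b} u g" by (rule primitive_on_subset[OF u sub])
  show int: "set_integrable lborel {a..b} (\<lambda>x. \<phi> (u x) * g x)"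
  proof (rule set_integrable_mult_continuous[OF _ compact_Icc primitive_onD(1)[OF u ab]])
    show "continuous_on {a..b} (\<lambda>x. \<phi> (u x))"
      by (rule continuous_on_compose2[OF \<phi> primitive_on_continuous_on_Icc[OF u sub]])
        (use sub S in auto)
  qed
  define defect where "defect c e = \<Phi> (u e) - \<Phi> (u c) - (LINT x:{c..e}|lborel. \<phi> (u x) * g x)" for c e
  define variation where "variation c e = (LINT x:{c..e}|lborel. \<bar>g x\<bar>)" for c e
  have "defect a b = 0"
  proof (rule additive_interval_function_eq_0[of a b defect variation, OF ab(3)])
    fix c d e assume cde: "a \<le> c" "c \<le> d" "d \<le> e" "e \<le> b"
    then have subset: "{c..e} \<subseteq> {a..b}" by auto
    show "defect c e = defect c d + defect d e"
      unfolding defect_def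
      using set_integral_combine_ivl[OF set_integrable_subset[OF int _ subset] cde(2,3)] by simp
    show "variation c e = variation c d + variation d e"
      unfolding variation_def
      using primitive_onD(1)[OF u ab] subset cde
      by (intro set_integral_combine_ivl set_integrable_abs) (auto intro: set_integrable_subset)
  next
    fix \<epsilon> x :: real assume "0 < \<epsilon>" "x \<in> {a..b}"
    then show "\<exists>\<delta>>0. \<forall>c e. a \<le> c \<longrightarrow> c \<le> x \<longrightarrow> x \<le> e \<longrightarrow> e \<le> b \<longrightarrow> e - c < \<delta> \<longrightarrow>
        \<bar>defect c e\<bar> \<le> \<epsilon> * variation c e"
      unfolding defect_def variation_def
      using sub S by (intro chain_rule_defect_locally_small[OF u_ab S(1) _ \<Phi> \<phi> int]) auto
  qed
  then show "\<Phi> (u b) - \<Phi> (u a) = (LINT x:{a..b}|lborel. \<phi> (u x) * g x)" by (simp add: defect_def)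
qed

lemma primitive_on_mult:
  assumes I: "is_interval I" and u: "primitive_on I u g" and v: "primitive_on I v h"
  shows "primitive_on I (\<lambda>x. u x * v x) (\<lambda>x. u x * h x + g x * v x)"
proof -
  have square: "primitive_on I (\<lambda>x. (w x)\<^sup>2) (\<lambda>x. (2 * w x) * k x)" if "primitive_on I w k" for w k
    by (rule primitive_on_chain[OF I that open_UNIV, where \<phi> = "\<lambda>r. 2 * r"])
       (auto intro!: derivative_eq_intros continuous_intros)
  have "primitive_on I (\<lambda>x. (1/4) * ((u x + v x)\<^sup>2 - (u x - v x)\<^sup>2))
     (\<lambda>x. (1/4) * ((2 * (u x + v x)) * (g x + h x) - (2 * (u x - v x)) * (g x - h x)))"
    by (intro primitive_on_cmult primitive_on_diff square primitive_on_add u v)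
  then show ?thesis
    by (rule primitive_on_cong[OF I]) (simp_all add: power2_eq_square field_simps)
qed

section \<open>Smooth test functions\<close>

lemma C_k_SucI:
  assumes "\<And>x. (f has_derivative f' x) (at x)" "\<And>b. b \<in> Basis \<Longrightarrow> C_k k (\<lambda>x. f' x b)"
  shows "C_k (Suc k) f"
proof -
  have "frechet_derivative f (at x) = f' x" for x
    using frechet_derivative_at[OF assms(1)] by simp
  moreover have "f differentiable_on UNIV"
    using assms(1) by (auto simp: differentiable_on_def differentiable_def)
  ultimately show ?thesis using assms(2) by simp
qed

lemma C_k_SucD:
  assumes "C_k (Suc k) f"
  shows "(f has_derivative frechet_derivative f (at x)) (at x)"
    and "b \<in> Basis \<Longrightarrow> C_k k (\<lambda>x. frechet_derivative f (at x) b)"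
  using assms by (auto simp: differentiable_on_def frechet_derivative_works)

lemma C_k_Suc_imp: "C_k (Suc k) f \<Longrightarrow> C_k k f"
proof (induction k arbitrary: f)
  case 0
  then show ?case by (auto intro: differentiable_imp_continuous_on)
next
  case (Suc k)
  then show ?case by simp
qed

lemma C_k_const: "C_k k (\<lambda>x. c)"
proof (induction k arbitrary: c)
  case (Suc k)
  show ?case by (rule C_k_SucI[where f' = "\<lambda>x b. 0"]) (auto simp: Suc)
qed simp

lemma C_k_add: "C_k k f \<Longrightarrow> C_k k g \<Longrightarrow> C_k k (\<lambda>x. f x + g x)"
proof (induction k arbitrary: f g)
  case 0
  then show ?case by (auto intro: continuous_on_add)
next
  case (Suc k)
  show ?case
    by (rule C_k_SucI[OF has_derivative_add[OF C_k_SucD(1)[OF Suc.prems(1)] C_k_SucD(1)[OF Suc.prems(2)]]])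
       (intro Suc.IH C_k_SucD(2)[OF Suc.prems(1)] C_k_SucD(2)[OF Suc.prems(2)])
qed

lemma C_k_mult: "C_k k f \<Longrightarrow> C_k k g \<Longrightarrow> C_k k (\<lambda>x. f x * g x)"
proof (induction k arbitrary: f g)
  case 0
  then show ?case by (auto intro: continuous_on_mult)
next
  case (Suc k)
  show ?case
    by (rule C_k_SucI[OF has_derivative_mult[OF C_k_SucD(1)[OF Suc.prems(1)] C_k_SucD(1)[OF Suc.prems(2)]]])
       (intro C_k_add Suc.IH C_k_SucD(2)[OF Suc.prems(1)] C_k_SucD(2)[OF Suc.prems(2)]
         C_k_Suc_imp[OF Suc.prems(1)] C_k_Suc_imp[OF Suc.prems(2)])
qed

lemma C_k_cmult: "C_k k f \<Longrightarrow> C_k k (\<lambda>x. c * f x)"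
  by (rule C_k_mult[OF C_k_const])

lemma C_k_diff: "C_k k f \<Longrightarrow> C_k k g \<Longrightarrow> C_k k (\<lambda>x. f x - g x)"
  using C_k_add[of k f "\<lambda>x. (-1) * g x"] C_k_cmult[of k g "-1"] by simp

lemma C_k_compose_affine:
  fixes f :: "real \<Rightarrow> real" and m :: "'a::euclidean_space \<Rightarrow> real"
  assumes "C_k k f" and m: "\<And>z. (m has_derivative l) (at z)"
  shows "C_k k (\<lambda>z. f (m z))"
  using assms(1)
proof (induction k arbitrary: f)
  case 0
  have "continuous_on UNIV m"
    using m by (auto intro!: continuous_at_imp_continuous_on has_derivative_continuous)
  then show ?case using 0 by (auto intro: continuous_on_compose2)
next
  case (Suc k)
  show ?case
  proof (rule C_k_SucI)
    fix z
    show "((\<lambda>z. f (m z)) has_derivative (\<lambda>b. frechet_derivative f (at (m z)) (l b))) (at z)"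
      by (rule has_derivative_compose[OF m C_k_SucD(1)[OF Suc.prems]])
  next
    fix b :: 'a assume "b \<in> Basis"
    have lin: "frechet_derivative f (at (m z)) (l b) = l b * frechet_derivative f (at (m z)) 1" for z
    proof -
      have "linear (frechet_derivative f (at (m z)))"
        using C_k_SucD(1)[OF Suc.prems] by (rule has_derivative_linear)
      from linear_cmul[OF this, of "l b" 1] show ?thesis by simp
    qed
    have "C_k k (\<lambda>z. l b * frechet_derivative f (at (m z)) 1)"
      by (intro C_k_cmult Suc.IH C_k_SucD(2)[OF Suc.prems]) simp
    then show "C_k k (\<lambda>z. frechet_derivative f (at (m z)) (l b))"
      by (simp add: lin)
  qed
qed

lemma C_k_real_SucI:
  assumes "\<And>x. (f has_real_derivative f' x) (at x)" "C_k k f'"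
  shows "C_k (Suc k) f"
  by (rule C_k_SucI[where f' = "\<lambda>x b. f' x * b"])
     (use assms in \<open>auto simp: has_field_derivative_def Basis_real_def\<close>)

lemma C_k_real_DERIV:
  assumes "C_k (Suc k) f"
  shows "(f has_real_derivative deriv f x) (at x)" "C_k k (deriv f)"
proof -
  have d: "(f has_real_derivative deriv f x) (at x)" for x
  proof -
    have "f differentiable (at x)" using C_k_SucD(1)[OF assms] by (auto simp: differentiable_def)
    then show ?thesis
      using DERIV_deriv_iff_real_differentiable by blast
  qed
  then show "(f has_real_derivative deriv f x) (at x)" .
  have "frechet_derivative f (at x) 1 = deriv f x" for x
    using frechet_derivative_at[OF d[of x, unfolded has_field_derivative_def]]
    by (metis mult.right_neutral)
  then show "C_k k (deriv f)" using C_k_SucD(2)[OF assms, of 1] by simp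
qed

definition flat :: "nat \<Rightarrow> real \<Rightarrow> real" where
  "flat m x = (if x \<le> 0 then 0 else exp (- (1 / x)) / x ^ m)"

lemma flat_tendsto_0: "(flat m \<longlongrightarrow> 0) (at 0)"
proof -
  have l: "(flat m \<longlongrightarrow> 0) (at_left 0)"
  proof (rule tendsto_eventually)
    show "\<forall>\<^sub>F x in at_left 0. flat m x = 0"
      using eventually_at_left_real[of "-1" 0] by (auto elim!: eventually_mono simp: flat_def)
  qed
  have "((\<lambda>x::real. (inverse x) ^ m / exp (inverse x)) \<longlongrightarrow> 0) (at_right 0)"
    by (rule filterlim_compose[OF tendsto_power_div_exp_0 filterlim_inverse_at_top_right])
  moreover have "\<forall>\<^sub>F x in at_right 0. (inverse x) ^ m / exp (inverse x) = flat m x"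
    using eventually_at_right_real[of 0 1]
    by (auto elim!: eventually_mono simp: flat_def exp_minus field_simps power_inverse inverse_eq_divide)
  ultimately have r: "(flat m \<longlongrightarrow> 0) (at_right 0)"
    by (rule Lim_transform_eventually)
  show ?thesis using l r by (simp add: filterlim_at_split)
qed

lemma flat_DERIV: "(flat m has_real_derivative (flat (m + 2) x - real m * flat (m + 1) x)) (at x)"
proof -
  consider (negative) "x < 0" | (zero) "x = 0" | (positive) "x > 0" by linarith
  then show ?thesis
  proof cases
    case negative
    have "((\<lambda>x. 0) has_real_derivative 0) (at x)" by simp
    then have "(flat m has_real_derivative 0) (at x)"
      by (rule has_field_derivative_transform_within_open[of _ _ _ "{..<0}"])
         (use negative in \<open>auto simp: flat_def\<close>)
    then show ?thesis using negative by (simp add: flat_def)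
  next
    case zero
    have "((\<lambda>h. (flat m (0 + h) - flat m 0) / h) \<longlongrightarrow> 0) (at 0)"
      by (rule Lim_transform_eventually[OF flat_tendsto_0[of "m + 1"]])
         (auto simp: eventually_at_filter flat_def field_simps)
    then have "(flat m has_real_derivative 0) (at 0)" by (simp add: DERIV_def)
    then show ?thesis using zero by (simp add: flat_def)
  next
    case positive
    have "((\<lambda>x. exp (- (1 / x)) / x ^ m) has_real_derivative
        (flat (m + 2) x - real m * flat (m + 1) x)) (at x)"
    proof (cases m)
      case 0
      show ?thesis using positive unfolding 0
        by (auto intro!: derivative_eq_intros simp: flat_def field_simps power2_eq_square)
    next
      case (Suc n)
      show ?thesis using positive unfolding Suc
        by (auto intro!: derivative_eq_intros simp: flat_def)
           (cases n; auto simp: field_simps power2_eq_square)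
    qed
    then show ?thesis
      by (rule has_field_derivative_transform_within_open[of _ _ _ "{0<..}"])
         (use positive in \<open>auto simp: flat_def\<close>)
  qed
qed

lemma C_k_flat: "C_k k (flat m)"
proof (induction k arbitrary: m)
  case 0
  show ?case
    using flat_DERIV by (auto intro!: continuous_at_imp_continuous_on DERIV_isCont)
next
  case (Suc k)
  show ?case
    by (rule C_k_real_SucI[OF flat_DERIV]) (intro C_k_diff C_k_cmult Suc)
qed

definition smooth_plateau :: "real \<Rightarrow> real \<Rightarrow> nat \<Rightarrow> real \<Rightarrow> real" where
  "smooth_plateau a b n x = flat 0 (real (Suc n) * (x - a)) * flat 0 (real (Suc n) * (b - x))"

lemma C_k_smooth_plateau: "C_k k (smooth_plateau a b n)"
proof -
  have "C_k k (\<lambda>x. flat 0 (real (Suc n) * (x - a)))"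
    by (rule C_k_compose_affine[OF C_k_flat, where l = "\<lambda>h. real (Suc n) * h"])
      (auto intro!: derivative_eq_intros)
  moreover have "C_k k (\<lambda>x. flat 0 (real (Suc n) * (b - x)))"
    by (rule C_k_compose_affine[OF C_k_flat, where l = "\<lambda>h. real (Suc n) * (- h)"])
      (auto intro!: derivative_eq_intros)
  ultimately show ?thesis
    unfolding smooth_plateau_def[abs_def] by (rule C_k_mult)
qed

lemma smooth_plateau_bounds: "0 \<le> smooth_plateau a b n x" "smooth_plateau a b n x \<le> 1"
  by (auto simp: smooth_plateau_def flat_def intro!: mult_le_one)

lemma smooth_plateau_pos: "x \<in> {a<..<b} \<Longrightarrow> 0 < smooth_plateau a b n x"
  by (simp add: smooth_plateau_def flat_def not_le)

lemma smooth_plateau_eq_0: "x \<notin> {a<..<b} \<Longrightarrow> smooth_plateau a b n x = 0"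
  by (auto simp: smooth_plateau_def flat_def mult_le_0_iff not_less)

lemma smooth_plateau_tendsto_indicator:
  "(\<lambda>n. smooth_plateau a b n x) \<longlonglongrightarrow> indicator {a<..<b} x"
proof (cases "x \<in> {a<..<b}")
  case True
  have lim: "(\<lambda>n. flat 0 (real (Suc n) * c)) \<longlonglongrightarrow> 1" if c: "c > 0" for c
  proof -
    have "(\<lambda>n. exp (- (inverse c * inverse (real (Suc n))))) \<longlonglongrightarrow> exp (- (inverse c * 0))"
      by (intro tendsto_intros LIMSEQ_inverse_real_of_nat)
    moreover have "exp (- (inverse c * inverse (real (Suc n)))) = flat 0 (real (Suc n) * c)" for n
    proof -
      have "\<not> real (Suc n) * c \<le> 0" using c by (simp add: mult_le_0_iff)
      then show ?thesis by (simp add: flat_def field_simps inverse_eq_divide)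
    qed
    ultimately show ?thesis by simp
  qed
  have "(\<lambda>n. smooth_plateau a b n x) \<longlonglongrightarrow> 1 * 1"
    unfolding smooth_plateau_def by (intro tendsto_mult lim) (use True in auto)
  then show ?thesis using True by simp
next
  case False
  then show ?thesis by (simp add: smooth_plateau_eq_0)
qed

subsection \<open>Test functions\<close>

lemma test_functionE:
  assumes "test_function \<Omega> \<phi>"
  obtains K where "compact K" "K \<subseteq> \<Omega>" "\<And>x. x \<notin> K \<Longrightarrow> \<phi> x = 0"
  using assms unfolding test_function_def by blast

lemma test_function_C_k: "test_function \<Omega> \<phi> \<Longrightarrow> C_k k \<phi>"
  by (simp add: test_function_def)

lemma test_functionI:
  assumes "\<And>k. C_k k \<phi>" "compact K" "K \<subseteq> \<Omega>" "\<And>x. x \<notin> K \<Longrightarrow> \<phi> x = 0"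
  shows "test_function \<Omega> \<phi>"
  using assms unfolding test_function_def by blast

lemma test_function_continuous_on: "test_function \<Omega> \<phi> \<Longrightarrow> continuous_on UNIV \<phi>"
  using test_function_C_k[of \<Omega> \<phi> 0] by simp

lemma test_function_borel_measurable: "test_function \<Omega> \<phi> \<Longrightarrow> \<phi> \<in> borel_measurable borel"
  by (intro borel_measurable_continuous_onI test_function_continuous_on)

lemma test_function_eq_0: "test_function \<Omega> \<phi> \<Longrightarrow> x \<notin> \<Omega> \<Longrightarrow> \<phi> x = 0"
  by (meson subsetD test_functionE)

lemma test_function_DERIV:
  fixes \<psi> :: "real \<Rightarrow> real"
  assumes "test_function I \<psi>"
  shows "(\<psi> has_real_derivative deriv \<psi> x) (at x)"
  by (rule C_k_real_DERIV(1)[OF test_function_C_k[OF assms]])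

lemma test_function_deriv:
  fixes \<psi> :: "real \<Rightarrow> real"
  assumes "test_function I \<psi>"
  shows "test_function I (deriv \<psi>)"
proof -
  obtain K where K: "compact K" "K \<subseteq> I" "\<And>x. x \<notin> K \<Longrightarrow> \<psi> x = 0"
    using test_functionE[OF assms] by blast
  show ?thesis
  proof (rule test_functionI[OF C_k_real_DERIV(2)[OF test_function_C_k[OF assms]] K(1,2)])
    fix x assume x: "x \<notin> K"
    have "((\<lambda>x. 0) has_real_derivative 0) (at x)" by simp
    then have "(\<psi> has_real_derivative 0) (at x)"
      by (rule has_field_derivative_transform_within_open[of _ _ _ "- K"])
         (use K x in \<open>auto simp: compact_imp_closed open_Compl\<close>)
    then show "deriv \<psi> x = 0" by (rule DERIV_imp_deriv)
  qed
qed

lemma test_function_diff: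
  assumes "test_function \<Omega> \<phi>" "test_function \<Omega> \<psi>"
  shows "test_function \<Omega> (\<lambda>x. \<phi> x - \<psi> x)"
proof -
  obtain K L where K: "compact K" "K \<subseteq> \<Omega>" "\<And>x. x \<notin> K \<Longrightarrow> \<phi> x = 0"
    and L: "compact L" "L \<subseteq> \<Omega>" "\<And>x. x \<notin> L \<Longrightarrow> \<psi> x = 0"
    using test_functionE[OF assms(1)] test_functionE[OF assms(2)] by metis
  show ?thesis
    by (rule test_functionI[of _ "K \<union> L"])
      (use K L assms in \<open>auto intro: C_k_diff test_function_C_k\<close>)
qed

lemma test_function_cmult: "test_function \<Omega> \<phi> \<Longrightarrow> test_function \<Omega> (\<lambda>x. c * \<phi> x)"
  unfolding test_function_def by (auto intro: C_k_cmult)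

lemma test_function_smooth_plateau:
  assumes "{a..b} \<subseteq> I"
  shows "test_function I (smooth_plateau a b n)"
  by (rule test_functionI[OF C_k_smooth_plateau compact_Icc assms]) (auto intro: smooth_plateau_eq_0)

lemma test_function_tensor:
  fixes \<psi> \<phi> :: "real \<Rightarrow> real"
  assumes "test_function I1 \<psi>" "test_function I2 \<phi>"
  shows "test_function (I1 \<times> I2) (\<lambda>z. \<psi> (fst z) * \<phi> (snd z))"
proof -
  obtain K L where K: "compact K" "K \<subseteq> I1" "\<And>x. x \<notin> K \<Longrightarrow> \<psi> x = 0"
    and L: "compact L" "L \<subseteq> I2" "\<And>x. x \<notin> L \<Longrightarrow> \<phi> x = 0"
    using test_functionE[OF assms(1)] test_functionE[OF assms(2)] by metis
  show ?thesis
  proof (rule test_functionI[OF _ compact_Times[OF K(1) L(1)]])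
    show "C_k k (\<lambda>z. \<psi> (fst z) * \<phi> (snd z))" for k
      using test_function_C_k[OF assms(1)] test_function_C_k[OF assms(2)]
      by (intro C_k_mult C_k_compose_affine[of k \<psi> fst fst] C_k_compose_affine[of k \<phi> snd snd])
        (auto intro!: derivative_eq_intros)
    show "K \<times> L \<subseteq> I1 \<times> I2" using K(2) L(2) by auto
    show "\<psi> (fst z) * \<phi> (snd z) = 0" if "z \<notin> K \<times> L" for z
      using K(3)[of "fst z"] L(3)[of "snd z"] that by (auto simp: mem_Times_iff)
  qed
qed

lemma frechet_derivative_tensor:
  fixes \<psi> \<phi> :: "real \<Rightarrow> real"
  assumes "test_function I1 \<psi>" "test_function I2 \<phi>"
  shows "frechet_derivative (\<lambda>z. \<psi> (fst z) * \<phi> (snd z)) (at z) (1, 0) = deriv \<psi> (fst z) * \<phi> (snd z)"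
    and "frechet_derivative (\<lambda>z. \<psi> (fst z) * \<phi> (snd z)) (at z) (0, 1) = \<psi> (fst z) * deriv \<phi> (snd z)"
proof -
  have "((\<lambda>z. \<psi> (fst z) * \<phi> (snd z)) has_derivative
      (\<lambda>h. \<psi> (fst z) * (deriv \<phi> (snd z) * snd h) + (deriv \<psi> (fst z) * fst h) * \<phi> (snd z))) (at z)"
    using test_function_DERIV[OF assms(1)] test_function_DERIV[OF assms(2)]
    unfolding has_field_derivative_def
    by (intro has_derivative_mult has_derivative_compose[of fst fst z UNIV \<psi>]
        has_derivative_compose[of snd snd z UNIV \<phi>] derivative_eq_intros) auto
  note fr = frechet_derivative_at[OF this, symmetric]
  show "frechet_derivative (\<lambda>z. \<psi> (fst z) * \<phi> (snd z)) (at z) (1, 0) = deriv \<psi> (fst z) * \<phi> (snd z)"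
    "frechet_derivative (\<lambda>z. \<psi> (fst z) * \<phi> (snd z)) (at z) (0, 1) = \<psi> (fst z) * deriv \<phi> (snd z)"
    by (simp_all add: fr)
qed

lemma frechet_derivative_eq_deriv:
  fixes \<psi> :: "real \<Rightarrow> real"
  assumes "(\<psi> has_real_derivative d) (at x)"
  shows "frechet_derivative \<psi> (at x) 1 = d"
  using frechet_derivative_at[OF assms[unfolded has_field_derivative_def], symmetric] by simp

lemma compact_subset_open_intervalE:
  fixes K I :: "real set"
  assumes "compact K" "K \<subseteq> I" "open I" "is_interval I" "I \<noteq> {}"
  obtains a b where "a < b" "{a..b} \<subseteq> I" "K \<subseteq> {a<..<b}"
proof -
  obtain x where "x \<in> I" using assms(5) by blast
  define L where "L = insert x K"
  have L: "compact L" "L \<noteq> {}" "L \<subseteq> I" using assms \<open>x \<in> I\<close> by (auto simp: L_def)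
  obtain l where l: "l \<in> L" "\<And>y. y \<in> L \<Longrightarrow> l \<le> y" using compact_attains_inf[OF L(1,2)] by blast
  obtain u where u: "u \<in> L" "\<And>y. y \<in> L \<Longrightarrow> y \<le> u" using compact_attains_sup[OF L(1,2)] by blast
  obtain d e where d: "d > 0" "cball l d \<subseteq> I" and e: "e > 0" "cball u e \<subseteq> I"
    using assms(3) L(3) l(1) u(1) open_contains_cball by (metis subsetD)
  show ?thesis
  proof
    have in_I: "l - d \<in> I" "u + e \<in> I"
      using d(1) e(1) by (intro subsetD[OF d(2)] subsetD[OF e(2)]; simp add: dist_real_def)+
    show "l - d < u + e" using l(2)[OF u(1)] d(1) e(1) by linarith
    show "{l - d..u + e} \<subseteq> I" by (rule is_interval_Icc_subset[OF assms(4) in_I])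
    show "K \<subseteq> {l - d<..<u + e}" using l(2) u(2) d(1) e(1) unfolding L_def by force
  qed
qed

section \<open>Locally integrable functions and weak derivatives\<close>

lemma borel_measurable_fst_snd [measurable]:
  "(fst :: 'a::euclidean_space \<times> 'b::euclidean_space \<Rightarrow> 'a) \<in> borel_measurable borel"
  "(snd :: 'a::euclidean_space \<times> 'b::euclidean_space \<Rightarrow> 'b) \<in> borel_measurable borel"
  by (auto intro!: borel_measurable_continuous_onI continuous_intros)

lemma locally_integrableD: "locally_integrable \<Omega> h \<Longrightarrow> compact K \<Longrightarrow> K \<subseteq> \<Omega> \<Longrightarrow> set_integrable lborel K h"
  by (simp add: locally_integrable_def)

lemma locally_integrable_diff:
  "locally_integrable \<Omega> f \<Longrightarrow> locally_integrable \<Omega> g \<Longrightarrow> locally_integrable \<Omega> (\<lambda>x. f x - g x)"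
  unfolding locally_integrable_def by auto

lemma continuous_on_imp_locally_integrable:
  assumes "continuous_on \<Omega> h"
  shows "locally_integrable \<Omega> h"
  unfolding locally_integrable_def set_integrable_def
  using assms by (intro allI impI borel_integrable_compact) (auto intro: continuous_on_subset)

lemma borel_measurable_locally_integrable:
  fixes f :: "'a::euclidean_space \<Rightarrow> real"
  assumes "locally_integrable UNIV f"
  shows "f \<in> borel_measurable borel"
proof (rule borel_measurable_LIMSEQ_real)
  show "(\<lambda>x. indicator (cball 0 (real n)) x *\<^sub>R f x) \<in> borel_measurable borel" for n
    using borel_measurable_integrable locally_integrableD[OF assms, of "cball 0 (real n)"]
    unfolding set_integrable_def by fastforce
  show "(\<lambda>n. indicator (cball 0 (real n)) x *\<^sub>R f x) \<longlonglongrightarrow> f x" for x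
  proof (rule tendsto_eventually)
    obtain n where "norm x \<le> real n" using real_arch_simple by blast
    then show "\<forall>\<^sub>F n in sequentially. indicator (cball 0 (real n)) x *\<^sub>R f x = f x"
      by (intro eventually_sequentiallyI[of n]) (auto simp: indicator_def)
  qed
qed

lemma integrable_mult_test_function:
  assumes "locally_integrable \<Omega> h" "test_function \<Omega> \<phi>"
  shows "integrable lborel (\<lambda>x. h x * \<phi> x)"
proof -
  obtain K where K: "compact K" "K \<subseteq> \<Omega>" "\<And>x. x \<notin> K \<Longrightarrow> \<phi> x = 0"
    using test_functionE[OF assms(2)] by blast
  have "set_integrable lborel K (\<lambda>x. \<phi> x * h x)"
    using K assms
    by (intro set_integrable_mult_continuous locally_integrableD[OF assms(1)]
        continuous_on_subset[OF test_function_continuous_on[OF assms(2)]]) auto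
  moreover have "(\<lambda>x. indicator K x *\<^sub>R (\<phi> x * h x)) = (\<lambda>x. h x * \<phi> x)"
    using K(3) by (fastforce simp: indicator_def)
  ultimately show ?thesis by (simp add: set_integrable_def)
qed

lemma test_function_integrable: "test_function \<Omega> \<phi> \<Longrightarrow> integrable lborel \<phi>"
  using integrable_mult_test_function[OF continuous_on_imp_locally_integrable[OF continuous_on_const], of \<Omega> \<phi> 1]
  by simp

lemma set_integral_mult_test_function:
  assumes "test_function \<Omega> \<phi>"
  shows "(LINT x:\<Omega>|lborel. h x * \<phi> x) = (LINT x|lborel. h x * \<phi> x)"
  unfolding set_lebesgue_integral_def
  using test_function_eq_0[OF assms]
  by (intro Bochner_Integration.integral_cong) (auto simp: indicator_def)

lemma weak_deriv_cong:
  assumes "weak_deriv \<Omega> b f g" "\<And>z. z \<in> \<Omega> \<Longrightarrow> f z = f' z" "\<And>z. z \<in> \<Omega> \<Longrightarrow> g z = g' z"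
  shows "weak_deriv \<Omega> b f' g'"
proof -
  have "set_integrable lborel K f' \<longleftrightarrow> set_integrable lborel K f"
    "set_integrable lborel K g' \<longleftrightarrow> set_integrable lborel K g" if "K \<subseteq> \<Omega>" for K
    by (rule set_integrable_cong; use that assms(2,3) in auto)+
  moreover have "(LINT x:\<Omega>|lborel. f' x * h x) = (LINT x:\<Omega>|lborel. f x * h x)"
    "(LINT x:\<Omega>|lborel. g' x * h x) = (LINT x:\<Omega>|lborel. g x * h x)" for h
    unfolding set_lebesgue_integral_def
    by (rule Bochner_Integration.integral_cong; use assms(2,3) in \<open>auto simp: indicator_def\<close>)+
  ultimately show ?thesis
    using assms(1) unfolding weak_deriv_def locally_integrable_def by auto
qed

lemma primitive_on_integrate_by_parts:
  assumes I: "open I" "is_interval I" and u: "primitive_on I u g" and \<psi>: "test_function I \<psi>"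
  shows "(LINT x|lborel. u x * deriv \<psi> x + g x * \<psi> x) = 0"
proof (cases "I = {}")
  case True
  then show ?thesis
    using test_function_eq_0[OF \<psi>] test_function_eq_0[OF test_function_deriv[OF \<psi>]] by simp
next
  case False
  obtain K where K: "compact K" "K \<subseteq> I" "\<And>x. x \<notin> K \<Longrightarrow> \<psi> x = 0" "\<And>x. x \<notin> K \<Longrightarrow> deriv \<psi> x = 0"
  proof -
    obtain K L where "compact K" "K \<subseteq> I" "\<And>x. x \<notin> K \<Longrightarrow> \<psi> x = 0"
      and "compact L" "L \<subseteq> I" "\<And>x. x \<notin> L \<Longrightarrow> deriv \<psi> x = 0"
      using test_functionE[OF \<psi>] test_functionE[OF test_function_deriv[OF \<psi>]] by metis
    then show ?thesis by (intro that[of "K \<union> L"]) auto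
  qed
  obtain a b where ab: "a < b" "{a..b} \<subseteq> I" "K \<subseteq> {a<..<b}"
    by (rule compact_subset_open_intervalE[OF K(1,2) I False])
  have out: "\<psi> x = 0" "deriv \<psi> x = 0" if "x \<notin> {a<..<b}" for x using K(3,4) ab(3) that by blast+
  have "primitive_on {a..b} \<psi> (deriv \<psi>)"
    using test_function_DERIV[OF \<psi>] test_function_continuous_on[OF test_function_deriv[OF \<psi>]]
    by (intro primitive_on_DERIV)
      (auto intro: has_field_derivative_at_within continuous_on_subset is_interval_cc)
  then have "primitive_on {a..b} (\<lambda>x. u x * \<psi> x) (\<lambda>x. u x * deriv \<psi> x + g x * \<psi> x)"
    by (intro primitive_on_mult primitive_on_subset[OF u ab(2)] is_interval_cc)
  then have "(LINT x:{a..b}|lborel. u x * deriv \<psi> x + g x * \<psi> x) = u b * \<psi> b - u a * \<psi> a"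
    using primitive_onD(2)[of "{a..b}" "\<lambda>x. u x * \<psi> x" _ a b] ab(1) by simp
  also have "\<dots> = 0" using out by simp
  also have "(LINT x:{a..b}|lborel. u x * deriv \<psi> x + g x * \<psi> x)
      = (LINT x|lborel. u x * deriv \<psi> x + g x * \<psi> x)"
    unfolding set_lebesgue_integral_def
  proof (rule Bochner_Integration.integral_cong)
    show "indicat_real {a..b} x *\<^sub>R (u x * deriv \<psi> x + g x * \<psi> x) = u x * deriv \<psi> x + g x * \<psi> x" for x
      using out[of x] by (cases "x \<in> {a..b}") auto
  qed simp
  finally show ?thesis .
qed

section \<open>Lebesgue measure on products\<close>

lemma space_sets_lborel_pair:
  "space (lborel \<Otimes>\<^sub>M lborel) = (UNIV :: ('a::euclidean_space \<times> 'b::euclidean_space) set)"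
  "sets (lborel \<Otimes>\<^sub>M lborel) = sets (borel :: ('a::euclidean_space \<times> 'b::euclidean_space) measure)"
  by (simp_all only: lborel_prod sets_lborel space_lborel space_borel)

lemma AE_lborel_pairD1:
  fixes P :: "'a::euclidean_space \<times> 'b::euclidean_space \<Rightarrow> bool"
  assumes "AE z in lborel. P z"
  shows "AE x in lborel. AE y in lborel. P (x, y)"
  using assms unfolding lborel_prod[symmetric] by (rule lborel_pair.AE_pair)

lemma AE_lborel_pairI:
  fixes P :: "'a::euclidean_space \<times> 'b::euclidean_space \<Rightarrow> bool"
  assumes "{z. P z} \<in> sets borel" "AE x in lborel. AE y in lborel. P (x, y)"
  shows "AE z in lborel. P z"
  unfolding lborel_prod[symmetric]
  by (rule lborel_pair.AE_pair_measure)
     (use assms in \<open>simp_all only: space_sets_lborel_pair UNIV_I simp_thms\<close>)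

lemma AE_lborel_pair_commute:
  fixes P :: "'a::euclidean_space \<times> 'b::euclidean_space \<Rightarrow> bool"
  assumes "{z. P z} \<in> sets borel"
  shows "(AE x in lborel. AE y in lborel. P (x, y)) \<longleftrightarrow> (AE y in lborel. AE x in lborel. P (x, y))"
  by (rule lborel_pair.AE_commute[of "\<lambda>x y. P (x, y)"])
     (use assms in \<open>simp only: space_sets_lborel_pair UNIV_I simp_thms prod.collapse\<close>)

lemma AE_lborel_pairD2:
  fixes P :: "'a::euclidean_space \<times> 'b::euclidean_space \<Rightarrow> bool"
  assumes "AE z in lborel. P z"
  shows "AE y in lborel. AE x in lborel. P (x, y)"
proof -
  obtain N where N: "{z \<in> space lborel. \<not> P z} \<subseteq> N" "N \<in> null_sets lborel"
    using assms by (auto simp: eventually_ae_filter)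
  have "AE y in lborel. AE x in lborel. (x, y) \<notin> N"
    using AE_lborel_pair_commute[of "\<lambda>z. z \<notin> N"] AE_lborel_pairD1[OF AE_not_in[OF N(2)]] N(2)
    by (auto simp: Collect_neg_eq)
  then show ?thesis using N(1) by (auto elim!: eventually_mono)
qed

lemma AE_lborel_fst:
  assumes "AE x in lborel. P x"
  shows "AE z::'a::euclidean_space \<times> 'b::euclidean_space in lborel. P (fst z)"
proof -
  obtain N where N: "{x \<in> space lborel. \<not> P x} \<subseteq> N" "N \<in> null_sets lborel"
    using assms by (auto simp: eventually_ae_filter)
  have [measurable]: "N \<in> sets borel" using N(2) by auto
  have "{z::'a \<times> 'b. fst z \<notin> N} \<in> sets borel" by measurable
  then have "AE z::'a \<times> 'b in lborel. fst z \<notin> N"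
    using AE_not_in[OF N(2)] by (intro AE_lborel_pairI) auto
  then show ?thesis using N(1) by (auto elim!: eventually_mono)
qed

lemma AE_lborel_snd:
  assumes "AE y in lborel. P y"
  shows "AE z::'a::euclidean_space \<times> 'b::euclidean_space in lborel. P (snd z)"
proof -
  obtain N where N: "{y \<in> space lborel. \<not> P y} \<subseteq> N" "N \<in> null_sets lborel"
    using assms by (auto simp: eventually_ae_filter)
  have [measurable]: "N \<in> sets borel" using N(2) by auto
  have "{z::'a \<times> 'b. snd z \<notin> N} \<in> sets borel" by measurable
  then have "AE z::'a \<times> 'b in lborel. snd z \<notin> N"
    using AE_not_in[OF N(2)] by (intro AE_lborel_pairI) auto
  then show ?thesis using N(1) by (auto elim!: eventually_mono)
qed

lemma
  fixes f :: "'a::euclidean_space \<times> 'b::euclidean_space \<Rightarrow> real"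
  assumes f: "integrable lborel f"
  shows lborel_AE_integrable_fst: "AE x in lborel. integrable lborel (\<lambda>y. f (x, y))"
    and lborel_AE_integrable_snd: "AE y in lborel. integrable lborel (\<lambda>x. f (x, y))"
    and lborel_integrable_fst: "integrable lborel (\<lambda>x. LINT y|lborel. f (x, y))"
    and lborel_integrable_snd: "integrable lborel (\<lambda>y. LINT x|lborel. f (x, y))"
    and lborel_integral_fst: "(LINT x|lborel. LINT y|lborel. f (x, y)) = (LINT z|lborel. f z)"
    and lborel_integral_snd: "(LINT y|lborel. LINT x|lborel. f (x, y)) = (LINT z|lborel. f z)"
proof -
  have f': "integrable (lborel \<Otimes>\<^sub>M lborel) (case_prod (\<lambda>x y. f (x, y)))"
    using f by (simp add: lborel_prod)
  note lborel_pair.AE_integrable_fst[OF f'] lborel_pair.AE_integrable_snd[OF f']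
      lborel_pair.integrable_fst[OF f'] lborel_pair.integrable_snd[OF f']
      lborel_pair.integral_fst[OF f'] lborel_pair.integral_snd[OF f']
  then show "AE x in lborel. integrable lborel (\<lambda>y. f (x, y))"
    "AE y in lborel. integrable lborel (\<lambda>x. f (x, y))"
    "integrable lborel (\<lambda>x. LINT y|lborel. f (x, y))"
    "integrable lborel (\<lambda>y. LINT x|lborel. f (x, y))"
    "(LINT x|lborel. LINT y|lborel. f (x, y)) = (LINT z|lborel. f z)"
    "(LINT y|lborel. LINT x|lborel. f (x, y)) = (LINT z|lborel. f z)"
    by (simp_all add: lborel_prod)
qed

lemma
  fixes f :: "'a::euclidean_space \<times> 'b::euclidean_space \<Rightarrow> real"
  assumes "integrable lborel f"
  shows lborel_integrable_swap: "integrable lborel (\<lambda>z. f (snd z, fst z))"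
    and lborel_integral_swap: "(LINT z|lborel. f (snd z, fst z)) = (LINT z|lborel. f z)"
proof -
  have "(\<lambda>(y, x). f (x, y)) = (\<lambda>z. f (snd z, fst z))" by auto
  then show "integrable lborel (\<lambda>z. f (snd z, fst z))"
    "(LINT z|lborel. f (snd z, fst z)) = (LINT z|lborel. f z)"
    using lborel_pair.integrable_product_swap[of f] lborel_pair.integral_product_swap[of f] assms
    by (auto simp: lborel_prod)
qed

lemma
  fixes u :: "'a::euclidean_space \<Rightarrow> real" and v :: "'b::euclidean_space \<Rightarrow> real"
  assumes u: "integrable lborel u" and v: "integrable lborel v"
  shows integrable_tensor: "integrable lborel (\<lambda>z. u (fst z) * v (snd z))"
    and integral_tensor:
      "(LINT z|lborel. u (fst z) * v (snd z)) = (LINT x|lborel. u x) * (LINT y|lborel. v y)"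
proof -
  have [measurable]: "u \<in> borel_measurable borel" "v \<in> borel_measurable borel"
    using u v by auto
  have "integrable (lborel \<Otimes>\<^sub>M lborel) (\<lambda>z. u (fst z) * v (snd z))"
  proof (rule lborel_pair.Fubini_integrable)
    show "(\<lambda>z. u (fst z) * v (snd z)) \<in> borel_measurable (lborel \<Otimes>\<^sub>M lborel)" by measurable
    show "integrable lborel (\<lambda>x. LINT y|lborel. norm (u (fst (x, y)) * v (snd (x, y))))"
      using u by (simp add: abs_mult)
    show "AE x in lborel. integrable lborel (\<lambda>y. u (fst (x, y)) * v (snd (x, y)))"
      using v by simp
  qed
  then show "integrable lborel (\<lambda>z. u (fst z) * v (snd z))" by (simp add: lborel_prod)
  from lborel_integral_fst[OF this]
  show "(LINT z|lborel. u (fst z) * v (snd z)) = (LINT x|lborel. u x) * (LINT y|lborel. v y)"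
    by simp
qed

lemma indicator_Times_fst_snd:
  "indicat_real (A \<times> B) z = indicator A (fst z) * indicator B (snd z)"
  by (cases z) (simp add: indicator_times)

lemma abs_signed_indicator_le:
  fixes c x :: real
  assumes "{min c x..max c x} \<subseteq> A"
  shows "\<bar>indicat_real {c<..<x} s - indicat_real {x<..<c} s\<bar> \<le> indicator A s"
proof -
  have "{c<..<x} \<union> {x<..<c} \<subseteq> {min c x..max c x}" by auto
  with assms have "{c<..<x} \<union> {x<..<c} \<subseteq> A" by blast
  then show ?thesis by (auto simp: indicator_def)
qed

lemma indefinite_integral_commute:
  fixes g :: "real \<times> real \<Rightarrow> real"
  assumes g: "set_integrable lborel (A \<times> B) g"
    and A: "A \<in> sets borel" "{min c y..max c y} \<subseteq> A" and B: "B \<in> sets borel" "{min d t..max d t} \<subseteq> B"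
  shows "indefinite_integral d (\<lambda>s. indefinite_integral c (\<lambda>x. g (x, s)) y) t
    = indefinite_integral c (\<lambda>x. indefinite_integral d (\<lambda>s. g (x, s)) t) y"
proof -
  define \<sigma> where "\<sigma> x = indicat_real {c<..<y} x - indicat_real {y<..<c} x" for x
  define \<tau> where "\<tau> s = indicat_real {d<..<t} s - indicat_real {t<..<d} s" for s
  have [measurable]: "\<sigma> \<in> borel_measurable borel" "\<tau> \<in> borel_measurable borel"
    unfolding \<sigma>_def \<tau>_def by measurable
  have \<sigma>: "\<bar>\<sigma> x\<bar> \<le> indicator A x" for x
    unfolding \<sigma>_def by (rule abs_signed_indicator_le[OF A(2)])
  have \<tau>: "\<bar>\<tau> s\<bar> \<le> indicator B s" for s
    unfolding \<tau>_def by (rule abs_signed_indicator_le[OF B(2)])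
  have "set_integrable lborel (A \<times> B) (\<lambda>z. (\<sigma> (fst z) * \<tau> (snd z)) * g z)"
  proof (rule set_integrable_mult_bounded[OF g])
    show "set_borel_measurable lborel (A \<times> B) (\<lambda>z. \<sigma> (fst z) * \<tau> (snd z))"
      unfolding set_borel_measurable_def indicator_Times_fst_snd using A(1) B(1) by measurable
    have "norm (\<sigma> (fst z) * \<tau> (snd z)) \<le> 1" for z :: "real \<times> real"
      using mult_mono[OF order_trans[OF \<sigma> indicator_le_1] order_trans[OF \<tau> indicator_le_1], of "snd z" "fst z"]
      by (simp add: abs_mult)
    then show "bounded ((\<lambda>z. \<sigma> (fst z) * \<tau> (snd z)) ` (A \<times> B))"
      by (auto intro!: boundedI[where B = 1])
  qed
  moreover have "indicator (A \<times> B) z *\<^sub>R ((\<sigma> (fst z) * \<tau> (snd z)) * g z) = \<sigma> (fst z) * \<tau> (snd z) * g z" for z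
    using \<sigma>[of "fst z"] \<tau>[of "snd z"] unfolding indicator_Times_fst_snd by (auto simp: indicator_def split: if_splits)
  ultimately have i: "integrable lborel (\<lambda>z. \<sigma> (fst z) * \<tau> (snd z) * g z)"
    by (simp only: set_integrable_def)
  have "indefinite_integral d (\<lambda>s. indefinite_integral c (\<lambda>x. g (x, s)) y) t
      = (LINT s|lborel. \<tau> s * (LINT x|lborel. \<sigma> x * g (x, s)))"
    by (simp add: indefinite_integral_eq_LINT \<sigma>_def \<tau>_def)
  also have "\<dots> = (LINT s|lborel. LINT x|lborel. \<sigma> x * \<tau> s * g (x, s))"
    by (simp add: mult_ac flip: Bochner_Integration.integral_mult_right_zero)
  also have "\<dots> = (LINT x|lborel. LINT s|lborel. \<sigma> x * \<tau> s * g (x, s))"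
    using lborel_integral_fst[OF i] lborel_integral_snd[OF i] by simp
  also have "\<dots> = (LINT x|lborel. \<sigma> x * (LINT s|lborel. \<tau> s * g (x, s)))"
    by (simp add: mult_ac flip: Bochner_Integration.integral_mult_right_zero)
  finally show ?thesis by (simp add: indefinite_integral_eq_LINT \<sigma>_def \<tau>_def)
qed

subsection \<open>Local integrability on products\<close>

lemma locally_integrable_TimesI:
  fixes h :: "'a::euclidean_space \<times> 'b::euclidean_space \<Rightarrow> real"
  assumes "\<And>K L. compact K \<Longrightarrow> K \<subseteq> \<Omega>1 \<Longrightarrow> compact L \<Longrightarrow> L \<subseteq> \<Omega>2 \<Longrightarrow> set_integrable lborel (K \<times> L) h"
  shows "locally_integrable (\<Omega>1 \<times> \<Omega>2) h"
  unfolding locally_integrable_def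
proof (intro allI impI)
  fix K :: "('a \<times> 'b) set" assume K: "compact K" "K \<subseteq> \<Omega>1 \<times> \<Omega>2"
  have "compact (fst ` K)" "compact (snd ` K)" "fst ` K \<subseteq> \<Omega>1" "snd ` K \<subseteq> \<Omega>2"
    using K by (auto intro!: compact_continuous_image continuous_intros)
  then have "set_integrable lborel (fst ` K \<times> snd ` K) h" by (intro assms)
  then show "set_integrable lborel K h"
    by (rule set_integrable_subset) (use K(1) in \<open>auto simp: borel_compact subset_fst_snd\<close>)
qed

lemma locally_integrable_TimesD:
  assumes "locally_integrable (\<Omega>1 \<times> \<Omega>2) h" "compact K" "K \<subseteq> \<Omega>1" "compact L" "L \<subseteq> \<Omega>2"
  shows "set_integrable lborel (K \<times> L) h"
  using assms by (intro locally_integrableD[OF assms(1)] compact_Times) auto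

lemma locally_integrable_swap:
  fixes h :: "'a::euclidean_space \<times> 'b::euclidean_space \<Rightarrow> real"
  assumes "locally_integrable (\<Omega>1 \<times> \<Omega>2) h"
  shows "locally_integrable (\<Omega>2 \<times> \<Omega>1) (\<lambda>z. h (snd z, fst z))"
proof (rule locally_integrable_TimesI)
  fix L :: "'b set" and K :: "'a set"
  assume "compact L" "L \<subseteq> \<Omega>2" "compact K" "K \<subseteq> \<Omega>1"
  then have "integrable lborel (\<lambda>z. indicator (K \<times> L) z *\<^sub>R h z)"
    using locally_integrable_TimesD[OF assms] unfolding set_integrable_def by blast
  from lborel_integrable_swap[OF this] show "set_integrable lborel (L \<times> K) (\<lambda>z. h (snd z, fst z))"
    unfolding set_integrable_def indicator_Times_fst_snd by (simp add: mult.commute)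
qed

lemma locally_integrable_tensor:
  assumes "locally_integrable \<Omega>1 u" "locally_integrable \<Omega>2 v"
  shows "locally_integrable (\<Omega>1 \<times> \<Omega>2) (\<lambda>z. u (fst z) * v (snd z))"
proof (rule locally_integrable_TimesI)
  fix K L assume "compact K" "K \<subseteq> \<Omega>1" "compact L" "L \<subseteq> \<Omega>2"
  then have "integrable lborel (\<lambda>x. indicator K x *\<^sub>R u x)" "integrable lborel (\<lambda>y. indicator L y *\<^sub>R v y)"
    using assms unfolding locally_integrable_def set_integrable_def by auto
  from integrable_tensor[OF this]
  show "set_integrable lborel (K \<times> L) (\<lambda>z. u (fst z) * v (snd z))"
    unfolding set_integrable_def indicator_Times_fst_snd by (simp add: mult_ac)
qed

lemma locally_integrable_fst: "locally_integrable \<Omega>1 u \<Longrightarrow> locally_integrable (\<Omega>1 \<times> \<Omega>2) (\<lambda>z. u (fst z))"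
  using locally_integrable_tensor[OF _ continuous_on_imp_locally_integrable[OF continuous_on_const], of \<Omega>1 u \<Omega>2 1]
  by simp

lemma locally_integrable_snd: "locally_integrable \<Omega>2 v \<Longrightarrow> locally_integrable (\<Omega>1 \<times> \<Omega>2) (\<lambda>z. v (snd z))"
  using locally_integrable_tensor[OF continuous_on_imp_locally_integrable[OF continuous_on_const], of \<Omega>2 v \<Omega>1 1]
  by simp

lemma AE_locally_integrable_slice:
  fixes g :: "'a::euclidean_space \<times> 'b::euclidean_space \<Rightarrow> real"
  assumes "open \<Omega>1" "open \<Omega>2" and g: "locally_integrable (\<Omega>1 \<times> \<Omega>2) g"
  shows "AE y in lborel. y \<in> \<Omega>2 \<longrightarrow> locally_integrable \<Omega>1 (\<lambda>x. g (x, y))"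
proof -
  obtain K where K: "\<And>n::nat. compact (K n)" "\<And>n. K n \<subseteq> \<Omega>1"
      "\<And>C. compact C \<Longrightarrow> C \<subseteq> \<Omega>1 \<Longrightarrow> \<exists>N. \<forall>n\<ge>N. C \<subseteq> K n"
    using open_Union_compact_subsets[OF assms(1)] by metis
  obtain L where L: "\<And>n::nat. compact (L n)" "\<And>n. L n \<subseteq> \<Omega>2" "\<Union>(range L) = \<Omega>2"
    using open_Union_compact_subsets[OF assms(2)] by metis
  have "AE y in lborel. y \<in> L m \<longrightarrow> set_integrable lborel (K n) (\<lambda>x. g (x, y))" for m n
  proof -
    have "integrable lborel (\<lambda>z. indicator (K n \<times> L m) z *\<^sub>R g z)"
      using locally_integrable_TimesD[OF g K(1,2) L(1,2)] unfolding set_integrable_def .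
    from lborel_AE_integrable_snd[OF this] show ?thesis
      by eventually_elim (auto simp: set_integrable_def indicator_Times_fst_snd)
  qed
  then have "AE y in lborel. \<forall>m n. y \<in> L m \<longrightarrow> set_integrable lborel (K n) (\<lambda>x. g (x, y))"
    unfolding AE_all_countable by blast
  then show ?thesis
  proof eventually_elim
    case (elim y)
    show ?case
      unfolding locally_integrable_def
    proof (intro impI allI)
      fix C assume y: "y \<in> \<Omega>2" and C: "compact C" "C \<subseteq> \<Omega>1"
      obtain m where m: "y \<in> L m" using y L(3) by blast
      obtain n where n: "C \<subseteq> K n" using K(3)[OF C] by blast
      show "set_integrable lborel C (\<lambda>x. g (x, y))"
        by (rule set_integrable_subset[OF _ _ n]) (use elim m borel_compact[OF C(1)] in auto)
    qed
  qed
qed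

section \<open>The fundamental lemma of the calculus of variations\<close>

lemma AE_eq_0_if_cbox_integrals_eq_0:
  fixes f :: "'a::euclidean_space \<Rightarrow> real"
  assumes "integrable lborel f" and zero: "\<And>p q. integral (cbox p q) f = 0"
  shows "AE x in lborel. f x = 0"
proof -
  have "f integrable_on cbox p q" for p q
  proof -
    have "set_integrable lborel (cbox p q) f"
      using assms(1) unfolding set_integrable_def by (intro integrable_mult_indicator) auto
    then show ?thesis by (rule set_borel_integral_eq_integral(1))
  qed
  then obtain N where N: "negligible N"
    "\<And>x e. \<lbrakk>x \<notin> N; 0 < e\<rbrakk> \<Longrightarrow> \<exists>d>0. \<forall>h. 0 < h \<and> h < d \<longrightarrow>
        norm (integral (cbox x (x + h *\<^sub>R One)) f /\<^sub>R h ^ DIM('a) - f x) < e"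
    using integrable_ccontinuous_explicit[of f] by blast
  have "f x = 0" if "x \<notin> N" for x
  proof (rule ccontr)
    assume "f x \<noteq> 0"
    then obtain d :: real where d: "d > 0" "\<forall>h. 0 < h \<and> h < d \<longrightarrow>
        norm (integral (cbox x (x + h *\<^sub>R One)) f /\<^sub>R h ^ DIM('a) - f x) < norm (f x)"
      using N(2)[OF \<open>x \<notin> N\<close>, of "norm (f x)"] by auto
    have "0 < d / 2 \<and> d / 2 < d" using d(1) by simp
    from d(2)[unfolded zero, rule_format, OF this] show False by simp
  qed
  moreover have "AE x in completion lborel. x \<notin> N"
    using N(1) by (intro AE_not_in) (simp add: negligible_iff_null_sets)
  then have "AE x in lborel. x \<notin> N" by (simp add: AE_completion_iff)
  ultimately show ?thesis by (auto elim!: eventually_mono)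
qed

lemma AE_eq_0_if_box_integrals_eq_0:
  fixes h :: "'a::euclidean_space \<Rightarrow> real"
  assumes \<Omega>: "open \<Omega>" and h: "locally_integrable \<Omega> h"
    and zero: "\<And>p q. cbox p q \<subseteq> \<Omega> \<Longrightarrow> (LINT x:box p q|lborel. h x) = 0"
  shows "AE x in lborel. x \<in> \<Omega> \<longrightarrow> h x = 0"
proof -
  have "AE x in lborel. x \<in> cbox p q \<longrightarrow> h x = 0" if sub: "cbox p q \<subseteq> \<Omega>" for p q
  proof -
    define f where "f x = indicator (cbox p q) x *\<^sub>R h x" for x
    have "integrable lborel f"
      using locally_integrableD[OF h compact_cbox sub] unfolding f_def[abs_def] set_integrable_def .
    moreover have "integral (cbox a b) f = 0" for a b
    proof -
      obtain r s where rs: "cbox p q \<inter> cbox a b = cbox r s"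
        using Int_interval[of p q a b] by blast
      have sub': "cbox r s \<subseteq> \<Omega>" using rs sub by auto
      have bi: "set_integrable lborel (box r s) h"
        by (rule set_integrable_subset[OF locally_integrableD[OF h compact_cbox sub']])
          (auto simp: box_subset_cbox)
      have "f = (\<lambda>x. if x \<in> cbox p q then h x else 0)" by (auto simp: f_def)
      then have "integral (cbox a b) f = integral (cbox r s) h"
        using rs Henstock_Kurzweil_Integration.integral_restrict_Int[of "cbox a b" "cbox p q" h] by simp
      also have "\<dots> = integral (box r s) h" by (rule integral_open_interval[symmetric])
      also have "\<dots> = (LINT z:box r s|lborel. h z)"
        using set_borel_integral_eq_integral(2)[OF bi] by simp
      also have "\<dots> = 0" by (rule zero[OF sub'])
      finally show ?thesis .
    qed
    ultimately have "AE x in lborel. f x = 0" by (rule AE_eq_0_if_cbox_integrals_eq_0)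
    then show ?thesis by eventually_elim (simp add: f_def indicator_def)
  qed
  moreover obtain \<D> where \<D>: "countable \<D>" "\<D> \<subseteq> Pow \<Omega>" "\<And>X. X \<in> \<D> \<Longrightarrow> \<exists>a b. X = cbox a b" "\<Union>\<D> = \<Omega>"
    using open_countable_Union_open_cbox[OF \<Omega>] by blast
  ultimately have "AE x in lborel. \<forall>X\<in>\<D>. x \<in> X \<longrightarrow> h x = 0"
    unfolding AE_ball_countable[OF \<D>(1)] by blast
  then show ?thesis by eventually_elim (use \<D>(4) in auto)
qed

lemma box_integral_eq_0_if_orthogonal_to_tensors:
  fixes h :: "real \<times> real \<Rightarrow> real"
  assumes h: "locally_integrable (I1 \<times> I2) h" and sub: "cbox p q \<subseteq> I1 \<times> I2"
    and orth: "\<And>\<psi> \<phi>. test_function I1 \<psi> \<Longrightarrow> test_function I2 \<phi> \<Longrightarrow>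
      (LINT z|lborel. h z * (\<psi> (fst z) * \<phi> (snd z))) = 0"
  shows "(LINT z:box p q|lborel. h z) = 0"
proof (cases "box p q = {}")
  case True
  then show ?thesis by (simp add: set_lebesgue_integral_def)
next
  case False
  obtain a c b d where pq: "p = (a, c)" "q = (b, d)" by (cases p, cases q) auto
  have boxes: "cbox p q = {a..b} \<times> {c..d}" "box p q = {a<..<b} \<times> {c<..<d}"
    by (auto simp: pq cbox_Pair_eq box_prod)
  have "{a..b} \<subseteq> I1" "{c..d} \<subseteq> I2"
    using sub False unfolding boxes by (auto simp: times_subset_iff)
  then have test: "test_function I1 (smooth_plateau a b n)" "test_function I2 (smooth_plateau c d n)" for n
    by (simp_all add: test_function_smooth_plateau)
  define \<beta> where "\<beta> n z = smooth_plateau a b n (fst z) * smooth_plateau c d n (snd z)" for n z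
  have \<beta>_le: "\<bar>\<beta> n z\<bar> \<le> indicator (cbox p q) z" for n z
    unfolding \<beta>_def boxes indicator_Times_fst_snd abs_mult
    using smooth_plateau_bounds smooth_plateau_eq_0 by (intro mult_mono) (auto simp: indicator_def)
  have "(\<lambda>n. LINT z|lborel. h z * \<beta> n z) \<longlonglongrightarrow> (LINT z|lborel. h z * indicator (box p q) z)"
  proof (rule integral_dominated_convergence)
    show "integrable lborel (\<lambda>z. norm (indicator (cbox p q) z *\<^sub>R h z))"
      using locally_integrableD[OF h compact_cbox sub] unfolding set_integrable_def by simp
    have "set_integrable lborel (box p q) h"
      by (rule set_integrable_subset[OF locally_integrableD[OF h compact_cbox sub]])
        (auto simp: box_subset_cbox)
    then show "(\<lambda>z. h z * indicator (box p q) z) \<in> borel_measurable lborel"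
      unfolding set_integrable_def by (auto simp: mult.commute)
    show "(\<lambda>z. h z * \<beta> n z) \<in> borel_measurable lborel" for n
      unfolding \<beta>_def
      by (intro borel_measurable_integrable integrable_mult_test_function[OF h] test_function_tensor test)
    show "AE z in lborel. (\<lambda>n. h z * \<beta> n z) \<longlonglongrightarrow> h z * indicator (box p q) z"
      unfolding \<beta>_def boxes indicator_Times_fst_snd
      by (intro AE_I2 tendsto_intros smooth_plateau_tendsto_indicator)
    show "AE z in lborel. norm (h z * \<beta> n z) \<le> norm (indicator (cbox p q) z *\<^sub>R h z)" for n
      using mult_left_mono[OF \<beta>_le] by (intro AE_I2) (simp add: abs_mult mult.commute)
  qed
  moreover have "(LINT z|lborel. h z * \<beta> n z) = 0" for n
    unfolding \<beta>_def by (rule orth[OF test])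
  ultimately show ?thesis
    unfolding set_lebesgue_integral_def by (simp add: LIMSEQ_const_iff mult.commute)
qed

lemma orthogonal_to_tensors_imp_AE_eq_0:
  fixes h :: "real \<times> real \<Rightarrow> real"
  assumes I: "open I1" "open I2" and h: "locally_integrable (I1 \<times> I2) h"
    and orth: "\<And>\<psi> \<phi>. test_function I1 \<psi> \<Longrightarrow> test_function I2 \<phi> \<Longrightarrow>
      (LINT z|lborel. h z * (\<psi> (fst z) * \<phi> (snd z))) = 0"
  shows "AE z in lborel. z \<in> I1 \<times> I2 \<longrightarrow> h z = 0"
  by (rule AE_eq_0_if_box_integrals_eq_0[OF open_Times[OF I] h])
    (rule box_integral_eq_0_if_orthogonal_to_tensors[OF h _ orth])

section \<open>Weak derivatives along slices\<close>

text \<open>Testing with tensor products only covers the two partial weak derivatives on a strip (after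
  a swap of the variables) as well as weak derivatives of functions of one variable.\<close>

definition weak_deriv_fst ::
    "real set \<Rightarrow> real set \<Rightarrow> (real \<times> real \<Rightarrow> real) \<Rightarrow> (real \<times> real \<Rightarrow> real) \<Rightarrow> bool" where
  "weak_deriv_fst I1 I2 f g \<longleftrightarrow> locally_integrable (I1 \<times> I2) f \<and> locally_integrable (I1 \<times> I2) g \<and>
     (\<forall>\<psi> \<phi>. test_function I1 \<psi> \<longrightarrow> test_function I2 \<phi> \<longrightarrow>
        (LINT z|lborel. f z * (deriv \<psi> (fst z) * \<phi> (snd z)))
          = - (LINT z|lborel. g z * (\<psi> (fst z) * \<phi> (snd z))))"

lemma weak_deriv_tensor:
  assumes "test_function I1 \<psi>" "test_function I2 \<phi>"
  shows "weak_deriv (I1 \<times> I2) (1, 0) f g \<Longrightarrow>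
      (LINT z|lborel. f z * (deriv \<psi> (fst z) * \<phi> (snd z))) = - (LINT z|lborel. g z * (\<psi> (fst z) * \<phi> (snd z)))"
    and "weak_deriv (I1 \<times> I2) (0, 1) f g \<Longrightarrow>
      (LINT z|lborel. f z * (\<psi> (fst z) * deriv \<phi> (snd z))) = - (LINT z|lborel. g z * (\<psi> (fst z) * \<phi> (snd z)))"
proof -
  let ?\<Phi> = "\<lambda>z. \<psi> (fst z) * \<phi> (snd z)"
  have weak: "(LINT z:I1 \<times> I2|lborel. f z * frechet_derivative ?\<Phi> (at z) b)
      = - (LINT z:I1 \<times> I2|lborel. g z * ?\<Phi> z)" if "weak_deriv (I1 \<times> I2) b f g" for b
    using that test_function_tensor[OF assms] unfolding weak_deriv_def by blast
  note drop = set_integral_mult_test_function[OF test_function_tensor]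
  show "(LINT z|lborel. f z * (deriv \<psi> (fst z) * \<phi> (snd z))) = - (LINT z|lborel. g z * ?\<Phi> z)"
    if "weak_deriv (I1 \<times> I2) (1, 0) f g"
    using weak[OF that] drop[OF assms] drop[OF test_function_deriv[OF assms(1)] assms(2)]
    by (simp add: frechet_derivative_tensor[OF assms])
  show "(LINT z|lborel. f z * (\<psi> (fst z) * deriv \<phi> (snd z))) = - (LINT z|lborel. g z * ?\<Phi> z)"
    if "weak_deriv (I1 \<times> I2) (0, 1) f g"
    using weak[OF that] drop[OF assms] drop[OF assms(1) test_function_deriv[OF assms(2)]]
    by (simp add: frechet_derivative_tensor[OF assms])
qed

lemma weak_deriv_imp_weak_deriv_fst:
  "weak_deriv (I1 \<times> I2) (1, 0) f g \<Longrightarrow> weak_deriv_fst I1 I2 f g"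
  unfolding weak_deriv_fst_def using weak_deriv_tensor(1) by (auto simp: weak_deriv_def)

lemma weak_deriv_imp_weak_deriv_fst_swap:
  assumes w: "weak_deriv (I1 \<times> I2) (0, 1) f g"
  shows "weak_deriv_fst I2 I1 (\<lambda>z. f (snd z, fst z)) (\<lambda>z. g (snd z, fst z))"
  unfolding weak_deriv_fst_def
proof (intro conjI allI impI)
  have loc: "locally_integrable (I1 \<times> I2) f" "locally_integrable (I1 \<times> I2) g"
    using w by (auto simp: weak_deriv_def)
  show "locally_integrable (I2 \<times> I1) (\<lambda>z. f (snd z, fst z))"
    "locally_integrable (I2 \<times> I1) (\<lambda>z. g (snd z, fst z))"
    by (intro locally_integrable_swap loc)+
  fix \<psi> \<phi> assume \<psi>: "test_function I2 \<psi>" and \<phi>: "test_function I1 \<phi>"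
  show "(LINT z|lborel. f (snd z, fst z) * (deriv \<psi> (fst z) * \<phi> (snd z)))
      = - (LINT z|lborel. g (snd z, fst z) * (\<psi> (fst z) * \<phi> (snd z)))"
    using weak_deriv_tensor(2)[OF \<phi> \<psi> w]
      lborel_integral_swap[OF integrable_mult_test_function[OF loc(1)
        test_function_tensor[OF \<phi> test_function_deriv[OF \<psi>]]]]
      lborel_integral_swap[OF integrable_mult_test_function[OF loc(2) test_function_tensor[OF \<phi> \<psi>]]]
    by (simp add: mult.commute)
qed

lemma weak_deriv1_imp_weak_deriv_fst:
  assumes w: "weak_deriv1 f g"
  shows "weak_deriv_fst UNIV I (\<lambda>z. f (fst z)) (\<lambda>z. g (fst z))"
  unfolding weak_deriv_fst_def
proof (intro conjI allI impI)
  have loc: "locally_integrable UNIV f" "locally_integrable UNIV g"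
    using w by (auto simp: weak_deriv_def)
  show "locally_integrable (UNIV \<times> I) (\<lambda>z. f (fst z))" "locally_integrable (UNIV \<times> I) (\<lambda>z. g (fst z))"
    by (intro locally_integrable_fst loc)+
  fix \<psi> \<phi> assume \<psi>: "test_function (UNIV :: real set) \<psi>" and \<phi>: "test_function I \<phi>"
  have "(LINT z|lborel. f (fst z) * (deriv \<psi> (fst z) * \<phi> (snd z)))
      = (LINT x|lborel. f x * deriv \<psi> x) * (LINT s|lborel. \<phi> s)"
    using integral_tensor[OF integrable_mult_test_function[OF loc(1) test_function_deriv[OF \<psi>]]
        test_function_integrable[OF \<phi>]] by (simp add: mult.assoc)
  also have "(LINT x|lborel. f x * deriv \<psi> x) = - (LINT x|lborel. g x * \<psi> x)"
    using w \<psi> frechet_derivative_eq_deriv[OF test_function_DERIV[OF \<psi>]]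
    unfolding weak_deriv_def by (auto simp: set_lebesgue_integral_def)
  also have "- (LINT x|lborel. g x * \<psi> x) * (LINT s|lborel. \<phi> s)
      = - (LINT z|lborel. g (fst z) * (\<psi> (fst z) * \<phi> (snd z)))"
    using integral_tensor[OF integrable_mult_test_function[OF loc(2) \<psi>] test_function_integrable[OF \<phi>]]
    by (simp add: mult.assoc)
  finally show "(LINT z|lborel. f (fst z) * (deriv \<psi> (fst z) * \<phi> (snd z)))
      = - (LINT z|lborel. g (fst z) * (\<psi> (fst z) * \<phi> (snd z)))" .
qed

lemma weak_deriv_fst_diff:
  assumes "weak_deriv_fst I1 I2 f g" "weak_deriv_fst I1 I2 f' g'"
  shows "weak_deriv_fst I1 I2 (\<lambda>z. f z - f' z) (\<lambda>z. g z - g' z)"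
  unfolding weak_deriv_fst_def
proof (intro conjI allI impI)
  have loc: "locally_integrable (I1 \<times> I2) f" "locally_integrable (I1 \<times> I2) g"
    "locally_integrable (I1 \<times> I2) f'" "locally_integrable (I1 \<times> I2) g'"
    using assms by (auto simp: weak_deriv_fst_def)
  show "locally_integrable (I1 \<times> I2) (\<lambda>z. f z - f' z)" "locally_integrable (I1 \<times> I2) (\<lambda>z. g z - g' z)"
    by (intro locally_integrable_diff loc)+
  fix \<psi> \<phi> assume \<psi>: "test_function I1 \<psi>" and \<phi>: "test_function I2 \<phi>"
  note i = integrable_mult_test_function[OF _ test_function_tensor[OF test_function_deriv[OF \<psi>] \<phi>]]
    integrable_mult_test_function[OF _ test_function_tensor[OF \<psi> \<phi>]]
  show "(LINT z|lborel. (f z - f' z) * (deriv \<psi> (fst z) * \<phi> (snd z)))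
      = - (LINT z|lborel. (g z - g' z) * (\<psi> (fst z) * \<phi> (snd z)))"
    using assms \<psi> \<phi> i(1)[OF loc(1)] i(1)[OF loc(3)] i(2)[OF loc(2)] i(2)[OF loc(4)]
    by (simp add: weak_deriv_fst_def left_diff_distrib)
qed

subsection \<open>The du Bois-Reymond lemma\<close>

lemma test_function_unit_integralE:
  fixes I :: "real set"
  assumes "open I" "is_interval I" "I \<noteq> {}"
  obtains \<psi> where "test_function I \<psi>" "(LINT x|lborel. \<psi> x) = 1"
proof -
  obtain a b where ab: "a < b" "{a..b} \<subseteq> I"
    using compact_subset_open_intervalE[of "{}" I] assms by auto
  define \<beta> where "\<beta> = smooth_plateau a b 0"
  have test: "test_function I \<beta>" unfolding \<beta>_def by (rule test_function_smooth_plateau[OF ab(2)])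
  have "(LINT x|lborel. \<beta> x) \<noteq> 0"
  proof
    assume "(LINT x|lborel. \<beta> x) = 0"
    then have "AE x in lborel. \<beta> x = 0"
      using integral_nonneg_eq_0_iff_AE[OF test_function_integrable[OF test]]
      by (simp add: \<beta>_def smooth_plateau_bounds)
    then have "AE x in lborel. x \<notin> {a<..<b}"
      by eventually_elim (metis \<beta>_def smooth_plateau_pos less_irrefl)
    then have "{a<..<b} \<in> null_sets lborel" by (subst AE_iff_null_sets) auto
    then show False using ab(1) by (auto simp: null_sets_def)
  qed
  then show ?thesis
    by (intro that[of "\<lambda>x. inverse (LINT x|lborel. \<beta> x) * \<beta> x"] test_function_cmult test) simp
qed

lemma test_function_primitiveE:
  fixes g :: "real \<Rightarrow> real"
  assumes I: "open I" "is_interval I" "I \<noteq> {}" and g: "test_function I g" and mean: "(LINT x|lborel. g x) = 0"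
  obtains \<psi> where "test_function I \<psi>" "deriv \<psi> = g"
proof -
  obtain K where K: "compact K" "K \<subseteq> I" "\<And>x. x \<notin> K \<Longrightarrow> g x = 0" using test_functionE[OF g] by blast
  obtain a b where ab: "a < b" "{a..b} \<subseteq> I" "K \<subseteq> {a<..<b}"
    by (rule compact_subset_open_intervalE[OF K(1,2) I])
  have out: "g x = 0" if "x \<notin> {a<..<b}" for x using K(3) ab(3) that by blast
  define \<psi> where "\<psi> = indefinite_integral a g"
  have D: "(\<psi> has_real_derivative g x) (at x)" for x
    unfolding \<psi>_def by (rule indefinite_integral_DERIV[OF test_function_continuous_on[OF g]])
  have "test_function I \<psi>"
  proof (rule test_functionI[OF _ compact_Icc ab(2)])
    show "C_k k \<psi>" for k using C_k_Suc_imp[OF C_k_real_SucI[OF D test_function_C_k[OF g]]] .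
    show "\<psi> x = 0" if x: "x \<notin> {a..b}" for x
    proof (cases "x < a")
      case True
      have "(LINT y:{x..a}|lborel. g y) = (LINT y:{x..a}|lborel. 0)"
        by (rule set_lebesgue_integral_cong) (auto simp: out)
      then show ?thesis using True by (simp add: \<psi>_def indefinite_integral_le)
    next
      case False
      then have ax: "a \<le> x" "b < x" using x by auto
      have "(LINT y:{a..x}|lborel. g y) = (LINT y|lborel. g y)"
        unfolding set_lebesgue_integral_def
      proof (rule Bochner_Integration.integral_cong[OF refl])
        show "indicat_real {a..x} y *\<^sub>R g y = g y" for y
          using out[of y] ax by (cases "y \<in> {a..x}") auto
      qed
      then show ?thesis using mean ax by (simp add: \<psi>_def indefinite_integral_ge)
    qed
  qed
  moreover have "deriv \<psi> = g" using D by (auto intro: DERIV_imp_deriv)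
  ultimately show ?thesis by (rule that)
qed

lemma locally_integrable_weighted_slice_integral:
  fixes k :: "real \<times> real \<Rightarrow> real"
  assumes k: "locally_integrable (I1 \<times> I2) k" and \<psi>: "test_function I1 \<psi>"
  shows "locally_integrable I2 (\<lambda>s. LINT x|lborel. k (x, s) * \<psi> x)"
  unfolding locally_integrable_def
proof (intro allI impI)
  fix L assume L: "compact L" "L \<subseteq> I2"
  obtain K where K: "compact K" "K \<subseteq> I1" "\<And>x. x \<notin> K \<Longrightarrow> \<psi> x = 0" using test_functionE[OF \<psi>] by blast
  have int: "set_integrable lborel (K \<times> L) (\<lambda>z. \<psi> (fst z) * k z)"
    by (intro set_integrable_mult_continuous compact_Times K(1) L(1) locally_integrable_TimesD[OF k]
        K(2) L(2) continuous_on_compose2[OF test_function_continuous_on[OF \<psi>]] continuous_intros) auto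
  have "indicator (K \<times> L) (x, s) *\<^sub>R (\<psi> x * k (x, s)) = indicator L s * (k (x, s) * \<psi> x)" for x s
    using K(3)[of x] by (auto simp: indicator_def)
  with lborel_integrable_snd[OF int[unfolded set_integrable_def]]
  show "set_integrable lborel L (\<lambda>s. LINT x|lborel. k (x, s) * \<psi> x)"
    unfolding set_integrable_def by (simp only: fst_conv integral_mult_right_zero real_scaleR_def)
qed

text \<open>The integral \<open>c\<close> of \<open>k\<close> against a test function \<open>\<omega>\<close> of mean one does the job, since
  \<open>\<psi> - (\<integral>\<psi>) \<omega>\<close> is the derivative of a test function.\<close>

lemma weak_deriv_fst_eq_0E:
  fixes k :: "real \<times> real \<Rightarrow> real"
  assumes I1: "open I1" "is_interval I1" "I1 \<noteq> {}" and I2: "open I2"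
    and k: "weak_deriv_fst I1 I2 k (\<lambda>z. 0)" and [measurable]: "k \<in> borel_measurable borel"
  obtains c where "c \<in> borel_measurable borel" "AE z in lborel. z \<in> I1 \<times> I2 \<longrightarrow> k z = c (snd z)"
proof -
  have kloc: "locally_integrable (I1 \<times> I2) k" using k by (simp add: weak_deriv_fst_def)
  obtain \<omega> where \<omega>: "test_function I1 \<omega>" "(LINT x|lborel. \<omega> x) = 1"
    using test_function_unit_integralE[OF I1] by blast
  note [measurable] = test_function_borel_measurable[OF \<omega>(1)]
  define c where "c s = (LINT x|lborel. k (x, s) * \<omega> x)" for s
  have cm [measurable]: "c \<in> borel_measurable borel" unfolding c_def by measurable
  have cloc: "locally_integrable I2 c"
    unfolding c_def by (rule locally_integrable_weighted_slice_integral[OF kloc \<omega>(1)])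
  have "AE z in lborel. z \<in> I1 \<times> I2 \<longrightarrow> k z - c (snd z) = 0"
  proof (rule orthogonal_to_tensors_imp_AE_eq_0[OF I1(1) I2
        locally_integrable_diff[OF kloc locally_integrable_snd[OF cloc]]])
    fix \<psi> \<phi> assume \<psi>: "test_function I1 \<psi>" and \<phi>: "test_function I2 \<phi>"
    define M where "M = (LINT x|lborel. \<psi> x)"
    have int: "integrable lborel (\<lambda>z. k z * (\<eta> (fst z) * \<phi> (snd z)))" if "test_function I1 \<eta>" for \<eta>
      by (rule integrable_mult_test_function[OF kloc test_function_tensor[OF that \<phi>]])
    have "test_function I1 (\<lambda>x. \<psi> x - M * \<omega> x)" by (intro test_function_diff test_function_cmult \<psi> \<omega>)
    moreover have "(LINT x|lborel. \<psi> x - M * \<omega> x) = 0"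
      using test_function_integrable[OF \<psi>] test_function_integrable[OF \<omega>(1)] \<omega>(2) by (simp add: M_def)
    ultimately obtain \<Psi> where \<Psi>: "test_function I1 \<Psi>" "deriv \<Psi> = (\<lambda>x. \<psi> x - M * \<omega> x)"
      using test_function_primitiveE[OF I1] by blast
    have "0 = (LINT z|lborel. k z * (deriv \<Psi> (fst z) * \<phi> (snd z)))"
      using k \<Psi>(1) \<phi> by (simp add: weak_deriv_fst_def)
    also have "\<dots> = (LINT z|lborel. k z * (\<psi> (fst z) * \<phi> (snd z)) - M * (k z * (\<omega> (fst z) * \<phi> (snd z))))"
      by (simp add: \<Psi>(2) algebra_simps)
    also have "\<dots> = (LINT z|lborel. k z * (\<psi> (fst z) * \<phi> (snd z)))
        - M * (LINT z|lborel. k z * (\<omega> (fst z) * \<phi> (snd z)))"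
      using int[OF \<psi>] int[OF \<omega>(1)] by simp
    also have "(LINT z|lborel. k z * (\<omega> (fst z) * \<phi> (snd z))) = (LINT s|lborel. c s * \<phi> s)"
      using lborel_integral_snd[OF int[OF \<omega>(1)], symmetric]
      by (simp add: c_def mult.assoc flip: Bochner_Integration.integral_mult_left_zero)
    also have "M * (LINT s|lborel. c s * \<phi> s) = (LINT z|lborel. \<psi> (fst z) * (c (snd z) * \<phi> (snd z)))"
      using integral_tensor[OF test_function_integrable[OF \<psi>] integrable_mult_test_function[OF cloc \<phi>]]
      by (simp add: M_def)
    finally have "(LINT z|lborel. k z * (\<psi> (fst z) * \<phi> (snd z)))
        = (LINT z|lborel. \<psi> (fst z) * (c (snd z) * \<phi> (snd z)))" by simp
    then show "(LINT z|lborel. (k z - c (snd z)) * (\<psi> (fst z) * \<phi> (snd z))) = 0"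
      using int[OF \<psi>]
        integrable_tensor[OF test_function_integrable[OF \<psi>] integrable_mult_test_function[OF cloc \<phi>]]
      by (simp add: algebra_simps)
  qed
  then show ?thesis by (intro that[OF cm]) simp
qed

subsection \<open>Representation by primitives\<close>

lemma primitive_on_indefinite_integral_locally_integrable:
  assumes "is_interval I" "c \<in> I" "locally_integrable I g"
  shows "primitive_on I (indefinite_integral c g) g"
  using is_interval_Icc_subset[OF assms(1)] locally_integrableD[OF assms(3)] assms(2)
  by (intro primitive_on_indefinite_integral) auto

lemma locally_integrable_slice_indefinite_integral:
  fixes g :: "real \<times> real \<Rightarrow> real"
  assumes I1: "open I1" "is_interval I1" "c \<in> I1" and I2: "open I2"
    and g: "locally_integrable (I1 \<times> I2) g" and [measurable]: "g \<in> borel_measurable borel"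
  shows "locally_integrable (I1 \<times> I2) (\<lambda>z. indefinite_integral c (\<lambda>x. g (x, snd z)) (fst z))"
proof (rule locally_integrable_TimesI)
  fix K L assume K: "compact K" "K \<subseteq> I1" and L: "compact L" "L \<subseteq> I2"
  have "I1 \<noteq> {}" using I1(3) by auto
  then obtain a b where ab: "{a..b} \<subseteq> I1" "insert c K \<subseteq> {a<..<b}"
    using compact_subset_open_intervalE[of "insert c K" I1] K I1 by auto
  have [measurable]: "K \<in> sets borel" "L \<in> sets borel" using K(1) L(1) by (auto intro: borel_compact)
  define m where "m s = (LINT x|lborel. \<bar>indicat_real ({a..b} \<times> L) (x, s) *\<^sub>R g (x, s)\<bar>)" for s
  have "integrable lborel (\<lambda>z. \<bar>indicat_real ({a..b} \<times> L) z *\<^sub>R g z\<bar>)"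
    using locally_integrable_TimesD[OF g compact_Icc ab(1) L] unfolding set_integrable_def by simp
  from lborel_integrable_snd[OF this] have "integrable lborel m" unfolding m_def .
  moreover have "integrable lborel (indicat_real K)"
    using K(1) emeasure_compact_finite by (intro integrable_real_indicator) auto
  ultimately have "integrable lborel (\<lambda>z. indicat_real K (fst z) * m (snd z))"
    by (intro integrable_tensor)
  then show "set_integrable lborel (K \<times> L) (\<lambda>z. indefinite_integral c (\<lambda>x. g (x, snd z)) (fst z))"
    unfolding set_integrable_def
  proof (rule Bochner_Integration.integrable_bound)
    show "(\<lambda>z. indicat_real (K \<times> L) z *\<^sub>R indefinite_integral c (\<lambda>x. g (x, snd z)) (fst z))
        \<in> borel_measurable lborel"
      unfolding indicator_Times_fst_snd by measurable
    show "AE z in lborel. norm (indicat_real (K \<times> L) z *\<^sub>R indefinite_integral c (\<lambda>x. g (x, snd z)) (fst z))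
        \<le> norm (indicat_real K (fst z) * m (snd z))"
      using AE_lborel_snd[OF AE_locally_integrable_slice[OF I1(1) I2 g]]
    proof eventually_elim
      case (elim z)
      show ?case
      proof (cases "z \<in> K \<times> L")
        case True
        then have z: "fst z \<in> K" "snd z \<in> L" by auto
        then have "set_integrable lborel {a..b} (\<lambda>x. g (x, snd z))"
          using elim L(2) ab(1) by (intro locally_integrableD[of I1]) auto
        moreover have "{min c (fst z)..max c (fst z)} \<subseteq> {a..b}"
          using ab(2) z(1) by auto
        ultimately have "\<bar>indefinite_integral c (\<lambda>x. g (x, snd z)) (fst z)\<bar>
            \<le> (LINT x:{a..b}|lborel. \<bar>g (x, snd z)\<bar>)"
          by (intro abs_indefinite_integral_le) auto
        also have "\<dots> = m (snd z)"
          unfolding m_def set_lebesgue_integral_def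
          by (rule Bochner_Integration.integral_cong) (use z in \<open>auto simp: indicator_def\<close>)
        finally show ?thesis using z by (auto simp: indicator_def)
      qed (simp add: indicator_def)
    qed
  qed
qed

lemma weak_deriv_fst_indefinite_integral:
  fixes g :: "real \<times> real \<Rightarrow> real"
  assumes I1: "open I1" "is_interval I1" "c \<in> I1" and I2: "open I2"
    and g: "locally_integrable (I1 \<times> I2) g" "g \<in> borel_measurable borel"
  shows "weak_deriv_fst I1 I2 (\<lambda>z. indefinite_integral c (\<lambda>x. g (x, snd z)) (fst z)) g"
  unfolding weak_deriv_fst_def
proof (intro conjI allI impI)
  let ?G = "\<lambda>z. indefinite_integral c (\<lambda>x. g (x, snd z)) (fst z)"
  show G: "locally_integrable (I1 \<times> I2) ?G"
    by (rule locally_integrable_slice_indefinite_integral[OF I1 I2 g])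
  show "locally_integrable (I1 \<times> I2) g" by (fact g(1))
  fix \<psi> \<phi> assume \<psi>: "test_function I1 \<psi>" and \<phi>: "test_function I2 \<phi>"
  have int: "integrable lborel (\<lambda>z. ?G z * (deriv \<psi> (fst z) * \<phi> (snd z)))"
    "integrable lborel (\<lambda>z. g z * (\<psi> (fst z) * \<phi> (snd z)))"
    by (intro integrable_mult_test_function[OF G] integrable_mult_test_function[OF g(1)]
        test_function_tensor test_function_deriv \<psi> \<phi>)+
  define F where "F z = ?G z * (deriv \<psi> (fst z) * \<phi> (snd z)) + g z * (\<psi> (fst z) * \<phi> (snd z))" for z
  have Fint: "integrable lborel F" unfolding F_def using int by simp
  have "AE s in lborel. (LINT x|lborel. F (x, s)) = 0"
    using AE_locally_integrable_slice[OF I1(1) I2 g(1)]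
  proof eventually_elim
    case (elim s)
    show ?case
    proof (cases "s \<in> I2")
      case True
      then have "primitive_on I1 (\<lambda>x. ?G (x, s)) (\<lambda>x. g (x, s))"
        using primitive_on_indefinite_integral_locally_integrable[OF I1(2,3)] elim by simp
      from primitive_on_integrate_by_parts[OF I1(1,2) this \<psi>]
      have "0 = (LINT x|lborel. (?G (x, s) * deriv \<psi> x + g (x, s) * \<psi> x) * \<phi> s)" by simp
      then show ?thesis by (simp add: F_def distrib_right mult.assoc)
    next
      case False
      then show ?thesis by (simp add: F_def test_function_eq_0[OF \<phi>])
    qed
  qed
  then have "(LINT s|lborel. LINT x|lborel. F (x, s)) = 0" by (rule integral_eq_zero_AE)
  then have "(LINT z|lborel. F z) = 0" using lborel_integral_snd[OF Fint] by simp
  then show "(LINT z|lborel. ?G z * (deriv \<psi> (fst z) * \<phi> (snd z))) = - (LINT z|lborel. g z * (\<psi> (fst z) * \<phi> (snd z)))"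
    unfolding F_def using int by simp
qed

lemma weak_deriv_fst_representationE:
  fixes f g :: "real \<times> real \<Rightarrow> real"
  assumes I1: "open I1" "is_interval I1" "c \<in> I1" and I2: "open I2" and w: "weak_deriv_fst I1 I2 f g"
    and [measurable]: "f \<in> borel_measurable borel" "g \<in> borel_measurable borel"
  obtains k where "k \<in> borel_measurable borel"
    "AE z in lborel. z \<in> I1 \<times> I2 \<longrightarrow> f z = k (snd z) + indefinite_integral c (\<lambda>x. g (x, snd z)) (fst z)"
proof -
  let ?G = "\<lambda>z. indefinite_integral c (\<lambda>x. g (x, snd z)) (fst z)"
  have "locally_integrable (I1 \<times> I2) g" using w by (simp add: weak_deriv_fst_def)
  from weak_deriv_fst_diff[OF w weak_deriv_fst_indefinite_integral[OF I1 I2 this]]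
  have "weak_deriv_fst I1 I2 (\<lambda>z. f z - ?G z) (\<lambda>z. 0)" by simp
  moreover have "I1 \<noteq> {}" using I1(3) by auto
  moreover have "(\<lambda>z. f z - ?G z) \<in> borel_measurable borel" by measurable
  ultimately obtain k where "k \<in> borel_measurable borel"
    "AE z in lborel. z \<in> I1 \<times> I2 \<longrightarrow> f z - ?G z = k (snd z)"
    using weak_deriv_fst_eq_0E[OF I1(1,2) _ I2] by blast
  then show ?thesis by (intro that[of k]) (auto elim!: eventually_mono)
qed

subsection \<open>Absolutely continuous representatives\<close>

definition AE_primitive :: "(real \<Rightarrow> real) \<Rightarrow> (real \<Rightarrow> real) \<Rightarrow> bool" where
  "AE_primitive f g \<longleftrightarrow> (\<exists>u. primitive_on UNIV u g \<and> (AE y in lborel. f y = u y))"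

lemma AE_primitiveE:
  assumes "AE_primitive f g"
  obtains u where "primitive_on UNIV u g" "AE y in lborel. f y = u y"
  using assms unfolding AE_primitive_def by blast

lemma weak_deriv_fst_AE_primitive_slice:
  assumes w: "weak_deriv_fst UNIV I f g" and I: "open I"
    and "f \<in> borel_measurable borel" "g \<in> borel_measurable borel"
  shows "AE t in lborel. t \<in> I \<longrightarrow> AE_primitive (\<lambda>y. f (y, t)) (\<lambda>y. g (y, t))"
proof -
  have "locally_integrable (UNIV \<times> I) g" using w by (simp add: weak_deriv_fst_def)
  note slice = AE_locally_integrable_slice[OF open_UNIV I this]
  obtain k where k: "AE z in lborel. z \<in> UNIV \<times> I \<longrightarrow>
      f z = k (snd z) + indefinite_integral 0 (\<lambda>x. g (x, snd z)) (fst z)"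
    using weak_deriv_fst_representationE[OF open_UNIV is_interval_univ UNIV_I I w assms(3,4)] by blast
  show ?thesis
    using AE_lborel_pairD2[OF k] slice
  proof eventually_elim
    case (elim t)
    show ?case
    proof
      assume t: "t \<in> I"
      define u where "u y = k t + indefinite_integral 0 (\<lambda>x. g (x, t)) y" for y
      have "primitive_on UNIV u (\<lambda>y. 0 + g (y, t))"
        unfolding u_def using elim(2) t
        by (intro primitive_on_add primitive_on_const
            primitive_on_indefinite_integral_locally_integrable) auto
      moreover have "AE y in lborel. f (y, t) = u y"
        using elim(1) t by (simp add: u_def)
      ultimately show "AE_primitive (\<lambda>y. f (y, t)) (\<lambda>y. g (y, t))"
        unfolding AE_primitive_def by auto
    qed
  qed
qed

lemma weak_deriv_strip_AE_primitive_slice: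
  assumes "weak_deriv (strip T) (1, 0) f g"
    and "f \<in> borel_measurable borel" "g \<in> borel_measurable borel"
  shows "AE t in lborel. t \<in> {0<..<T} \<longrightarrow> AE_primitive (\<lambda>y. f (y, t)) (\<lambda>y. g (y, t))"
  using assms unfolding strip_def
  by (intro weak_deriv_fst_AE_primitive_slice weak_deriv_imp_weak_deriv_fst) auto

lemma AE_lborel_ex_ivl:
  assumes "AE t in lborel. P t" "a < (b::real)"
  obtains t where "a < t" "t < b" "P t"
proof -
  have "\<exists>t\<in>{a<..<b}. P t"
  proof (rule ccontr)
    assume "\<not> ?thesis"
    then have "AE t in lborel. t \<notin> {a<..<b}" using assms(1) by (auto elim!: eventually_mono)
    then have "{a<..<b} \<in> null_sets lborel" by (subst AE_iff_null_sets) auto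
    then show False using assms(2) by (auto simp: null_sets_def)
  qed
  then show ?thesis using that by auto
qed

lemma weak_deriv1_AE_primitive:
  assumes w: "weak_deriv1 f g"
  shows "AE_primitive f g"
proof -
  have [measurable]: "f \<in> borel_measurable borel" "g \<in> borel_measurable borel"
    using w by (auto simp: weak_deriv_def intro: borel_measurable_locally_integrable)
  have "(\<lambda>z::real \<times> real. f (fst z)) \<in> borel_measurable borel"
    "(\<lambda>z::real \<times> real. g (fst z)) \<in> borel_measurable borel"
    by measurable
  from weak_deriv_fst_AE_primitive_slice[OF weak_deriv1_imp_weak_deriv_fst[OF w] _ this, of "{0<..<1}"]
  have "AE t in lborel. t \<in> {0<..<1::real} \<longrightarrow> AE_primitive f g" by simp
  then obtain t :: real where "0 < t" "t < 1" "t \<in> {0<..<1} \<longrightarrow> AE_primitive f g"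
    by (rule AE_lborel_ex_ivl[of _ 0 1]) auto
  then show ?thesis by simp
qed

lemma AE_le_imp_le:
  fixes f :: "real \<Rightarrow> real"
  assumes f: "AE y in lborel. c \<le> f y" "continuous_on UNIV f"
  shows "c \<le> f y"
proof (rule ccontr)
  assume "\<not> c \<le> f y"
  then have "open {x. f x < c}" "y \<in> {x. f x < c}"
    using f(2) by (auto intro!: open_Collect_less continuous_intros)
  then obtain d where d: "d > 0" "ball y d \<subseteq> {x. f x < c}" using open_contains_ball by blast
  obtain t where t: "y < t" "t < y + d" "c \<le> f t" by (rule AE_lborel_ex_ivl[OF f(1), of y "y + d"]) (use d in auto)
  then have "t \<in> ball y d" by (simp add: dist_real_def)
  then show False using d(2) t(3) by auto
qed

lemma AE_ge_imp_ge:
  fixes f :: "real \<Rightarrow> real"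
  assumes "AE y in lborel. f y \<le> c" "continuous_on UNIV f"
  shows "f y \<le> c"
  using AE_le_imp_le[of "-c" "\<lambda>y. - f y" y] assms by (simp add: continuous_on_minus)

subsection \<open>Primitives in time and initial values\<close>

definition slab_integrable :: "(real \<times> real \<Rightarrow> real) \<Rightarrow> bool" where
  "slab_integrable g \<longleftrightarrow> (\<forall>r. set_integrable lborel ({-r..r} \<times> UNIV) g)"

definition time_primitive :: "(real \<Rightarrow> real) \<Rightarrow> (real \<times> real \<Rightarrow> real) \<Rightarrow> real \<times> real \<Rightarrow> real" where
  "time_primitive f0 g z = f0 (fst z) + indefinite_integral 0 (\<lambda>s. g (fst z, s)) (snd z)"

lemma time_primitive_0 [simp]: "time_primitive f0 g (y, 0) = f0 y"
  by (simp add: time_primitive_def)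

lemma borel_measurable_time_primitive [measurable]:
  assumes [measurable]: "f0 \<in> borel_measurable borel" "g \<in> borel_measurable borel"
  shows "time_primitive f0 g \<in> borel_measurable borel"
  unfolding time_primitive_def[abs_def] by measurable

lemma primitive_on_time_primitive:
  assumes "\<And>a b. set_integrable lborel {a..b} (\<lambda>s. g (y, s))"
  shows "primitive_on UNIV (\<lambda>t. time_primitive f0 g (y, t)) (\<lambda>s. g (y, s))"
  using primitive_on_add[OF primitive_on_const primitive_on_indefinite_integral, of UNIV "\<lambda>s. g (y, s)" 0 "f0 y"]
    assms by (simp add: time_primitive_def)

lemma set_integrable_if_integrable:
  "integrable M h \<Longrightarrow> A \<in> sets M \<Longrightarrow> set_integrable M A (h :: _ \<Rightarrow> real)"
  unfolding set_integrable_def by (rule integrable_mult_indicator)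

lemma slab_integrable_AE_integrable_slice:
  assumes "slab_integrable g"
  shows "AE y in lborel. integrable lborel (\<lambda>s. g (y, s))"
proof -
  have "AE y in lborel. \<forall>n::nat. integrable lborel (\<lambda>s. indicat_real ({-real n..real n} \<times> UNIV) (y, s) *\<^sub>R g (y, s))"
    unfolding AE_all_countable
    using assms lborel_AE_integrable_fst unfolding slab_integrable_def set_integrable_def by blast
  then show ?thesis
  proof eventually_elim
    case (elim y)
    obtain n where "\<bar>y\<bar> \<le> real n" using real_arch_simple by blast
    then have "(\<lambda>s. indicat_real ({-real n..real n} \<times> UNIV) (y, s) *\<^sub>R g (y, s)) = (\<lambda>s. g (y, s))"
      by (auto simp: indicator_def fun_eq_iff)
    then show ?case using elim by metis
  qed
qed

lemma AE_lborel_swap: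
  fixes P :: "'a::euclidean_space \<times> 'b::euclidean_space \<Rightarrow> bool"
  assumes "AE z in lborel. P z"
  shows "AE z in lborel. P (snd z, fst z)"
proof -
  obtain N where N: "{z \<in> space lborel. \<not> P z} \<subseteq> N" "N \<in> null_sets lborel"
    using assms by (auto simp: eventually_ae_filter)
  have [measurable]: "N \<in> sets borel" using N(2) by auto
  have "{z. (snd z, fst z) \<notin> N} \<in> sets borel" by measurable
  then have "AE z in lborel. (snd z, fst z) \<notin> N"
    using AE_lborel_pairD2[OF AE_not_in[OF N(2)]] by (intro AE_lborel_pairI) auto
  then show ?thesis using N(1) by (auto elim!: eventually_mono)
qed

lemma weak_deriv_time_primitiveE:
  assumes T: "T > 0" and w: "weak_deriv (strip T) (0, 1) f g" and gi: "slab_integrable g"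
    and [measurable]: "f \<in> borel_measurable borel" "g \<in> borel_measurable borel"
  obtains c where "c \<in> borel_measurable borel"
    "AE z in lborel. z \<in> strip T \<longrightarrow> f z = time_primitive c g z"
proof -
  have "weak_deriv_fst {0<..<T} UNIV (\<lambda>z. f (snd z, fst z)) (\<lambda>z. g (snd z, fst z))"
    using w unfolding strip_def by (rule weak_deriv_imp_weak_deriv_fst_swap)
  from weak_deriv_fst_representationE[OF _ is_interval_oo _ open_UNIV this, of "T / 2"]
  obtain k where [measurable]: "k \<in> borel_measurable borel" and k: "AE z in lborel. z \<in> {0<..<T} \<times> UNIV \<longrightarrow>
      f (snd z, fst z) = k (snd z) + indefinite_integral (T / 2) (\<lambda>s. g (snd z, s)) (fst z)"
    using T by (auto simp: measurable_compose)
  define c where "c y = k y - indefinite_integral 0 (\<lambda>s. g (y, s)) (T / 2)" for y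
  show ?thesis
  proof
    show "c \<in> borel_measurable borel" unfolding c_def by measurable
    show "AE z in lborel. z \<in> strip T \<longrightarrow> f z = time_primitive c g z"
      using AE_lborel_swap[OF k] AE_lborel_fst[OF slab_integrable_AE_integrable_slice[OF gi]]
    proof eventually_elim
      case (elim z)
      have "primitive_on UNIV (indefinite_integral 0 (\<lambda>s. g (fst z, s))) (\<lambda>s. g (fst z, s))"
        by (rule primitive_on_indefinite_integral) (auto intro: set_integrable_if_integrable elim)
      from primitive_on_eq_indefinite_integral[OF this UNIV_I UNIV_I, of "snd z" "T / 2"]
      show ?case using elim(1) by (auto simp: strip_def time_primitive_def c_def)
    qed
  qed
qed

lemma Fatou_AE_eq_0:
  fixes u :: "nat \<Rightarrow> 'a \<Rightarrow> ennreal"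
  assumes u [measurable]: "\<And>n. u n \<in> borel_measurable M"
    and lim: "AE x in M. (\<lambda>n. u n x) \<longlonglongrightarrow> l x" and zero: "(\<lambda>n. \<integral>\<^sup>+x. u n x \<partial>M) \<longlonglongrightarrow> 0"
  shows "AE x in M. l x = 0"
proof -
  have "(\<integral>\<^sup>+x. liminf (\<lambda>n. u n x) \<partial>M) \<le> liminf (\<lambda>n. \<integral>\<^sup>+x. u n x \<partial>M)"
    by (rule nn_integral_liminf[OF u])
  also have "\<dots> = 0" using lim_imp_Liminf[OF _ zero] by simp
  finally have "AE x in M. liminf (\<lambda>n. u n x) = 0"
    by (subst nn_integral_0_iff_AE[symmetric]) auto
  then show ?thesis
    using lim by eventually_elim (auto dest: lim_imp_Liminf[rotated])
qed

lemma attains_initial_sequenceE: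
  assumes init: "attains_initial f f0" and T: "T > 0" and P: "AE t in lborel. t \<in> {0<..<T} \<longrightarrow> P t"
  obtains t where "t \<longlonglongrightarrow> 0" "\<And>n. P (t n)"
    "(\<lambda>n. \<integral>\<^sup>+ y\<in>{-real n..real n}. ennreal ((f (y, t n) - f0 y)\<^sup>2) \<partial>lborel) \<longlonglongrightarrow> 0"
proof -
  define dist0 where "dist0 n t = (\<integral>\<^sup>+ y\<in>{-real n..real n}. ennreal ((f (y, t) - f0 y)\<^sup>2) \<partial>lborel)" for n t
  have "\<exists>t. 0 < t \<and> t < inverse (real (Suc n)) \<and> P t \<and> dist0 n t < ennreal (inverse (real (Suc n)))" for n
  proof -
    have \<epsilon>: "0 < inverse (real (Suc n))" by simp
    then obtain \<delta> where \<delta>: "\<delta> > 0" "AE t in lborel. 0 < t \<and> t < \<delta> \<longrightarrow> dist0 n t < ennreal (inverse (real (Suc n)))"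
      using init unfolding attains_initial_def dist0_def by blast
    have ev: "AE t in lborel. (t \<in> {0<..<T} \<longrightarrow> P t) \<and>
        (0 < t \<and> t < \<delta> \<longrightarrow> dist0 n t < ennreal (inverse (real (Suc n))))"
      using P \<delta>(2) by eventually_elim simp
    have "0 < min \<delta> (min T (inverse (real (Suc n))))" using \<delta>(1) T \<epsilon> by simp
    with ev obtain t where "0 < t" "t < min \<delta> (min T (inverse (real (Suc n))))" "(t \<in> {0<..<T} \<longrightarrow> P t) \<and>
        (0 < t \<and> t < \<delta> \<longrightarrow> dist0 n t < ennreal (inverse (real (Suc n))))"
      by (rule AE_lborel_ex_ivl)
    then show ?thesis by (intro exI[of _ t]) auto
  qed
  then obtain t where t: "\<And>n. 0 < t n" "\<And>n. t n < inverse (real (Suc n))" "\<And>n. P (t n)"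
    "\<And>n. dist0 n (t n) < ennreal (inverse (real (Suc n)))"
    by metis
  show thesis
  proof (rule that[of t])
    show "t \<longlonglongrightarrow> 0"
      by (rule real_tendsto_sandwich[OF _ _ tendsto_const LIMSEQ_inverse_real_of_nat])
        (use t(1,2) in \<open>auto intro!: always_eventually less_imp_le\<close>)
    have upper: "(\<lambda>n. ennreal (inverse (real (Suc n)))) \<longlonglongrightarrow> 0"
      using tendsto_ennrealI[OF LIMSEQ_inverse_real_of_nat] by simp
    show "(\<lambda>n. \<integral>\<^sup>+ y\<in>{-real n..real n}. ennreal ((f (y, t n) - f0 y)\<^sup>2) \<partial>lborel) \<longlonglongrightarrow> 0"
      by (rule tendsto_sandwich[OF _ _ tendsto_const upper])
        (use t(4) in \<open>auto simp: dist0_def intro!: always_eventually less_imp_le\<close>)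
  qed (rule t(3))
qed

text \<open>Along suitable times \<open>t\<^sub>n \<rightarrow> 0\<close> the slices \<open>f (\<cdot>, t\<^sub>n)\<close> tend to \<open>c\<close> pointwise and to \<open>f0\<close> in the mean.\<close>

lemma attains_initial_time_primitive_unique:
  assumes T: "T > 0" and f: "AE z in lborel. z \<in> strip T \<longrightarrow> f z = time_primitive c g z"
    and g: "slab_integrable g" and init: "attains_initial f f0"
    and [measurable]: "f \<in> borel_measurable borel" "f0 \<in> borel_measurable borel"
  shows "AE y in lborel. c y = f0 y"
proof -
  have slices: "AE t in lborel. t \<in> {0<..<T} \<longrightarrow> (AE y in lborel. f (y, t) = time_primitive c g (y, t))"
    using AE_lborel_pairD2[OF f] by (auto simp: strip_def elim!: eventually_mono)
  obtain t where t_lim: "t \<longlonglongrightarrow> 0"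
    and represented: "\<And>n. AE y in lborel. f (y, t n) = time_primitive c g (y, t n)"
    and mean_lim: "(\<lambda>n. \<integral>\<^sup>+ y\<in>{-real n..real n}. ennreal ((f (y, t n) - f0 y)\<^sup>2) \<partial>lborel) \<longlonglongrightarrow> 0"
    by (rule attains_initial_sequenceE[OF init T slices]) (rule that)
  define u where "u n y = ennreal ((f (y, t n) - f0 y)\<^sup>2) * indicator {-real n..real n} y" for n y
  have "AE y in lborel. ennreal ((c y - f0 y)\<^sup>2) = 0"
  proof (rule Fatou_AE_eq_0[where u = u])
    show "u n \<in> borel_measurable lborel" for n unfolding u_def by measurable
    show "(\<lambda>n. \<integral>\<^sup>+ y. u n y \<partial>lborel) \<longlonglongrightarrow> 0" using mean_lim by (simp add: u_def)
    have "AE y in lborel. \<forall>n. f (y, t n) = time_primitive c g (y, t n)"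
      using represented by (simp add: AE_all_countable)
    then show "AE y in lborel. (\<lambda>n. u n y) \<longlonglongrightarrow> ennreal ((c y - f0 y)\<^sup>2)"
      using slab_integrable_AE_integrable_slice[OF g]
    proof eventually_elim
      case (elim y)
      have "primitive_on UNIV (\<lambda>t. time_primitive c g (y, t)) (\<lambda>s. g (y, s))"
        by (rule primitive_on_time_primitive) (auto intro: set_integrable_if_integrable elim)
      then have "isCont (\<lambda>t. time_primitive c g (y, t)) 0"
        using primitive_on_continuous_on by (auto simp: continuous_on_eq_continuous_at)
      then have "(\<lambda>n. f (y, t n)) \<longlonglongrightarrow> c y"
        using isCont_tendsto_compose[OF _ t_lim] elim(1) by fastforce
      then have "(\<lambda>n. ennreal ((f (y, t n) - f0 y)\<^sup>2)) \<longlonglongrightarrow> ennreal ((c y - f0 y)\<^sup>2)"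
        by (intro tendsto_intros)
      moreover obtain m where "\<bar>y\<bar> \<le> real m" using real_arch_simple by blast
      then have "\<forall>\<^sub>F n in sequentially. u n y = ennreal ((f (y, t n) - f0 y)\<^sup>2)"
        by (intro eventually_sequentiallyI[of m]) (auto simp: u_def indicator_def)
      ultimately show ?case by (simp add: tendsto_cong)
    qed
  qed
  then show ?thesis by eventually_elim simp
qed

lemma weak_deriv_attains_initial_time_primitive:
  assumes T: "T > 0" and w: "weak_deriv (strip T) (0, 1) f g" and gi: "slab_integrable g"
    and init: "attains_initial f f0"
    and meas: "f \<in> borel_measurable borel" "g \<in> borel_measurable borel" "f0 \<in> borel_measurable borel"
  shows "AE z in lborel. z \<in> strip T \<longrightarrow> f z = time_primitive f0 g z"
proof -
  obtain c where c: "AE z in lborel. z \<in> strip T \<longrightarrow> f z = time_primitive c g z"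
    using weak_deriv_time_primitiveE[OF T w gi meas(1,2)] by blast
  show ?thesis
    using c AE_lborel_fst[OF attains_initial_time_primitive_unique[OF T c gi init meas(1,3)]]
    by eventually_elim (simp add: time_primitive_def)
qed

section \<open>Damped primitives\<close>

lemma primitive_on_LINT_atMost:
  fixes g :: "real \<Rightarrow> real"
  assumes g: "\<And>y. set_integrable lborel {..y} g"
  shows "primitive_on UNIV (\<lambda>y. LINT x:{..y}|lborel. g x) g"
proof (rule primitive_onI)
  fix a b :: real assume ab: "a \<le> b"
  show "set_integrable lborel {a..b} g" by (rule set_integrable_subset[OF g[of b]]) auto
  have "set_integrable lborel {a<..b} g" by (rule set_integrable_subset[OF g[of b]]) auto
  moreover have "{..b} = {..a} \<union> {a<..b}" "{..a} \<inter> {a<..b} = {}" using ab by auto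
  ultimately have "(LINT x:{..b}|lborel. g x) = (LINT x:{..a}|lborel. g x) + (LINT x:{a<..b}|lborel. g x)"
    using g[of a] by (simp add: set_integral_Un)
  also have "(LINT x:{a<..b}|lborel. g x) = (LINT x:{a..b}|lborel. g x)"
    using interval_integral_Ioc[OF ab, of g] interval_integral_Icc[OF ab, of g] by simp
  finally show "(LINT x:{..b}|lborel. g x) - (LINT x:{..a}|lborel. g x) = (LINT x:{a..b}|lborel. g x)"
    by simp
qed

text \<open>The solution of \<open>u' = j - r u\<close> that vanishes at \<open>-\<infinity>\<close> if \<open>r\<close> is not integrable there.\<close>

definition damped_primitive :: "(real \<Rightarrow> real) \<Rightarrow> (real \<Rightarrow> real) \<Rightarrow> real \<Rightarrow> real" where
  "damped_primitive r j y = exp (- indefinite_integral 0 r y) *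
     (LINT x:{..y}|lborel. exp (indefinite_integral 0 r x) * j x)"

context
  fixes r :: "real \<Rightarrow> real"
  assumes r_cont: "continuous_on UNIV r" and r_nonneg: "\<And>y. 0 \<le> r y"
begin

lemma indefinite_integral_mono:
  assumes "x \<le> y"
  shows "indefinite_integral 0 r x \<le> indefinite_integral 0 r y"
  by (rule DERIV_nonneg_imp_nondecreasing[OF assms])
    (use indefinite_integral_DERIV[OF r_cont] r_nonneg in blast)

lemma primitive_on_exp_indefinite_integral:
  "primitive_on UNIV (\<lambda>y. exp (c * indefinite_integral 0 r y)) (\<lambda>y. exp (c * indefinite_integral 0 r y) * (c * r y))"
proof (rule primitive_on_chain[OF _ _ open_UNIV UNIV_I DERIV_exp])
  show "primitive_on UNIV (\<lambda>y. c * indefinite_integral 0 r y) (\<lambda>y. c * r y)"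
    by (intro primitive_on_cmult primitive_on_indefinite_integral
        set_integrable_continuous_compact[OF r_cont]) auto
qed (auto intro: continuous_intros)

lemma set_integrable_exp_indefinite_integral_mult:
  assumes "integrable lborel j"
  shows "set_integrable lborel {..y} (\<lambda>x. exp (indefinite_integral 0 r x) * j x)"
proof (rule set_integrable_mult_bounded)
  show "set_integrable lborel {..y} j" by (rule set_integrable_if_integrable[OF assms]) simp
  have "continuous_on UNIV (\<lambda>x. exp (1 * indefinite_integral 0 r x))"
    using primitive_on_continuous_on[OF primitive_on_exp_indefinite_integral open_UNIV] .
  then have [measurable]: "(\<lambda>x. exp (indefinite_integral 0 r x)) \<in> borel_measurable borel"
    by (simp add: borel_measurable_continuous_onI)
  show "set_borel_measurable lborel {..y} (\<lambda>x. exp (indefinite_integral 0 r x))"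
    unfolding set_borel_measurable_def by measurable
  show "bounded ((\<lambda>x. exp (indefinite_integral 0 r x)) ` {..y})"
    using indefinite_integral_mono
    by (intro boundedI[where B = "exp (indefinite_integral 0 r y)"]) auto
qed

lemma primitive_on_damped_primitive:
  assumes "integrable lborel j"
  shows "primitive_on UNIV (damped_primitive r j) (\<lambda>y. j y - r y * damped_primitive r j y)"
proof -
  let ?I = "\<lambda>y. LINT x:{..y}|lborel. exp (indefinite_integral 0 r x) * j x"
  have "primitive_on UNIV (\<lambda>y. exp (- 1 * indefinite_integral 0 r y) * ?I y)
    (\<lambda>y. exp (- 1 * indefinite_integral 0 r y) * (exp (indefinite_integral 0 r y) * j y)
      + exp (- 1 * indefinite_integral 0 r y) * (- 1 * r y) * ?I y)"
    by (intro primitive_on_mult primitive_on_exp_indefinite_integral primitive_on_LINT_atMost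
        set_integrable_exp_indefinite_integral_mult assms is_interval_univ)
  then show ?thesis
    by (rule primitive_on_cong[OF is_interval_univ]) (simp_all add: damped_primitive_def exp_minus field_simps)
qed

lemma abs_damped_primitive_le:
  assumes "integrable lborel j"
  shows "\<bar>damped_primitive r j y\<bar> \<le> damped_primitive r (\<lambda>x. \<bar>j x\<bar>) y"
  using set_integral_abs_bound[OF set_integrable_exp_indefinite_integral_mult[OF assms]]
  by (simp add: damped_primitive_def abs_mult)

lemma damped_primitive_abs_nonneg:
  assumes "integrable lborel j"
  shows "0 \<le> damped_primitive r (\<lambda>x. \<bar>j x\<bar>) y"
  using abs_damped_primitive_le[OF assms, of y] by linarith

lemma damped_primitive_abs_le_integral:
  assumes j: "integrable lborel j"
  shows "damped_primitive r (\<lambda>x. \<bar>j x\<bar>) y \<le> (LINT x|lborel. \<bar>j x\<bar>)"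
proof -
  let ?X = "indefinite_integral 0 r"
  have "(LINT x:{..y}|lborel. exp (?X x) * \<bar>j x\<bar>) \<le> (LINT x|lborel. exp (?X y) * \<bar>j x\<bar>)"
    unfolding set_lebesgue_integral_def
  proof (rule integral_mono)
    show "integrable lborel (\<lambda>x. indicat_real {..y} x *\<^sub>R (exp (?X x) * \<bar>j x\<bar>))"
      using set_integrable_exp_indefinite_integral_mult[OF integrable_abs[OF j]]
      unfolding set_integrable_def .
    show "integrable lborel (\<lambda>x. exp (?X y) * \<bar>j x\<bar>)" using j by simp
    show "indicat_real {..y} x *\<^sub>R (exp (?X x) * \<bar>j x\<bar>) \<le> exp (?X y) * \<bar>j x\<bar>" for x
      using indefinite_integral_mono[of x y] by (auto simp: indicator_def intro: mult_right_mono)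
  qed
  then show ?thesis by (simp add: damped_primitive_def exp_minus field_simps)
qed

lemma integral_mult_abs_damped_primitive_le:
  assumes j: "integrable lborel j" and ab: "a \<le> b"
  shows "(LINT y:{a..b}|lborel. r y * \<bar>damped_primitive r j y\<bar>) \<le> 2 * (LINT y|lborel. \<bar>j y\<bar>)"
proof -
  let ?Q = "damped_primitive r (\<lambda>x. \<bar>j x\<bar>)"
  have cont: "continuous_on UNIV (damped_primitive r i)" if "integrable lborel i" for i
    using primitive_on_continuous_on[OF primitive_on_damped_primitive[OF that] open_UNIV] .
  have rQ: "set_integrable lborel {a..b} (\<lambda>y. r y * ?Q y)"
    by (intro set_integrable_continuous_compact continuous_intros r_cont cont integrable_abs j compact_Icc)
  have ji: "set_integrable lborel {a..b} (\<lambda>y. \<bar>j y\<bar>)"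
    by (intro set_integrable_if_integrable integrable_abs j) simp
  have "(LINT y:{a..b}|lborel. r y * \<bar>damped_primitive r j y\<bar>) \<le> (LINT y:{a..b}|lborel. r y * ?Q y)"
    by (intro set_integral_mono rQ set_integrable_continuous_compact continuous_intros r_cont cont j
        compact_Icc mult_left_mono abs_damped_primitive_le r_nonneg)
  also have "\<dots> = (LINT y:{a..b}|lborel. \<bar>j y\<bar>) + ?Q a - ?Q b"
    using primitive_onD(2)[OF primitive_on_damped_primitive[OF integrable_abs[OF j]] UNIV_I UNIV_I ab] ji rQ
    by simp
  also have "\<dots> \<le> (LINT y|lborel. \<bar>j y\<bar>) + (LINT y|lborel. \<bar>j y\<bar>)"
  proof -
    have "(LINT y:{a..b}|lborel. \<bar>j y\<bar>) \<le> (LINT y|lborel. \<bar>j y\<bar>)"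
      using ji j unfolding set_lebesgue_integral_def set_integrable_def
      by (intro integral_mono) (auto simp: indicator_def)
    then show ?thesis
      using damped_primitive_abs_le_integral[OF j, of a] damped_primitive_abs_nonneg[OF j, of b] by linarith
  qed
  finally show ?thesis by simp
qed

end

section \<open>Densities with regular inverse\<close>

lemma L_infty_UNIVE:
  fixes f :: "real \<Rightarrow> real"
  assumes "L_infty UNIV f"
  obtains C where "C > 0" "f \<in> borel_measurable borel" "AE y in lborel. \<bar>f y\<bar> \<le> C"
proof -
  obtain C where C: "AE y in lborel. \<bar>f y\<bar> \<le> C" and m: "set_borel_measurable lborel UNIV f"
    using assms unfolding L_infty_def by auto
  show ?thesis
    by (rule that[of "max C 1"])
       (use m C in \<open>auto simp: set_borel_measurable_def elim!: eventually_mono\<close>)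
qed

lemma Landau_inequality:
  fixes B D :: "real \<Rightarrow> real"
  assumes B: "\<And>y. (B has_real_derivative D y) (at y)" "\<And>y. 0 \<le> B y"
    and D: "M-lipschitz_on UNIV D" and M: "0 < M"
  shows "(D y)\<^sup>2 \<le> 2 * M * B y"
proof -
  define T where "T x = B x - D y * (x - y) - M * (x - y)\<^sup>2 / 2" for x
  have T: "(T has_real_derivative D x - D y - M * (x - y)) (at x)" for x
    unfolding T_def[abs_def] by (auto intro!: derivative_eq_intros B(1))
  have lip: "\<bar>D x - D y\<bar> \<le> M * \<bar>x - y\<bar>" for x
    using lipschitz_onD[OF D, of x y] by (simp add: dist_real_def)
  have "T x \<le> T y" for x
  proof (cases "y \<le> x")
    case True
    then show ?thesis
    proof (rule DERIV_nonpos_imp_nonincreasing)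
      fix z assume "y \<le> z"
      then have "D z - D y - M * (z - y) \<le> 0" using lip[of z] by (simp add: abs_le_iff)
      then show "\<exists>d. (T has_real_derivative d) (at z) \<and> d \<le> 0" using T by blast
    qed
  next
    case False
    then have "x \<le> y" by simp
    then show ?thesis
    proof (rule DERIV_nonneg_imp_nondecreasing)
      fix z assume "z \<le> y"
      then have "0 \<le> D z - D y - M * (z - y)"
        using lip[of z] by (simp add: abs_le_iff abs_of_nonpos algebra_simps)
      then show "\<exists>d. (T has_real_derivative d) (at z) \<and> 0 \<le> d" using T by blast
    qed
  qed
  from this[of "y - D y / M"] have "B (y - D y / M) + (D y)\<^sup>2 / (2 * M) \<le> B y"
    using M by (simp add: T_def power_divide power2_eq_square)
  then have "(D y)\<^sup>2 / (2 * M) \<le> B y" using B(2)[of "y - D y / M"] by linarith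
  then show ?thesis using M by (simp add: field_simps)
qed

locale inverse_density =
  fixes B D dD :: "real \<Rightarrow> real" and M Bmin :: real
  assumes DERIV_B: "\<And>y. (B has_real_derivative D y) (at y)" and B_ge: "\<And>y. Bmin \<le> B y" and Bmin_pos: "0 < Bmin"
    and D_primitive: "primitive_on UNIV D dD" and dD_measurable [measurable]: "dD \<in> borel_measurable borel"
    and dD_le: "AE y in lborel. \<bar>dD y\<bar> \<le> M" and M_pos: "0 < M"
begin

lemma B_pos: "0 < B y"
  using B_ge Bmin_pos by (meson less_le_trans)

lemma continuous_on_B: "continuous_on UNIV B"
  using DERIV_B by (auto intro!: continuous_at_imp_continuous_on DERIV_isCont)

lemma continuous_on_D: "continuous_on UNIV D"
  by (rule primitive_on_continuous_on[OF D_primitive open_UNIV])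

lemma B_D_measurable [measurable]: "B \<in> borel_measurable borel" "D \<in> borel_measurable borel"
  by (intro borel_measurable_continuous_onI continuous_on_B continuous_on_D)+

lemma D_squared_le: "(D y)\<^sup>2 \<le> 2 * M * B y"
proof (rule Landau_inequality[OF DERIV_B less_imp_le[OF B_pos] _ M_pos])
  show "M-lipschitz_on UNIV D"
    by (rule primitive_on_lipschitz_on[OF D_primitive]) (use dD_le M_pos in auto)
qed

lemma abs_D_le: "\<bar>D y\<bar> \<le> sqrt (2 * M) * sqrt (B y)"
  using real_sqrt_le_mono[OF D_squared_le] by (simp add: real_sqrt_mult)

definition log_deriv :: "real \<Rightarrow> real" where
  "log_deriv y = D y / B y"

definition log_deriv' :: "real \<Rightarrow> real" where
  "log_deriv' y = dD y / B y - (D y)\<^sup>2 / (B y)\<^sup>2"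

lemma log_deriv_measurable [measurable]:
  "log_deriv \<in> borel_measurable borel" "log_deriv' \<in> borel_measurable borel"
  unfolding log_deriv_def[abs_def] log_deriv'_def[abs_def] by measurable

lemma primitive_on_ln_B: "primitive_on UNIV (\<lambda>y. ln (B y)) log_deriv"
proof (rule primitive_on_DERIV[OF is_interval_univ])
  show "((\<lambda>y. ln (B y)) has_real_derivative log_deriv y) (at y within UNIV)" for y
    using DERIV_B B_pos[of y] unfolding log_deriv_def by (auto intro!: derivative_eq_intros)
  show "continuous_on UNIV log_deriv"
    unfolding log_deriv_def[abs_def]
    using B_pos by (intro continuous_intros continuous_on_B continuous_on_D) (simp add: less_imp_neq[symmetric])
qed

lemma primitive_on_log_deriv: "primitive_on UNIV log_deriv log_deriv'"
proof -
  have "primitive_on UNIV B D"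
    using DERIV_B continuous_on_D by (intro primitive_on_DERIV) auto
  then have "primitive_on UNIV (\<lambda>y. inverse (B y)) (\<lambda>y. - (inverse (B y) * inverse (B y)) * D y)"
    by (rule primitive_on_chain[OF is_interval_univ, where S = "{0<..}"])
      (auto intro!: derivative_eq_intros continuous_intros B_pos)
  from primitive_on_mult[OF is_interval_univ D_primitive this]
  show ?thesis
    by (rule primitive_on_cong[OF is_interval_univ])
      (simp_all add: log_deriv_def log_deriv'_def divide_inverse power2_eq_square)
qed

lemma abs_log_deriv_le: "\<bar>log_deriv y\<bar> \<le> sqrt (2 * M) / sqrt (B y)"
proof -
  have "\<bar>log_deriv y\<bar> \<le> sqrt (2 * M) * sqrt (B y) / B y"
    using abs_D_le B_pos[of y] by (simp add: log_deriv_def divide_right_mono)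
  also have "\<dots> = sqrt (2 * M) / sqrt (B y)"
    using B_pos[of y] by (simp add: field_simps)
  finally show ?thesis .
qed

lemma abs_log_deriv'_le: "AE y in lborel. \<bar>log_deriv' y\<bar> \<le> 3 * M / B y"
  using dD_le
proof eventually_elim
  case (elim y)
  have "(D y)\<^sup>2 / (B y)\<^sup>2 \<le> 2 * M * B y / (B y)\<^sup>2"
    using D_squared_le by (intro divide_right_mono) auto
  also have "\<dots> = 2 * M / B y" using B_pos[of y] by (simp add: power2_eq_square)
  finally have "(D y)\<^sup>2 / (B y)\<^sup>2 \<le> 2 * M / B y" .
  moreover have "\<bar>dD y / B y\<bar> \<le> M / B y"
    using elim B_pos[of y] by (simp add: divide_right_mono)
  moreover have "\<bar>log_deriv' y\<bar> \<le> \<bar>dD y / B y\<bar> + (D y)\<^sup>2 / (B y)\<^sup>2"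
    unfolding log_deriv'_def by (rule order_trans[OF abs_triangle_ineq4]) simp
  ultimately have "\<bar>log_deriv' y\<bar> \<le> M / B y + 2 * M / B y" by linarith
  also have "\<dots> = 3 * M / B y" by (simp flip: add_divide_distrib)
  finally show ?case .
qed

end

lemma inverse_density_exists:
  assumes \<rho>: "\<And>y. 0 < \<rho> y" "L_infty UNIV \<rho>"
    and w: "weak_deriv1 (\<lambda>y. 1 / \<rho> y) d" "weak_deriv1 d dd" "L_infty UNIV dd"
  shows "\<exists>B D M b. inverse_density B D dd M b \<and> (AE y in lborel. \<rho> y = 1 / B y)"
proof -
  obtain C where C: "C > 0" "AE y in lborel. \<bar>\<rho> y\<bar> \<le> C" using L_infty_UNIVE[OF \<rho>(2)] by metis
  obtain M where M: "M > 0" "dd \<in> borel_measurable borel" "AE y in lborel. \<bar>dd y\<bar> \<le> M"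
    using L_infty_UNIVE[OF w(3)] by metis
  obtain B where B: "primitive_on UNIV B d" "AE y in lborel. 1 / \<rho> y = B y"
    using AE_primitiveE[OF weak_deriv1_AE_primitive[OF w(1)]] by blast
  obtain D where D: "primitive_on UNIV D dd" "AE y in lborel. d y = D y"
    using AE_primitiveE[OF weak_deriv1_AE_primitive[OF w(2)]] by blast
  have Dc: "continuous_on UNIV D" by (rule primitive_on_continuous_on[OF D(1) open_UNIV])
  have [measurable]: "D \<in> borel_measurable borel" using Dc by (rule borel_measurable_continuous_onI)
  have "primitive_on UNIV B D"
    by (rule primitive_on_cong_deriv_AE[OF is_interval_univ B(1)])
      (use D(2) in \<open>auto simp: set_borel_measurable_def\<close>)
  note DERIV = primitive_on_imp_DERIV[OF this Dc]
  have "AE y in lborel. 1 / C \<le> B y"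
    using C(2) B(2)
  proof eventually_elim
    case (elim y)
    have "1 / C \<le> 1 / \<rho> y" using elim(1) \<rho>(1)[of y] C(1) by (intro divide_left_mono) auto
    then show ?case unfolding elim(2) .
  qed
  moreover have "continuous_on UNIV B" by (rule primitive_on_continuous_on[OF B(1) open_UNIV])
  ultimately have "1 / C \<le> B y" for y by (rule AE_le_imp_le)
  then have "inverse_density B D dd M (1 / C)"
    using DERIV D(1) M C(1) by unfold_locales auto
  moreover have "AE y in lborel. \<rho> y = 1 / B y" using B(2) by eventually_elim (auto dest: sym)
  ultimately show ?thesis by blast
qed

lemma density_locally_bounded_below:
  assumes "\<And>y. 0 < \<rho> y" "L_infty UNIV \<rho>"
    and "weak_deriv1 (\<lambda>y. 1 / \<rho> y) d" "weak_deriv1 d dd" "L_infty UNIV dd"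
  shows "\<exists>c>0. AE y in lborel. \<bar>y\<bar> \<le> N \<longrightarrow> c \<le> \<rho> y"
proof -
  obtain B D M b where B: "inverse_density B D dd M b" "AE y in lborel. \<rho> y = 1 / B y"
    using inverse_density_exists[OF assms] by blast
  interpret inverse_density B D dd M b by fact
  have "bounded (B ` {-N..N})"
    by (intro compact_imp_bounded compact_continuous_image continuous_on_subset[OF continuous_on_B]) auto
  then obtain K where K: "K > 0" "\<And>y. y \<in> {-N..N} \<Longrightarrow> \<bar>B y\<bar> \<le> K" by (auto simp: bounded_pos)
  have "AE y in lborel. \<bar>y\<bar> \<le> N \<longrightarrow> 1 / K \<le> \<rho> y"
    using B(2)
  proof eventually_elim
    case (elim y)
    show ?case
    proof
      assume "\<bar>y\<bar> \<le> N"
      then have "B y \<le> K" using K(2)[of y] by (simp add: abs_le_iff)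
      then show "1 / K \<le> \<rho> y" unfolding elim using B_pos[of y] by (intro divide_left_mono) auto
    qed
  qed
  then show ?thesis using K(1) by (intro exI[of _ "1 / K"]) simp
qed

section \<open>The entropy weight\<close>

definition entropy_weight ::
    "real \<Rightarrow> real \<Rightarrow> (real \<Rightarrow> real) \<Rightarrow> (real \<Rightarrow> real) \<Rightarrow> (real \<Rightarrow> real) \<Rightarrow> (real \<Rightarrow> real) \<Rightarrow> bool" where
  "entropy_weight \<alpha> C \<rho> J0 e e' \<longleftrightarrow> primitive_on UNIV e e' \<and> e' \<in> borel_measurable borel \<and>
     (AE y in lborel. \<bar>e y\<bar> \<le> C * sqrt (\<rho> y) \<and> \<bar>e' y\<bar> \<le> C * \<rho> y \<and>
        \<bar>indefinite_integral 0 (\<lambda>x. J0 x * e x) y + \<alpha> * ln (\<rho> y)\<bar> \<le> C)"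

text \<open>The weight is \<open>e = \<alpha> H (ln B)'\<close>, where \<open>H\<close> regularises \<open>1 / J\<close> at the length scale \<open>\<surd>B\<close>:
  subtracting the damped primitive of \<open>j = (1 / J)'\<close> makes \<open>e'\<close> of size \<open>1 / B\<close> although \<open>j\<close> is
  unbounded, while \<open>J e\<close> still differs from \<open>\<alpha> (ln B)'\<close> by an integrable function.\<close>

locale regularised_weight = inverse_density +
  fixes \<alpha> Jmin Jmax :: real and J j :: "real \<Rightarrow> real"
  assumes \<alpha>_pos: "0 < \<alpha>" and Jmin_pos: "0 < Jmin" and J_bounds: "\<And>y. Jmin \<le> J y" "\<And>y. J y \<le> Jmax"
    and J_cont: "continuous_on UNIV J"
    and j_primitive: "primitive_on UNIV (\<lambda>y. 1 / J y) j" and j_integrable: "integrable lborel j"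
begin

definition variation :: real where
  "variation = (LINT y|lborel. \<bar>j y\<bar>)"

definition rate :: "real \<Rightarrow> real" where
  "rate y = 1 / sqrt (B y)"

definition correction :: "real \<Rightarrow> real" where
  "correction = damped_primitive rate j"

definition regularised :: "real \<Rightarrow> real" where
  "regularised y = 1 / J y - correction y"

definition weight :: "real \<Rightarrow> real" where
  "weight y = \<alpha> * (regularised y * log_deriv y)"

definition weight' :: "real \<Rightarrow> real" where
  "weight' y = \<alpha> * (regularised y * log_deriv' y + rate y * correction y * log_deriv y)"

lemma J_pos: "0 < J y"
  using J_bounds(1)[of y] Jmin_pos by linarith

lemma variation_nonneg: "0 \<le> variation"
  by (simp add: variation_def)

lemma rate_nonneg: "0 \<le> rate y"
  using B_pos[of y] by (simp add: rate_def)

lemma continuous_on_rate: "continuous_on UNIV rate"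
  unfolding rate_def[abs_def]
  using B_pos by (intro continuous_intros continuous_on_B) (simp add: less_imp_neq[symmetric])

lemma abs_correction_le: "\<bar>correction y\<bar> \<le> variation"
  unfolding correction_def variation_def
  using abs_damped_primitive_le[OF continuous_on_rate rate_nonneg j_integrable]
    damped_primitive_abs_le_integral[OF continuous_on_rate rate_nonneg j_integrable]
  by (rule order_trans)

lemma primitive_on_correction: "primitive_on UNIV correction (\<lambda>y. j y - rate y * correction y)"
  unfolding correction_def
  by (rule primitive_on_damped_primitive[OF continuous_on_rate rate_nonneg j_integrable])

lemma continuous_on_correction: "continuous_on UNIV correction"
  by (rule primitive_on_continuous_on[OF primitive_on_correction open_UNIV])

lemma integral_rate_correction_le:
  "a \<le> b \<Longrightarrow> (LINT y:{a..b}|lborel. rate y * \<bar>correction y\<bar>) \<le> 2 * variation"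
  unfolding correction_def variation_def
  by (rule integral_mult_abs_damped_primitive_le[OF continuous_on_rate rate_nonneg j_integrable])

lemma primitive_on_regularised: "primitive_on UNIV regularised (\<lambda>y. rate y * correction y)"
  using primitive_on_diff[OF j_primitive primitive_on_correction] by (simp add: regularised_def[abs_def])

lemma abs_regularised_le: "\<bar>regularised y\<bar> \<le> 1 / Jmin + variation"
proof -
  have "1 / J y \<le> 1 / Jmin" using J_bounds(1)[of y] Jmin_pos J_pos[of y] by (intro divide_left_mono) auto
  moreover have "0 < 1 / J y" using J_pos[of y] by simp
  ultimately show ?thesis
    using abs_correction_le[of y] unfolding regularised_def by linarith
qed

lemma primitive_on_weight: "primitive_on UNIV weight weight'"
  unfolding weight_def[abs_def] weight'_def[abs_def]
  by (intro primitive_on_cmult primitive_on_mult[OF is_interval_univ] primitive_on_regularised primitive_on_log_deriv)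

lemma continuous_on_weight: "continuous_on UNIV weight"
  by (rule primitive_on_continuous_on[OF primitive_on_weight open_UNIV])

lemma weight'_measurable: "weight' \<in> borel_measurable borel"
proof -
  have [measurable]: "correction \<in> borel_measurable borel" "J \<in> borel_measurable borel"
    by (intro borel_measurable_continuous_onI continuous_on_correction J_cont)+
  show ?thesis
    unfolding weight'_def[abs_def] regularised_def rate_def by measurable
qed

lemma abs_weight_le: "\<bar>weight y\<bar> \<le> \<alpha> * ((1 / Jmin + variation) * sqrt (2 * M)) * rate y"
proof -
  have "\<bar>regularised y\<bar> * \<bar>log_deriv y\<bar> \<le> (1 / Jmin + variation) * (sqrt (2 * M) * rate y)"
    using abs_regularised_le abs_log_deriv_le Jmin_pos variation_nonneg
    by (intro mult_mono) (auto simp: rate_def)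
  then show ?thesis using \<alpha>_pos by (simp add: weight_def abs_mult mult.assoc)
qed

lemma abs_weight'_le:
  "AE y in lborel. \<bar>weight' y\<bar> \<le> \<alpha> * ((1 / Jmin + variation) * (3 * M) + variation * sqrt (2 * M)) * (1 / B y)"
  using abs_log_deriv'_le
proof eventually_elim
  case (elim y)
  have "\<bar>regularised y * log_deriv' y + rate y * correction y * log_deriv y\<bar>
      \<le> \<bar>regularised y\<bar> * \<bar>log_deriv' y\<bar> + (rate y * \<bar>correction y\<bar>) * \<bar>log_deriv y\<bar>"
    using abs_triangle_ineq[of "regularised y * log_deriv' y"] rate_nonneg by (metis abs_mult abs_of_nonneg)
  also have "\<dots> \<le> (1 / Jmin + variation) * (3 * M / B y)
      + (rate y * variation) * (sqrt (2 * M) / sqrt (B y))"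
    using abs_regularised_le elim abs_correction_le abs_log_deriv_le Jmin_pos variation_nonneg rate_nonneg
    by (intro add_mono mult_mono) auto
  also have "\<dots> = ((1 / Jmin + variation) * (3 * M) + variation * sqrt (2 * M)) * (1 / B y)"
    using B_pos[of y] by (simp add: rate_def add_divide_distrib)
  finally have "\<bar>regularised y * log_deriv' y + rate y * correction y * log_deriv y\<bar>
      \<le> ((1 / Jmin + variation) * (3 * M) + variation * sqrt (2 * M)) * (1 / B y)" .
  from mult_left_mono[OF this less_imp_le[OF \<alpha>_pos]] \<alpha>_pos show ?case
    by (simp add: weight'_def abs_mult mult.assoc)
qed

lemma primitive_on_weighted_volume:
  "primitive_on UNIV (indefinite_integral 0 (\<lambda>x. J x * weight x)) (\<lambda>x. J x * weight x)"
  by (intro primitive_on_indefinite_integral set_integrable_continuous_compact continuous_on_mult J_cont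
      continuous_on_weight compact_Icc UNIV_I)

lemma abs_weighted_volume_defect_le:
  assumes "a \<le> b"
  shows "\<bar>LINT x:{a..b}|lborel. J x * weight x - \<alpha> * log_deriv x\<bar> \<le> \<alpha> * (sqrt (2 * M) * Jmax) * (2 * variation)"
proof -
  have "primitive_on UNIV (\<lambda>y. indefinite_integral 0 (\<lambda>x. J x * weight x) y - \<alpha> * ln (B y))
      (\<lambda>x. J x * weight x - \<alpha> * log_deriv x)"
    by (intro primitive_on_diff primitive_on_cmult primitive_on_weighted_volume primitive_on_ln_B)
  then have int: "set_integrable lborel {a..b} (\<lambda>x. J x * weight x - \<alpha> * log_deriv x)"
    using primitive_onD(1)[OF _ UNIV_I UNIV_I assms] by blast
  have bound: "\<bar>J x * weight x - \<alpha> * log_deriv x\<bar> \<le> \<alpha> * (sqrt (2 * M) * Jmax) * (rate x * \<bar>correction x\<bar>)" for x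
  proof -
    have "J x * weight x - \<alpha> * log_deriv x = - (\<alpha> * (log_deriv x * J x * correction x))"
      using J_pos[of x] by (simp add: weight_def regularised_def field_simps)
    then have "\<bar>J x * weight x - \<alpha> * log_deriv x\<bar> = \<alpha> * (\<bar>log_deriv x\<bar> * J x * \<bar>correction x\<bar>)"
      using \<alpha>_pos J_pos[of x] by (simp add: abs_mult)
    also have "\<dots> \<le> \<alpha> * ((sqrt (2 * M) * rate x) * Jmax * \<bar>correction x\<bar>)"
      using abs_log_deriv_le[of x] J_bounds(2)[of x] J_pos[of x] \<alpha>_pos rate_nonneg[of x] M_pos
      by (intro mult_left_mono mult_right_mono mult_mono) (auto simp: rate_def)
    finally show ?thesis by (simp add: mult_ac)
  qed
  have "\<bar>LINT x:{a..b}|lborel. J x * weight x - \<alpha> * log_deriv x\<bar>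
      \<le> (LINT x:{a..b}|lborel. \<bar>J x * weight x - \<alpha> * log_deriv x\<bar>)"
    by (rule set_integral_abs_bound[OF int])
  also have "\<dots> \<le> (LINT x:{a..b}|lborel. \<alpha> * (sqrt (2 * M) * Jmax) * (rate x * \<bar>correction x\<bar>))"
    by (intro set_integral_mono set_integrable_abs[OF int] bound set_integrable_continuous_compact
        continuous_intros continuous_on_rate continuous_on_correction compact_Icc)
  also have "\<dots> \<le> \<alpha> * (sqrt (2 * M) * Jmax) * (2 * variation)"
    using integral_rate_correction_le[OF assms] \<alpha>_pos M_pos J_pos[of 0] J_bounds(2)[of 0]
    by (simp add: mult_left_mono)
  finally show ?thesis .
qed

lemma abs_weighted_volume_le:
  "\<bar>indefinite_integral 0 (\<lambda>x. J x * weight x) y - \<alpha> * ln (B y)\<bar>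
    \<le> \<alpha> * (sqrt (2 * M) * Jmax) * (2 * variation) + \<bar>\<alpha> * ln (B 0)\<bar>"
proof -
  have "primitive_on UNIV (\<lambda>y. indefinite_integral 0 (\<lambda>x. J x * weight x) y - \<alpha> * ln (B y))
      (\<lambda>x. J x * weight x - \<alpha> * log_deriv x)"
    by (intro primitive_on_diff primitive_on_cmult primitive_on_weighted_volume primitive_on_ln_B)
  from primitive_on_eq_indefinite_integral[OF this UNIV_I UNIV_I, of y 0]
  have "indefinite_integral 0 (\<lambda>x. J x * weight x) y - \<alpha> * ln (B y)
      = indefinite_integral 0 (\<lambda>x. J x * weight x - \<alpha> * log_deriv x) y - \<alpha> * ln (B 0)" by simp
  moreover have "\<bar>indefinite_integral 0 (\<lambda>x. J x * weight x - \<alpha> * log_deriv x) y\<bar>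
      \<le> \<alpha> * (sqrt (2 * M) * Jmax) * (2 * variation)"
    using abs_weighted_volume_defect_le[of 0 y] abs_weighted_volume_defect_le[of y 0]
    by (cases "0 \<le> y") (simp_all add: indefinite_integral_ge indefinite_integral_le)
  ultimately show ?thesis by linarith
qed

lemma entropy_weight_inverse_density: "\<exists>C>0. entropy_weight \<alpha> C (\<lambda>y. 1 / B y) J weight weight'"
proof -
  define e_bound where "e_bound = \<alpha> * ((1 / Jmin + variation) * sqrt (2 * M))"
  define e'_bound where "e'_bound = \<alpha> * ((1 / Jmin + variation) * (3 * M) + variation * sqrt (2 * M))"
  define volume_bound where "volume_bound = \<alpha> * (sqrt (2 * M) * Jmax) * (2 * variation) + \<bar>\<alpha> * ln (B 0)\<bar>"
  define C where "C = max 1 (max e_bound (max e'_bound volume_bound))"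
  have C: "e_bound \<le> C" "e'_bound \<le> C" "volume_bound \<le> C" "0 < C" by (auto simp: C_def)
  have "AE y in lborel. \<bar>weight y\<bar> \<le> C * sqrt (1 / B y) \<and> \<bar>weight' y\<bar> \<le> C * (1 / B y) \<and>
      \<bar>indefinite_integral 0 (\<lambda>x. J x * weight x) y + \<alpha> * ln (1 / B y)\<bar> \<le> C"
    using abs_weight'_le
  proof eventually_elim
    case (elim y)
    have "\<bar>weight y\<bar> \<le> C * rate y"
      using abs_weight_le[of y] mult_right_mono[OF C(1) rate_nonneg[of y]] unfolding e_bound_def by linarith
    moreover have "\<bar>weight' y\<bar> \<le> C * (1 / B y)"
      using elim mult_right_mono[OF C(2), of "1 / B y"] B_pos[of y] unfolding e'_bound_def by auto
    moreover have "\<bar>indefinite_integral 0 (\<lambda>x. J x * weight x) y + \<alpha> * ln (1 / B y)\<bar> \<le> C"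
      using abs_weighted_volume_le[of y] C(3) B_pos[of y] unfolding volume_bound_def by (simp add: ln_div)
    ultimately show ?case by (simp add: rate_def real_sqrt_divide)
  qed
  then show ?thesis
    unfolding entropy_weight_def using primitive_on_weight weight'_measurable C(4) by blast
qed

end

lemma abs_le_square_divide_sqrt:
  fixes a r :: real
  assumes "0 < r"
  shows "\<bar>a\<bar> \<le> (a / sqrt r)\<^sup>2 + r"
proof -
  have "0 \<le> (\<bar>a / sqrt r\<bar> - sqrt r)\<^sup>2" by simp
  also have "\<dots> = (a / sqrt r)\<^sup>2 + r - 2 * \<bar>a\<bar>"
    using assms by (simp add: power2_diff abs_div power_divide)
  finally show ?thesis using abs_ge_zero[of a] by linarith
qed

lemma inverse_jacobian_bounded_variation:
  assumes \<rho>: "\<And>y. 0 < \<rho> y" "integrable lborel \<rho>"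
    and J: "0 < Jmin" "\<And>y. Jmin \<le> J y" "primitive_on UNIV J dJ" and dJ: "L2 (\<lambda>y. dJ y / sqrt (\<rho> y))"
  shows "\<exists>j. primitive_on UNIV (\<lambda>y. 1 / J y) j \<and> integrable lborel j"
proof -
  define j where "j x = - (inverse (J x) * inverse (J x)) * dJ x" for x
  have Jpos: "0 < J y" for y using J(1,2) by (meson less_le_trans)
  have "primitive_on UNIV (\<lambda>y. inverse (J y)) j"
    unfolding j_def
    by (rule primitive_on_chain[OF is_interval_univ J(3), where S = "{0<..}"])
      (auto intro!: derivative_eq_intros continuous_intros Jpos)
  then have P: "primitive_on UNIV (\<lambda>y. 1 / J y) j" by (simp add: inverse_eq_divide)
  have [measurable]: "\<rho> \<in> borel_measurable borel" "J \<in> borel_measurable borel"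
    using \<rho>(2) primitive_on_continuous_on[OF J(3) open_UNIV] by (auto intro: borel_measurable_continuous_onI)
  have [measurable]: "dJ \<in> borel_measurable borel"
  proof -
    have [measurable]: "(\<lambda>y. dJ y / sqrt (\<rho> y)) \<in> borel_measurable borel" using dJ by (simp add: L2_def)
    have "dJ = (\<lambda>y. (dJ y / sqrt (\<rho> y)) * sqrt (\<rho> y))"
      using \<rho>(1) by (simp add: fun_eq_iff less_imp_neq[symmetric])
    moreover have "(\<lambda>y. (dJ y / sqrt (\<rho> y)) * sqrt (\<rho> y)) \<in> borel_measurable borel" by measurable
    ultimately show ?thesis by (simp only:)
  qed
  have bound: "\<bar>j y\<bar> \<le> 1 / Jmin\<^sup>2 * ((dJ y / sqrt (\<rho> y))\<^sup>2 + \<rho> y)" for y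
  proof -
    have "1 / (J y)\<^sup>2 \<le> 1 / Jmin\<^sup>2"
      using J(1,2) Jpos[of y] by (intro divide_left_mono power_mono) auto
    with abs_le_square_divide_sqrt[OF \<rho>(1)] have "1 / (J y)\<^sup>2 * \<bar>dJ y\<bar> \<le> 1 / Jmin\<^sup>2 * ((dJ y / sqrt (\<rho> y))\<^sup>2 + \<rho> y)"
      by (intro mult_mono) auto
    moreover have "\<bar>j y\<bar> = 1 / (J y)\<^sup>2 * \<bar>dJ y\<bar>"
      using Jpos[of y] by (simp add: j_def abs_mult power2_eq_square divide_inverse)
    ultimately show ?thesis by simp
  qed
  have "integrable lborel j"
  proof (rule Bochner_Integration.integrable_bound)
    show "integrable lborel (\<lambda>y. 1 / Jmin\<^sup>2 * ((dJ y / sqrt (\<rho> y))\<^sup>2 + \<rho> y))"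
      using dJ \<rho>(2) unfolding L2_def by auto
    show "j \<in> borel_measurable lborel" unfolding j_def by measurable
    show "AE y in lborel. norm (j y) \<le> norm (1 / Jmin\<^sup>2 * ((dJ y / sqrt (\<rho> y))\<^sup>2 + \<rho> y))"
      unfolding real_norm_def by (intro AE_I2 order_trans[OF bound abs_ge_self])
  qed
  with P show ?thesis by blast
qed

lemma entropy_weight_cong_AE:
  assumes "entropy_weight \<alpha> C \<rho> J e e'" and [measurable]: "J \<in> borel_measurable borel" "J' \<in> borel_measurable borel"
    and eq: "AE y in lborel. \<rho>' y = \<rho> y" "AE y in lborel. J y = J' y"
  shows "entropy_weight \<alpha> C \<rho>' J' e e'"
proof -
  have "continuous_on UNIV e"
    using assms(1) primitive_on_continuous_on[OF _ open_UNIV] by (auto simp: entropy_weight_def)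
  then have [measurable]: "e \<in> borel_measurable borel" by (rule borel_measurable_continuous_onI)
  have "indefinite_integral 0 (\<lambda>x. J x * e x) y = indefinite_integral 0 (\<lambda>x. J' x * e x) y" for y
    by (rule indefinite_integral_cong_AE) (use eq(2) in auto)
  with assms(1) eq(1) show ?thesis
    unfolding entropy_weight_def by (auto elim: eventually_elim2)
qed

lemma entropy_weight_exists:
  fixes \<rho>0 J0 dJ0 d dd :: "real \<Rightarrow> real"
  assumes \<alpha>: "\<alpha> > 0" and \<rho>: "\<And>y. 0 < \<rho>0 y" "L_infty UNIV \<rho>0" "integrable lborel \<rho>0"
    and w: "weak_deriv1 (\<lambda>y. 1 / \<rho>0 y) d" "weak_deriv1 d dd" "L_infty UNIV dd"
    and J0: "Jlow > 0" "AE y in lborel. Jlow \<le> J0 y" "L_infty UNIV J0" "weak_deriv1 J0 dJ0"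
      "L2 (\<lambda>y. dJ0 y / sqrt (\<rho>0 y))"
  shows "\<exists>e e' C. C > 0 \<and> entropy_weight \<alpha> C \<rho>0 J0 e e'"
proof -
  obtain B D M b where B: "inverse_density B D dd M b" "AE y in lborel. \<rho>0 y = 1 / B y"
    using inverse_density_exists[OF \<rho>(1,2) w] by blast
  obtain Jmax where Jmax: "J0 \<in> borel_measurable borel" "AE y in lborel. \<bar>J0 y\<bar> \<le> Jmax"
    using L_infty_UNIVE[OF J0(3)] by metis
  obtain J where J: "primitive_on UNIV J dJ0" "AE y in lborel. J0 y = J y"
    using AE_primitiveE[OF weak_deriv1_AE_primitive[OF J0(4)]] by blast
  have Jc: "continuous_on UNIV J" by (rule primitive_on_continuous_on[OF J(1) open_UNIV])
  have "AE y in lborel. Jlow \<le> J y" "AE y in lborel. J y \<le> Jmax"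
    using J0(2) J(2) Jmax(2) by (auto elim!: eventually_elim2)
  then have J_bounds: "Jlow \<le> J y" "J y \<le> Jmax" for y
    using Jc by (auto intro: AE_le_imp_le AE_ge_imp_ge)
  obtain j where "primitive_on UNIV (\<lambda>y. 1 / J y) j" "integrable lborel j"
    using inverse_jacobian_bounded_variation[OF \<rho>(1,3) J0(1) J_bounds(1) J(1) J0(5)] by blast
  then interpret regularised_weight B D dd M b \<alpha> Jlow Jmax J j
    using B(1) \<alpha> J0(1) J_bounds Jc
    by (intro regularised_weight.intro regularised_weight_axioms.intro)
  obtain C where C: "C > 0" "entropy_weight \<alpha> C (\<lambda>y. 1 / B y) J weight weight'"
    using entropy_weight_inverse_density by blast
  have "AE y in lborel. J y = J0 y" using J(2) by eventually_elim simp
  from entropy_weight_cong_AE[OF C(2) borel_measurable_continuous_onI[OF Jc] Jmax(1) B(2) this] C(1)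
  show ?thesis by blast
qed

section \<open>Positive parts and cutoffs\<close>

lemma DERIV_pos_part_power:
  fixes s :: real
  shows "((\<lambda>s. max 0 s ^ Suc (Suc k)) has_real_derivative real (Suc (Suc k)) * max 0 s ^ Suc k) (at s)"
proof -
  consider (negative) "s < 0" | (zero) "s = 0" | (positive) "s > 0" by linarith
  then show ?thesis
  proof cases
    case negative
    have "((\<lambda>s. 0) has_real_derivative 0) (at s)" by simp
    then have "((\<lambda>s. max 0 s ^ Suc (Suc k)) has_real_derivative 0) (at s)"
      by (rule has_field_derivative_transform_within_open[of _ _ _ "{..<0}"]) (use negative in auto)
    then show ?thesis using negative by simp
  next
    case zero
    have "((\<lambda>h. max 0 h ^ Suc k) \<longlongrightarrow> max 0 0 ^ Suc k) (at (0::real))"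
      by (intro tendsto_intros)
    then have "((\<lambda>h. max 0 h ^ Suc k) \<longlongrightarrow> 0) (at (0::real))" by simp
    then have "((\<lambda>h. (max 0 (0 + h) ^ Suc (Suc k) - max 0 0 ^ Suc (Suc k)) / h) \<longlongrightarrow> 0) (at (0::real))"
      by (rule Lim_transform_eventually) (auto simp: eventually_at_filter max_def)
    then show ?thesis using zero by (simp add: DERIV_def)
  next
    case positive
    have "((\<lambda>s. s ^ Suc (Suc k)) has_real_derivative real (Suc (Suc k)) * s ^ Suc k) (at s)"
      using DERIV_pow[of "Suc (Suc k)" s] by simp
    then have "((\<lambda>s. max 0 s ^ Suc (Suc k)) has_real_derivative real (Suc (Suc k)) * s ^ Suc k) (at s)"
      by (rule has_field_derivative_transform_within_open[of _ _ _ "{0<..}"]) (use positive in auto)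
    then show ?thesis using positive by simp
  qed
qed

lemma primitive_on_pos_part_power:
  assumes "is_interval I" "primitive_on I u g"
  shows "primitive_on I (\<lambda>x. max 0 (u x) ^ Suc (Suc k)) (\<lambda>x. (real (Suc (Suc k)) * max 0 (u x) ^ Suc k) * g x)"
proof (rule primitive_on_chain[OF assms open_UNIV UNIV_I DERIV_pos_part_power])
  show "continuous_on UNIV (\<lambda>r::real. real (Suc (Suc k)) * max 0 r ^ Suc k)"
    by (intro continuous_on_mult continuous_on_power continuous_on_max continuous_on_const continuous_on_id)
qed

lemma primitive_on_pos_part_square:
  assumes "is_interval I" "primitive_on I u g"
  shows "primitive_on I (\<lambda>x. (max 0 (u x))\<^sup>2) (\<lambda>x. 2 * max 0 (u x) * g x)"
  using primitive_on_pos_part_power[OF assms, of 0] by (simp add: numeral_2_eq_2)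

lemma primitive_on_pos_part_cube:
  assumes "is_interval I" "primitive_on I u g"
  shows "primitive_on I (\<lambda>x. max 0 (u x) ^ 3) (\<lambda>x. 3 * (max 0 (u x))\<^sup>2 * g x)"
  using primitive_on_pos_part_power[OF assms, of 1] by (simp add: numeral_3_eq_3 numeral_2_eq_2)

definition cutoff :: "real \<Rightarrow> real \<Rightarrow> real" where
  "cutoff N y = (max 0 (1 - y\<^sup>2 / N\<^sup>2))\<^sup>2"

definition cutoff' :: "real \<Rightarrow> real \<Rightarrow> real" where
  "cutoff' N y = 2 * max 0 (1 - y\<^sup>2 / N\<^sup>2) * (- (2 * y / N\<^sup>2))"

lemma cutoff_measurable [measurable]: "cutoff N \<in> borel_measurable borel"
  unfolding cutoff_def[abs_def] by measurable

lemma cutoff_nonneg: "0 \<le> cutoff N y"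
  by (simp add: cutoff_def)

lemma cutoff_le_1: "cutoff N y \<le> 1"
  unfolding cutoff_def by (intro power_le_one) auto

lemma cutoff_eq_0: "0 < N \<Longrightarrow> y \<notin> {-N<..<N} \<Longrightarrow> cutoff N y = 0"
  using abs_le_square_iff[of N y] by (auto simp: cutoff_def max_def field_simps abs_le_iff)

lemma cutoff_tendsto_1: "(\<lambda>n. cutoff (real (Suc n)) y) \<longlonglongrightarrow> 1"
proof -
  have "(\<lambda>n. (max 0 (1 - y\<^sup>2 * (inverse (real (Suc n)))\<^sup>2))\<^sup>2) \<longlonglongrightarrow> (max 0 (1 - y\<^sup>2 * 0\<^sup>2))\<^sup>2"
    by (intro tendsto_intros LIMSEQ_inverse_real_of_nat)
  then show ?thesis by (simp add: cutoff_def divide_inverse power_inverse)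
qed

lemma primitive_on_cutoff: "primitive_on UNIV (cutoff N) (cutoff' N)"
proof -
  have "primitive_on UNIV (\<lambda>y. 1 - y\<^sup>2 * inverse (N\<^sup>2)) (\<lambda>y. - (2 * y * inverse (N\<^sup>2)))"
    by (rule primitive_on_DERIV) (auto intro!: derivative_eq_intros continuous_intros)
  from primitive_on_pos_part_square[OF is_interval_univ this] show ?thesis
    by (simp add: cutoff_def[abs_def] cutoff'_def[abs_def] divide_inverse)
qed

text \<open>Completing the square: the gradient term absorbs all but the contribution of the cutoff.\<close>

lemma cutoff_flux_pointwise:
  fixes m p q j :: real
  assumes N: "0 < N" and y: "\<bar>y\<bar> \<le> N" and p: "0 \<le> p" "p \<le> W" and j: "0 < jmin" "jmin \<le> j"
  shows "- ((m\<^sup>2 * (2 * p * q) + (2 * m * (- (2 * y / N\<^sup>2))) * p\<^sup>2) * (q / j)) \<le> 2 * W ^ 3 / (N\<^sup>2 * jmin)"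
proof -
  define a where "a = y / N\<^sup>2"
  have "a\<^sup>2 = y\<^sup>2 / N\<^sup>2 * (1 / N\<^sup>2)" by (simp add: a_def power_divide power2_eq_square)
  also have "\<dots> \<le> 1 * (1 / N\<^sup>2)"
    using abs_le_square_iff[of y N] y N by (intro mult_right_mono) auto
  finally have a: "a\<^sup>2 \<le> 1 / N\<^sup>2" by simp
  have "- ((m\<^sup>2 * (2 * p * q) + (2 * m * (- (2 * a))) * p\<^sup>2) * q) = 2 * p * ((a * p)\<^sup>2 - (m * q - a * p)\<^sup>2)"
    by (simp add: power2_eq_square algebra_simps)
  also have "\<dots> \<le> 2 * p * (a * p)\<^sup>2" using p(1) by (intro mult_left_mono) auto
  also have "\<dots> = 2 * (p ^ 3 * a\<^sup>2)" by (simp add: power2_eq_square power3_eq_cube)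
  also have "\<dots> \<le> 2 * (W ^ 3 * (1 / N\<^sup>2))"
    using p a by (intro mult_left_mono mult_mono power_mono) auto
  finally have "- ((m\<^sup>2 * (2 * p * q) + (2 * m * (- (2 * a))) * p\<^sup>2) * q) / j \<le> 2 * (W ^ 3 * (1 / N\<^sup>2)) / jmin"
    using p j by (intro frac_le) auto
  then show ?thesis by (simp add: a_def)
qed

lemma cutoff_flux_estimate:
  assumes N: "0 < N" and P: "primitive_on UNIV P P'" and F: "primitive_on UNIV F g"
    and flux: "AE y in lborel. F y = P' y / j y" and j: "0 < jmin" "AE y in lborel. jmin \<le> j y"
    and W: "0 \<le> W" "AE y in lborel. P y \<le> W"
  shows "integrable lborel (\<lambda>y. cutoff N y * (max 0 (P y))\<^sup>2 * g y)"
    and "(LINT y|lborel. cutoff N y * (max 0 (P y))\<^sup>2 * g y) \<le> 4 * W ^ 3 / (N * jmin)"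
proof -
  have I: "-N \<le> N" using N by simp
  define U where "U y = cutoff N y * (max 0 (P y))\<^sup>2" for y
  define U' where "U' y = cutoff N y * (2 * max 0 (P y) * P' y) + cutoff' N y * (max 0 (P y))\<^sup>2" for y
  have U: "primitive_on UNIV U U'"
    unfolding U_def[abs_def] U'_def[abs_def]
    by (intro primitive_on_mult primitive_on_cutoff primitive_on_pos_part_square P is_interval_univ)
  have U0: "U y = 0" if "y \<notin> {-N<..<N}" for y using cutoff_eq_0[OF N that] by (simp add: U_def)
  note UF = primitive_onD[OF primitive_on_mult[OF is_interval_univ U F] UNIV_I UNIV_I I]
  have Ug: "set_integrable lborel {-N..N} (\<lambda>y. U y * g y)"
    using primitive_onD(1)[OF F UNIV_I UNIV_I I] primitive_on_continuous_on_Icc[OF U]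
    by (intro set_integrable_mult_continuous) auto
  have U'F: "set_integrable lborel {-N..N} (\<lambda>y. U' y * F y)"
    using set_integral_diff(1)[OF UF(1) Ug] by simp
  have neg: "set_integrable lborel {-N..N} (\<lambda>y. - (U' y * F y))"
    using set_integrable_mult_right[of "-1" lborel "{-N..N}" "\<lambda>y. U' y * F y"] U'F by simp
  have indicator: "indicator {-N..N} y *\<^sub>R (U y * g y) = cutoff N y * (max 0 (P y))\<^sup>2 * g y" for y
    using U0[of y] by (cases "y \<in> {-N..N}") (auto simp: U_def)
  show "integrable lborel (\<lambda>y. cutoff N y * (max 0 (P y))\<^sup>2 * g y)"
    using Ug unfolding set_integrable_def indicator .
  have bound: "AE y in lborel. y \<in> {-N..N} \<longrightarrow> - (U' y * F y) \<le> 2 * W ^ 3 / (N\<^sup>2 * jmin)"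
    using flux j(2) W(2)
  proof eventually_elim
    case (elim y)
    show ?case
      unfolding U'_def cutoff_def cutoff'_def elim(1)
      by (intro impI cutoff_flux_pointwise) (use N j(1) W(1) elim in auto)
  qed
  have "(LINT y:{-N..N}|lborel. - (U' y * F y)) \<le> (LINT y:{-N..N}|lborel. 2 * W ^ 3 / (N\<^sup>2 * jmin))"
    by (rule set_integral_mono_AE[OF neg set_integrable_continuous_compact bound]) auto
  also have "\<dots> = 4 * W ^ 3 / (N * jmin)"
    using N by (simp add: set_lebesgue_integral_def power2_eq_square)
  also have "(LINT y:{-N..N}|lborel. - (U' y * F y)) = (LINT y:{-N..N}|lborel. U y * g y)"
    using UF(2) U0[of N] U0[of "-N"] Ug U'F set_integral_uminus[OF U'F] by simp
  finally show "(LINT y|lborel. cutoff N y * (max 0 (P y))\<^sup>2 * g y) \<le> 4 * W ^ 3 / (N * jmin)"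
    unfolding set_lebesgue_integral_def indicator .
qed

section \<open>The barrier\<close>

lemma slab_integrable_mult_continuous:
  assumes g: "slab_integrable g" and e: "continuous_on UNIV e"
  shows "slab_integrable (\<lambda>z. e (fst z) * g z)"
  unfolding slab_integrable_def
proof
  fix r :: real
  have [measurable]: "e \<in> borel_measurable borel" using e by (rule borel_measurable_continuous_onI)
  show "set_integrable lborel ({-r..r} \<times> UNIV) (\<lambda>z. e (fst z) * g z)"
  proof (rule set_integrable_mult_bounded)
    show "set_integrable lborel ({-r..r} \<times> UNIV) g" using g by (simp add: slab_integrable_def)
    show "set_borel_measurable lborel ({-r..r} \<times> UNIV) (\<lambda>z. e (fst z))"
      unfolding set_borel_measurable_def indicator_Times_fst_snd by measurable
    have "bounded (e ` {-r..r})"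
      by (intro compact_imp_bounded compact_continuous_image continuous_on_subset[OF e]) auto
    then show "bounded ((\<lambda>z. e (fst z)) ` ({-r..r} \<times> UNIV))"
      by (rule bounded_subset) auto
  qed
qed

lemma indefinite_integral_diff:
  assumes "\<And>a b. set_integrable lborel {a..b} f" "\<And>a b. set_integrable lborel {a..b} g"
  shows "indefinite_integral c (\<lambda>x. f x - g x) y = indefinite_integral c f y - indefinite_integral c g y"
proof -
  have "primitive_on UNIV (\<lambda>y. indefinite_integral c f y - indefinite_integral c g y) (\<lambda>x. f x - g x)"
    by (intro primitive_on_diff primitive_on_indefinite_integral assms UNIV_I)
  from primitive_on_eq_indefinite_integral[OF this UNIV_I UNIV_I, of y c] show ?thesis by simp
qed

locale thermal_flow =
  fixes T \<kappa> cv \<beta> Jmin Jmax Jt_bound :: real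
    and \<rho>0 J0 \<theta>0 :: "real \<Rightarrow> real" and J Jt \<theta> \<theta>t \<theta>y Qy :: "real \<times> real \<Rightarrow> real"
  assumes T_pos: "T > 0" and \<kappa>_pos: "\<kappa> > 0" and cv_pos: "cv > 0" and \<beta>_nonneg: "\<beta> \<ge> 0"
    and Jmin_pos: "Jmin > 0" and Jt_bound_nonneg: "Jt_bound \<ge> 0"
    and data_measurable [measurable]: "\<rho>0 \<in> borel_measurable borel" "J0 \<in> borel_measurable borel"
      "\<theta>0 \<in> borel_measurable borel"
    and flow_measurable [measurable]: "J \<in> borel_measurable borel" "Jt \<in> borel_measurable borel"
      "\<theta> \<in> borel_measurable borel" "\<theta>t \<in> borel_measurable borel"
      "\<theta>y \<in> borel_measurable borel" "Qy \<in> borel_measurable borel"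
    and \<rho>0_pos: "\<And>y. 0 < \<rho>0 y" and \<rho>0_integrable: "integrable lborel \<rho>0"
    and J_bounds: "AE z in lborel. z \<in> strip T \<longrightarrow> Jmin \<le> J z \<and> J z \<le> Jmax"
    and J0_loc: "locally_integrable UNIV J0"
    and J_eq: "AE z in lborel. z \<in> strip T \<longrightarrow> J z = time_primitive J0 Jt z"
    and Jt_slab: "slab_integrable Jt"
    and Jt_L2: "AE t in lborel. (\<integral>\<^sup>+ y. ennreal ((Jt (y, t))\<^sup>2) \<partial>lborel) \<le> ennreal Jt_bound"
    and \<theta>_nonneg: "AE z in lborel. z \<in> strip T \<longrightarrow> 0 \<le> \<theta> z"
    and \<theta>_eq: "AE z in lborel. z \<in> strip T \<longrightarrow> \<theta> z = time_primitive \<theta>0 \<theta>t z"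
    and \<theta>t_slab: "slab_integrable \<theta>t"
    and \<theta>_slice: "AE t in lborel. t \<in> {0<..<T} \<longrightarrow> AE_primitive (\<lambda>y. \<theta> (y, t)) (\<lambda>y. \<theta>y (y, t))"
    and flux_slice: "AE t in lborel. t \<in> {0<..<T} \<longrightarrow>
      AE_primitive (\<lambda>y. \<theta>y (y, t) / J (y, t)) (\<lambda>y. Qy (y, t))"
    and heat_inequality: "AE z in lborel. z \<in> strip T \<longrightarrow>
      \<kappa> * Qy z - \<beta> * (\<rho>0 (fst z))\<^sup>2 * (\<theta> z)\<^sup>2 / J z \<le> cv * \<rho>0 (fst z) * \<theta>t z"

locale weighted_thermal_flow = thermal_flow +
  fixes \<alpha> C c0 \<rho>max :: real and e e' :: "real \<Rightarrow> real"
  assumes \<alpha>_pos: "\<alpha> > 0" and C_pos: "C > 0" and c0_pos: "c0 > 0"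
    and \<rho>max_pos: "\<rho>max > 0" and \<rho>0_le: "AE y in lborel. \<rho>0 y \<le> \<rho>max"
    and weight: "entropy_weight \<alpha> C \<rho>0 J0 e e'"
    and \<theta>0_ge: "AE y in lborel. c0 * \<rho>0 y powr \<alpha> \<le> \<theta>0 y"
begin

lemma e_primitive: "primitive_on UNIV e e'"
  and e'_measurable [measurable]: "e' \<in> borel_measurable borel"
  and e_bounds: "AE y in lborel. \<bar>e y\<bar> \<le> C * sqrt (\<rho>0 y) \<and> \<bar>e' y\<bar> \<le> C * \<rho>0 y \<and>
    \<bar>indefinite_integral 0 (\<lambda>x. J0 x * e x) y + \<alpha> * ln (\<rho>0 y)\<bar> \<le> C"
  using weight by (auto simp: entropy_weight_def)

lemma e_continuous: "continuous_on UNIV e"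
  by (rule primitive_on_continuous_on[OF e_primitive open_UNIV])

lemma e_measurable [measurable]: "e \<in> borel_measurable borel"
  using e_continuous by (rule borel_measurable_continuous_onI)

definition exponent0 :: "real \<Rightarrow> real" where
  "exponent0 = indefinite_integral 0 (\<lambda>x. J0 x * e x)"

definition exponent_t :: "real \<times> real \<Rightarrow> real" where
  "exponent_t z = indefinite_integral 0 (\<lambda>x. Jt (x, snd z) * e x) (fst z)"

definition exponent :: "real \<times> real \<Rightarrow> real" where
  "exponent = time_primitive exponent0 exponent_t"

definition exponent_t_max :: real where
  "exponent_t_max = Jt_bound + C\<^sup>2 * (LINT y|lborel. \<rho>0 y)"

definition barrier_scale :: real where "barrier_scale = c0 * exp (- C)"

definition barrier_max :: real where "barrier_max = c0 * \<rho>max powr \<alpha>"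

definition decay_rate :: real where
  "decay_rate = exponent_t_max + (\<kappa> * C + \<beta> * \<rho>max * barrier_max / Jmin) / cv"

definition barrier :: "real \<times> real \<Rightarrow> real" where
  "barrier z = barrier_scale * exp (- decay_rate * snd z - exponent z)"

definition barrier_t :: "real \<times> real \<Rightarrow> real" where
  "barrier_t z = - (barrier z * (decay_rate + exponent_t z))"

lemma exponent_measurable [measurable]:
  "exponent_t \<in> borel_measurable borel" "exponent \<in> borel_measurable borel"
  unfolding exponent_def exponent_t_def[abs_def] exponent0_def by measurable

lemma barrier_measurable [measurable]:
  "barrier \<in> borel_measurable borel" "barrier_t \<in> borel_measurable borel"
  unfolding barrier_def[abs_def] barrier_t_def[abs_def] by measurable

lemma exponent_t_max_nonneg: "0 \<le> exponent_t_max"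
  unfolding exponent_t_max_def using Jt_bound_nonneg \<rho>0_pos
  by (auto intro!: add_nonneg_nonneg mult_nonneg_nonneg simp: less_imp_le)

lemma barrier_scale_pos: "0 < barrier_scale"
  using c0_pos by (simp add: barrier_scale_def)

lemma barrier_max_pos: "0 < barrier_max"
  using c0_pos \<rho>max_pos by (simp add: barrier_max_def)

lemma decay_rate_ge: "exponent_t_max \<le> decay_rate"
  unfolding decay_rate_def
  using \<kappa>_pos C_pos \<beta>_nonneg \<rho>max_pos barrier_max_pos Jmin_pos cv_pos by auto

lemma decay_rate_eq: "cv * (decay_rate - exponent_t_max) = \<kappa> * C + \<beta> * \<rho>max * barrier_max / Jmin"
  using cv_pos by (simp add: decay_rate_def)

lemma barrier_pos: "0 < barrier z"
  unfolding barrier_def using barrier_scale_pos by simp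

lemma abs_exponent_t_le: "AE s in lborel. \<forall>y. \<bar>exponent_t (y, s)\<bar> \<le> exponent_t_max"
  using Jt_L2
proof eventually_elim
  case (elim s)
  have sq: "integrable lborel (\<lambda>x. (Jt (x, s))\<^sup>2)"
    by (rule integrableI_bounded) (use elim in \<open>auto simp: le_less_trans\<close>)
  have sq_le: "(LINT x|lborel. (Jt (x, s))\<^sup>2) \<le> Jt_bound"
    using elim nn_integral_eq_integral[OF sq] Jt_bound_nonneg by simp
  have dom: "integrable lborel (\<lambda>x. (Jt (x, s))\<^sup>2 + C\<^sup>2 * \<rho>0 x)" using sq \<rho>0_integrable by simp
  have bound: "AE x in lborel. \<bar>Jt (x, s) * e x\<bar> \<le> (Jt (x, s))\<^sup>2 + C\<^sup>2 * \<rho>0 x"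
    using e_bounds
  proof eventually_elim
    case (elim x)
    have "(e x)\<^sup>2 \<le> (C * sqrt (\<rho>0 x))\<^sup>2" using elim by (metis abs_ge_zero power2_abs power_mono)
    also have "\<dots> = C\<^sup>2 * \<rho>0 x" using \<rho>0_pos[of x] by (simp add: power_mult_distrib less_imp_le)
    finally have "(e x)\<^sup>2 \<le> C\<^sup>2 * \<rho>0 x" .
    moreover have "0 \<le> (\<bar>Jt (x, s)\<bar> - \<bar>e x\<bar>)\<^sup>2" by simp
    then have "2 * \<bar>Jt (x, s) * e x\<bar> \<le> (Jt (x, s))\<^sup>2 + (e x)\<^sup>2" by (simp add: power2_diff abs_mult)
    ultimately show ?case using abs_ge_zero[of "Jt (x, s) * e x"] by linarith
  qed
  have int: "integrable lborel (\<lambda>x. Jt (x, s) * e x)"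
    by (rule Bochner_Integration.integrable_bound[OF dom])
       (use bound in \<open>auto elim!: eventually_mono\<close>)
  have "\<bar>exponent_t (y, s)\<bar> \<le> (LINT x:UNIV|lborel. \<bar>Jt (x, s) * e x\<bar>)" for y
    unfolding exponent_t_def fst_conv snd_conv
    by (rule abs_indefinite_integral_le[OF set_integrable_if_integrable[OF int]]) auto
  moreover have "(LINT x:UNIV|lborel. \<bar>Jt (x, s) * e x\<bar>) \<le> (LINT x|lborel. (Jt (x, s))\<^sup>2 + C\<^sup>2 * \<rho>0 x)"
    using integral_mono_AE[OF integrable_abs[OF int] dom bound] by (simp add: set_lebesgue_integral_def)
  moreover have "\<dots> \<le> exponent_t_max" using sq \<rho>0_integrable sq_le by (simp add: exponent_t_max_def)
  ultimately show ?case by (meson order_trans)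
qed

lemma set_integrable_exponent_t: "set_integrable lborel {a..b} (\<lambda>s. exponent_t (y, s))"
  by (rule set_integrable_AE_bounded[where c = exponent_t_max])
    (use abs_exponent_t_le in \<open>auto elim!: eventually_mono simp: emeasure_lborel_Icc_eq\<close>)

lemma primitive_on_exponent_time: "primitive_on UNIV (\<lambda>t. exponent (y, t)) (\<lambda>s. exponent_t (y, s))"
  unfolding exponent_def by (rule primitive_on_time_primitive[OF set_integrable_exponent_t])

lemma abs_exponent_diff_le:
  assumes "0 \<le> t"
  shows "\<bar>exponent (y, t) - exponent0 y\<bar> \<le> exponent_t_max * t"
proof -
  have "exponent_t_max-lipschitz_on UNIV (\<lambda>t. exponent (y, t))"
    by (rule primitive_on_lipschitz_on[OF primitive_on_exponent_time])
      (use abs_exponent_t_le exponent_t_max_nonneg in \<open>auto elim!: eventually_mono\<close>)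
  from lipschitz_onD[OF this, of t 0] assms show ?thesis
    by (simp add: dist_real_def exponent_def)
qed

lemma set_integrable_mult_e:
  assumes "set_integrable lborel {a..b} f"
  shows "set_integrable lborel {a..b} (\<lambda>x. f x * e x)"
  using set_integrable_mult_continuous[OF continuous_on_subset[OF e_continuous] compact_Icc assms]
  by (simp add: mult.commute)

lemma set_integrable_J0_e: "set_integrable lborel {a..b} (\<lambda>x. J0 x * e x)"
  by (intro set_integrable_mult_e locally_integrableD[OF J0_loc]) auto

lemma exponent_eq_space_integral:
  "exponent (y, t) = exponent0 y + indefinite_integral 0 (\<lambda>x. e x * indefinite_integral 0 (\<lambda>s. Jt (x, s)) t) y"
proof -
  define r where "r = \<bar>y\<bar>"
  have int: "set_integrable lborel ({-r..r} \<times> UNIV) (\<lambda>z. e (fst z) * Jt z)"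
    using slab_integrable_mult_continuous[OF Jt_slab e_continuous] by (simp add: slab_integrable_def)
  have "{min 0 y..max 0 y} \<subseteq> {-r..r}" by (auto simp: r_def min_def max_def)
  then have "indefinite_integral 0 (\<lambda>s. indefinite_integral 0 (\<lambda>x. e x * Jt (x, s)) y) t
      = indefinite_integral 0 (\<lambda>x. indefinite_integral 0 (\<lambda>s. e x * Jt (x, s)) t) y"
    using indefinite_integral_commute[OF int, of 0 y 0 t] by simp
  then show ?thesis
    by (simp add: exponent_def time_primitive_def exponent_t_def mult.commute indefinite_integral_def)
qed

lemma primitive_on_exponent_space:
  "AE t in lborel. t \<in> {0<..<T} \<longrightarrow> primitive_on UNIV (\<lambda>y. exponent (y, t)) (\<lambda>y. J (y, t) * e y)"
  using AE_lborel_pairD2[OF J_eq] AE_lborel_pairD2[OF J_bounds]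
proof eventually_elim
  case (elim t)
  show ?case
  proof
    assume t: "t \<in> {0<..<T}"
    have J_repr: "AE x in lborel. J (x, t) = time_primitive J0 Jt (x, t)"
      using elim(1) by eventually_elim (use t in \<open>auto simp: strip_def\<close>)
    have J_abs: "AE x in lborel. \<bar>J (x, t)\<bar> \<le> Jmax"
      using elim(2) by eventually_elim (use t Jmin_pos in \<open>auto simp: strip_def\<close>)
    have "set_integrable lborel {a..b} (\<lambda>x. J (x, t))" for a b
      by (rule set_integrable_AE_bounded[where c = Jmax])
        (use J_abs in \<open>auto elim!: eventually_mono simp: emeasure_lborel_Icc_eq\<close>)
    then have Je: "set_integrable lborel {a..b} (\<lambda>x. J (x, t) * e x)" for a b
      by (rule set_integrable_mult_e)
    have "indefinite_integral 0 (\<lambda>x. e x * indefinite_integral 0 (\<lambda>s. Jt (x, s)) t) y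
        = indefinite_integral 0 (\<lambda>x. J (x, t) * e x - J0 x * e x) y" for y
      by (rule indefinite_integral_cong_AE)
        (measurable, use J_repr in \<open>auto elim!: eventually_mono simp: time_primitive_def algebra_simps\<close>)
    then have "exponent (y, t) = indefinite_integral 0 (\<lambda>x. J (x, t) * e x) y" for y
      by (simp add: exponent_eq_space_integral exponent0_def indefinite_integral_diff[OF Je set_integrable_J0_e])
    then show "primitive_on UNIV (\<lambda>y. exponent (y, t)) (\<lambda>y. J (y, t) * e y)"
      using primitive_on_indefinite_integral[of UNIV "\<lambda>x. J (x, t) * e x" 0] Je by simp
  qed
qed

lemma exp_neg_exponent0:
  "AE y in lborel. exp (- C) * \<rho>0 y powr \<alpha> \<le> exp (- exponent0 y) \<and> exp (- exponent0 y) \<le> exp C * \<rho>0 y powr \<alpha>"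
  using e_bounds
proof eventually_elim
  case (elim y)
  have powr: "\<rho>0 y powr \<alpha> = exp (\<alpha> * ln (\<rho>0 y))" using \<rho>0_pos[of y] by (simp add: powr_def)
  have "- C + \<alpha> * ln (\<rho>0 y) \<le> - exponent0 y" "- exponent0 y \<le> C + \<alpha> * ln (\<rho>0 y)"
    using elim unfolding exponent0_def by (auto simp: abs_le_iff)
  then show ?case unfolding powr exp_add[symmetric] by simp
qed

lemma barrier_initial_le: "AE y in lborel. barrier (y, 0) \<le> \<theta>0 y"
  using exp_neg_exponent0 \<theta>0_ge
proof eventually_elim
  case (elim y)
  have "barrier (y, 0) \<le> barrier_scale * (exp C * \<rho>0 y powr \<alpha>)"
    unfolding barrier_def exponent_def using elim(1) barrier_scale_pos by simp
  also have "\<dots> = c0 * \<rho>0 y powr \<alpha>" by (simp add: barrier_scale_def exp_minus)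
  finally show ?case using elim(2) by simp
qed

lemma barrier_le: "AE y in lborel. \<forall>t\<ge>0. barrier (y, t) \<le> barrier_max"
  using exp_neg_exponent0 \<rho>0_le
proof eventually_elim
  case (elim y)
  show ?case
  proof (intro allI impI)
    fix t :: real assume t: "t \<ge> 0"
    have "exponent_t_max * t \<le> decay_rate * t" using decay_rate_ge t by (rule mult_right_mono)
    then have "- decay_rate * t - exponent (y, t) \<le> - exponent0 y"
      using abs_exponent_diff_le[OF t, of y] by (simp add: abs_le_iff)
    then have "exp (- decay_rate * t - exponent (y, t)) \<le> exp C * \<rho>0 y powr \<alpha>"
      using elim(1) by (meson exp_le_cancel_iff order_trans)
    also have "\<dots> \<le> exp C * \<rho>max powr \<alpha>"
      using elim(2) \<rho>0_pos[of y] \<alpha>_pos by (intro mult_left_mono powr_mono2) auto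
    finally have "barrier (y, t) \<le> barrier_scale * (exp C * \<rho>max powr \<alpha>)"
      unfolding barrier_def using barrier_scale_pos by simp
    also have "\<dots> = barrier_max" by (simp add: barrier_scale_def barrier_max_def exp_minus)
    finally show "barrier (y, t) \<le> barrier_max" .
  qed
qed

lemma barrier_ge: "\<exists>c>0. AE y in lborel. \<forall>t\<in>{0..T}. c * \<rho>0 y powr \<alpha> \<le> barrier (y, t)"
proof -
  define m where "m = (decay_rate + exponent_t_max) * T"
  define c where "c = barrier_scale * (exp (- m) * exp (- C))"
  have "AE y in lborel. \<forall>t\<in>{0..T}. c * \<rho>0 y powr \<alpha> \<le> barrier (y, t)"
    using exp_neg_exponent0
  proof eventually_elim
    case (elim y)
    show ?case
    proof
      fix t assume t: "t \<in> {0..T}"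
      have "(decay_rate + exponent_t_max) * t \<le> m"
        unfolding m_def using decay_rate_ge exponent_t_max_nonneg t by (intro mult_left_mono) auto
      then have "- m + - exponent0 y \<le> - decay_rate * t - exponent (y, t)"
        using abs_exponent_diff_le[of t y] t by (simp add: abs_le_iff distrib_right)
      then have "exp (- m) * exp (- exponent0 y) \<le> exp (- decay_rate * t - exponent (y, t))"
        by (simp flip: exp_add)
      moreover have "exp (- m) * (exp (- C) * \<rho>0 y powr \<alpha>) \<le> exp (- m) * exp (- exponent0 y)"
        using elim by (intro mult_left_mono) auto
      ultimately have "exp (- m) * (exp (- C) * \<rho>0 y powr \<alpha>) \<le> exp (- decay_rate * t - exponent (y, t))"
        by (rule order_trans[rotated])
      then show "c * \<rho>0 y powr \<alpha> \<le> barrier (y, t)"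
        unfolding barrier_def c_def using barrier_scale_pos by (simp add: mult.assoc)
    qed
  qed
  moreover have "c > 0" unfolding c_def using barrier_scale_pos by simp
  ultimately show ?thesis by blast
qed

lemma primitive_on_cmult_exp:
  assumes "primitive_on UNIV u g"
  shows "primitive_on UNIV (\<lambda>x. c * exp (u x)) (\<lambda>x. c * exp (u x) * g x)"
  using primitive_on_cmult[OF primitive_on_chain[OF is_interval_univ assms open_UNIV UNIV_I DERIV_exp
      continuous_on_exp[OF continuous_on_id]], of c]
  by (simp add: mult.assoc)

lemma primitive_on_barrier_time: "primitive_on UNIV (\<lambda>t. barrier (y, t)) (\<lambda>t. barrier_t (y, t))"
proof -
  have "primitive_on UNIV (\<lambda>t. - decay_rate * t) (\<lambda>t. - decay_rate)"
    by (rule primitive_on_DERIV) (auto intro!: derivative_eq_intros)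
  from primitive_on_cmult_exp[OF primitive_on_diff[OF this primitive_on_exponent_time], of barrier_scale y]
  show ?thesis
    by (rule primitive_on_cong[OF is_interval_univ]) (auto simp: barrier_def barrier_t_def algebra_simps)
qed

lemma primitive_on_barrier_space:
  assumes "primitive_on UNIV (\<lambda>y. exponent (y, t)) (\<lambda>y. J (y, t) * e y)"
  shows "primitive_on UNIV (\<lambda>y. barrier (y, t)) (\<lambda>y. - (barrier (y, t) * (J (y, t) * e y)))"
  using primitive_on_cmult_exp[OF primitive_on_diff[OF primitive_on_const assms]]
  by (simp add: barrier_def)

lemma primitive_on_barrier_flux:
  assumes "primitive_on UNIV (\<lambda>y. exponent (y, t)) (\<lambda>y. J (y, t) * e y)"
  shows "primitive_on UNIV (\<lambda>y. - (e y * barrier (y, t))) (\<lambda>y. barrier (y, t) * (J (y, t) * (e y)\<^sup>2 - e' y))"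
proof -
  have "primitive_on UNIV (\<lambda>y. - (e y * barrier (y, t)))
     (\<lambda>y. - (e y * - (barrier (y, t) * (J (y, t) * e y)) + e' y * barrier (y, t)))"
    by (intro primitive_on_minus primitive_on_mult e_primitive primitive_on_barrier_space[OF assms] is_interval_univ)
  then show ?thesis
    by (rule primitive_on_cong[OF is_interval_univ]) (auto simp: algebra_simps power2_eq_square)
qed

lemma barrier_subsolution: "AE z in lborel. z \<in> strip T \<longrightarrow>
   cv * \<rho>0 (fst z) * barrier_t z
     \<le> \<kappa> * (barrier z * (J z * (e (fst z))\<^sup>2 - e' (fst z))) - \<beta> * (\<rho>0 (fst z))\<^sup>2 * (barrier z)\<^sup>2 / J z"
  using J_bounds AE_lborel_fst[OF e_bounds] AE_lborel_fst[OF \<rho>0_le] AE_lborel_fst[OF barrier_le]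
    AE_lborel_snd[OF abs_exponent_t_le]
proof eventually_elim
  case (elim z)
  show ?case
  proof
    assume z: "z \<in> strip T"
    define r w j where "r = \<rho>0 (fst z)" and "w = barrier z" and "j = J z"
    have r: "0 < r" "r \<le> \<rho>max" using \<rho>0_pos elim(3) by (auto simp: r_def)
    have w: "0 < w" "w \<le> barrier_max"
      using elim(4) z barrier_pos by (auto simp: w_def strip_def)
    have j: "Jmin \<le> j" "0 < j" using elim(1) z Jmin_pos by (auto simp: j_def)
    have "- exponent_t_max \<le> exponent_t z"
      using spec[OF elim(5), of "fst z"] by (simp add: abs_le_iff)
    then have "(r * w) * (cv * (decay_rate - exponent_t_max)) \<le> (r * w) * (cv * (decay_rate + exponent_t z))"
      using r w cv_pos by (intro mult_left_mono) auto
    then have time: "cv * r * barrier_t z \<le> - (r * w * (\<kappa> * C + \<beta> * \<rho>max * barrier_max / Jmin))"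
      unfolding decay_rate_eq barrier_t_def w_def[symmetric] by (simp add: algebra_simps)
    have "e' (fst z) \<le> C * r" using elim(2) by (auto simp: r_def abs_le_iff)
    moreover have "0 \<le> j * (e (fst z))\<^sup>2" using j by simp
    ultimately have "- (C * r) \<le> j * (e (fst z))\<^sup>2 - e' (fst z)" by linarith
    then have "(\<kappa> * w) * (- (C * r)) \<le> (\<kappa> * w) * (j * (e (fst z))\<^sup>2 - e' (fst z))"
      using \<kappa>_pos w by (intro mult_left_mono) auto
    then have diffusion: "- (r * w * (\<kappa> * C)) \<le> \<kappa> * (w * (j * (e (fst z))\<^sup>2 - e' (fst z)))"
      by (simp add: algebra_simps)
    have "(r * w) * (\<beta> * (r * w)) / j \<le> (r * w) * (\<beta> * (\<rho>max * barrier_max)) / Jmin"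
      using r w j Jmin_pos \<beta>_nonneg by (intro frac_le mult_mono mult_nonneg_nonneg) auto
    then have cooling: "\<beta> * r\<^sup>2 * w\<^sup>2 / j \<le> r * w * (\<beta> * \<rho>max * barrier_max / Jmin)"
      by (simp add: power2_eq_square algebra_simps)
    show "cv * \<rho>0 (fst z) * barrier_t z
        \<le> \<kappa> * (barrier z * (J z * (e (fst z))\<^sup>2 - e' (fst z))) - \<beta> * (\<rho>0 (fst z))\<^sup>2 * (barrier z)\<^sup>2 / J z"
      using time diffusion cooling unfolding r_def[symmetric] w_def[symmetric] j_def[symmetric]
      by (simp add: distrib_left)
  qed
qed

section \<open>The comparison principle\<close>

definition temperature :: "real \<times> real \<Rightarrow> real" where
  "temperature = time_primitive \<theta>0 \<theta>t"

definition excess :: "real \<times> real \<Rightarrow> real" where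
  "excess z = max 0 (barrier z - temperature z)"

definition tested_rate :: "real \<Rightarrow> real \<times> real \<Rightarrow> real" where
  "tested_rate N z = cv * \<rho>0 (fst z) * cutoff N (fst z) * (excess z)\<^sup>2 * (barrier_t z - \<theta>t z)"

lemma temperature_measurable [measurable]: "temperature \<in> borel_measurable borel"
  unfolding temperature_def by measurable

lemma excess_measurable [measurable]: "excess \<in> borel_measurable borel"
  unfolding excess_def[abs_def] by measurable

lemma tested_rate_measurable [measurable]: "tested_rate N \<in> borel_measurable borel"
  unfolding tested_rate_def[abs_def] by measurable

lemma temperature_eq: "AE z in lborel. z \<in> strip T \<longrightarrow> temperature z = \<theta> z"
  using \<theta>_eq by eventually_elim (auto simp: temperature_def)

lemma excess_nonneg: "0 \<le> excess z"
  by (simp add: excess_def)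

lemma excess_le: "AE z in lborel. z \<in> strip T \<longrightarrow> excess z \<le> barrier_max"
  using temperature_eq \<theta>_nonneg AE_lborel_fst[OF barrier_le]
proof eventually_elim
  case (elim z)
  show ?case
  proof
    assume z: "z \<in> strip T"
    then have "barrier z \<le> barrier_max" using elim(3) by (cases z) (auto simp: strip_def)
    then show "excess z \<le> barrier_max" using elim(1,2) z barrier_max_pos by (auto simp: excess_def)
  qed
qed

lemma primitive_on_temperature_time:
  "AE y in lborel. primitive_on UNIV (\<lambda>t. temperature (y, t)) (\<lambda>s. \<theta>t (y, s))"
  using slab_integrable_AE_integrable_slice[OF \<theta>t_slab]
proof eventually_elim
  case (elim y)
  show ?case
    unfolding temperature_def
    by (rule primitive_on_time_primitive) (auto intro: set_integrable_if_integrable elim)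
qed

lemma tested_rate_le_flux_difference:
  "AE z in lborel. z \<in> strip T \<longrightarrow> tested_rate N z
    \<le> \<kappa> * (cutoff N (fst z) * (max 0 (barrier z - \<theta> z))\<^sup>2
      * (barrier z * (J z * (e (fst z))\<^sup>2 - e' (fst z)) - Qy z))"
  using J_bounds temperature_eq barrier_subsolution heat_inequality \<theta>_nonneg
proof eventually_elim
  case (elim z)
  show ?case
  proof
    assume z: "z \<in> strip T"
    define d where "d = barrier z * (J z * (e (fst z))\<^sup>2 - e' (fst z)) - Qy z"
    define u where "u = cutoff N (fst z) * (max 0 (barrier z - \<theta> z))\<^sup>2"
    have u: "0 \<le> u" unfolding u_def by (simp add: cutoff_nonneg)
    have rate: "tested_rate N z = u * (cv * \<rho>0 (fst z) * (barrier_t z - \<theta>t z))"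
      using elim(2) z by (simp add: tested_rate_def u_def excess_def)
    have "tested_rate N z \<le> u * (\<kappa> * d)"
    proof (cases "\<theta> z < barrier z")
      case False
      then show ?thesis by (simp add: rate u_def)
    next
      case True
      have "0 < J z" using elim(1) z Jmin_pos by auto
      then have "\<beta> * (\<rho>0 (fst z))\<^sup>2 * (\<theta> z)\<^sup>2 / J z \<le> \<beta> * (\<rho>0 (fst z))\<^sup>2 * (barrier z)\<^sup>2 / J z"
        using elim(5) z True \<beta>_nonneg by (intro divide_right_mono mult_left_mono power_mono) auto
      then have "cv * \<rho>0 (fst z) * (barrier_t z - \<theta>t z) \<le> \<kappa> * d"
        using elim(3,4) z by (simp add: d_def right_diff_distrib)
      then show ?thesis unfolding rate using u by (rule mult_left_mono)
    qed
    then show "tested_rate N z \<le> \<kappa> * (cutoff N (fst z) * (max 0 (barrier z - \<theta> z))\<^sup>2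
        * (barrier z * (J z * (e (fst z))\<^sup>2 - e' (fst z)) - Qy z))"
      by (simp add: u_def d_def mult_ac)
  qed
qed

definition flux_constant :: real where
  "flux_constant = \<kappa> * (4 * barrier_max ^ 3 / Jmin)"

lemma flux_constant_nonneg: "0 \<le> flux_constant"
  unfolding flux_constant_def using \<kappa>_pos barrier_max_pos Jmin_pos by simp

lemma barrier_flux_difference:
  assumes q: "AE y in lborel. \<theta>y (y, t) / J (y, t) = q y" and J: "AE y in lborel. Jmin \<le> J (y, t)"
  shows "AE y in lborel. - (e y * barrier (y, t)) - q y
    = (- (barrier (y, t) * (J (y, t) * e y)) - \<theta>y (y, t)) / J (y, t)"
  using q J
proof eventually_elim
  case (elim y)
  then have "0 < J (y, t)" using Jmin_pos by linarith
  then show ?case unfolding elim(1)[symmetric] by (simp add: field_simps)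
qed

text \<open>The equation for \<open>barrier - \<theta>\<close> is tested with \<open>cutoff N\<close> times the square of \<open>excess\<close> and
  integrated by parts in space.\<close>

lemma tested_rate_space_integral_le:
  assumes N: "N > 0"
  shows "AE t in lborel. t \<in> {0<..<T} \<longrightarrow> integrable lborel (\<lambda>y. tested_rate N (y, t)) \<longrightarrow>
    (LINT y|lborel. tested_rate N (y, t)) \<le> flux_constant / N"
  using primitive_on_exponent_space \<theta>_slice flux_slice AE_lborel_pairD2[OF J_bounds]
    AE_lborel_pairD2[OF \<theta>_nonneg] AE_lborel_pairD2[OF tested_rate_le_flux_difference[of N]]
proof eventually_elim
  case (elim t)
  show ?case
  proof (intro impI)
    assume t: "t \<in> {0<..<T}" and int: "integrable lborel (\<lambda>y. tested_rate N (y, t))"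
    have strip: "(y, t) \<in> strip T" for y using t by (auto simp: strip_def)
    obtain u where u: "primitive_on UNIV u (\<lambda>y. \<theta>y (y, t))" "AE y in lborel. \<theta> (y, t) = u y"
      using elim(2) t by (blast elim: AE_primitiveE)
    obtain q where q: "primitive_on UNIV q (\<lambda>y. Qy (y, t))" "AE y in lborel. \<theta>y (y, t) / J (y, t) = q y"
      using elim(3) t by (blast elim: AE_primitiveE)
    have exponent: "primitive_on UNIV (\<lambda>y. exponent (y, t)) (\<lambda>y. J (y, t) * e y)" using elim(1) t by blast
    define P where "P y = barrier (y, t) - u y" for y
    define g where "g y = barrier (y, t) * (J (y, t) * (e y)\<^sup>2 - e' y) - Qy (y, t)" for y
    have P: "primitive_on UNIV P (\<lambda>y. - (barrier (y, t) * (J (y, t) * e y)) - \<theta>y (y, t))"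
      unfolding P_def by (rule primitive_on_diff[OF primitive_on_barrier_space[OF exponent] u(1)])
    have F: "primitive_on UNIV (\<lambda>y. - (e y * barrier (y, t)) - q y) g"
      unfolding g_def by (rule primitive_on_diff[OF primitive_on_barrier_flux[OF exponent] q(1)])
    have P_le: "AE y in lborel. P y \<le> barrier_max"
      using u(2) elim(5) barrier_le
    proof eventually_elim
      case (elim y)
      then have "barrier (y, t) \<le> barrier_max" "0 \<le> u y" using t strip by auto
      then show ?case by (simp add: P_def)
    qed
    have J_ge: "AE y in lborel. Jmin \<le> J (y, t)" using elim(4) strip by simp
    note estimate = cutoff_flux_estimate[OF N P F barrier_flux_difference[OF q(2) J_ge] Jmin_pos J_ge
        less_imp_le[OF barrier_max_pos] P_le]
    have "(LINT y|lborel. tested_rate N (y, t)) \<le> (LINT y|lborel. \<kappa> * (cutoff N y * (max 0 (P y))\<^sup>2 * g y))"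
    proof (rule integral_mono_AE[OF int])
      show "integrable lborel (\<lambda>y. \<kappa> * (cutoff N y * (max 0 (P y))\<^sup>2 * g y))" using estimate(1) by simp
      show "AE y in lborel. tested_rate N (y, t) \<le> \<kappa> * (cutoff N y * (max 0 (P y))\<^sup>2 * g y)"
        using elim(6) u(2) by eventually_elim (use strip in \<open>simp add: P_def g_def\<close>)
    qed
    also have "\<dots> \<le> \<kappa> * (4 * barrier_max ^ 3 / (N * Jmin))"
      using mult_left_mono[OF estimate(2) less_imp_le[OF \<kappa>_pos]] by simp
    finally show "(LINT y|lborel. tested_rate N (y, t)) \<le> flux_constant / N"
      by (simp add: flux_constant_def mult.commute)
  qed
qed

lemma abs_tested_rate_le:
  assumes N: "N > 0"
  shows "AE z in lborel. z \<in> strip T \<longrightarrow> \<bar>tested_rate N z\<bar>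
    \<le> cv * \<rho>max * barrier_max\<^sup>2 * (barrier_max * (decay_rate + exponent_t_max) + \<bar>\<theta>t z\<bar>)"
  using excess_le AE_lborel_fst[OF \<rho>0_le] AE_lborel_fst[OF barrier_le] AE_lborel_snd[OF abs_exponent_t_le]
proof eventually_elim
  case (elim z)
  show ?case
  proof
    assume z: "z \<in> strip T"
    have ex: "0 \<le> excess z" "excess z \<le> barrier_max" using excess_nonneg elim(1) z by auto
    have "\<bar>cv * \<rho>0 (fst z) * cutoff N (fst z) * (excess z)\<^sup>2\<bar> = cv * \<rho>0 (fst z) * cutoff N (fst z) * (excess z)\<^sup>2"
      using cv_pos \<rho>0_pos[of "fst z"] cutoff_nonneg[of N "fst z"] by simp
    also have "\<dots> \<le> cv * \<rho>max * 1 * barrier_max\<^sup>2"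
      using cv_pos \<rho>0_pos[of "fst z"] elim(2) cutoff_nonneg[of N "fst z"] cutoff_le_1[of N "fst z"] ex \<rho>max_pos
      by (intro mult_mono power_mono mult_nonneg_nonneg) auto
    finally have weight: "\<bar>cv * \<rho>0 (fst z) * cutoff N (fst z) * (excess z)\<^sup>2\<bar> \<le> cv * \<rho>max * barrier_max\<^sup>2"
      by simp
    have "\<bar>exponent_t z\<bar> \<le> exponent_t_max" using spec[OF elim(4), of "fst z"] by simp
    moreover have "0 \<le> decay_rate" using decay_rate_ge exponent_t_max_nonneg by linarith
    ultimately have "\<bar>decay_rate + exponent_t z\<bar> \<le> decay_rate + exponent_t_max" by linarith
    moreover have "barrier z \<le> barrier_max" using elim(3) z by (cases z) (auto simp: strip_def)
    ultimately have "\<bar>barrier_t z\<bar> \<le> barrier_max * (decay_rate + exponent_t_max)"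
      using barrier_pos[of z] barrier_max_pos by (simp add: barrier_t_def abs_mult mult_mono)
    then have "\<bar>barrier_t z - \<theta>t z\<bar> \<le> barrier_max * (decay_rate + exponent_t_max) + \<bar>\<theta>t z\<bar>" by linarith
    with weight show "\<bar>tested_rate N z\<bar>
        \<le> cv * \<rho>max * barrier_max\<^sup>2 * (barrier_max * (decay_rate + exponent_t_max) + \<bar>\<theta>t z\<bar>)"
      unfolding tested_rate_def abs_mult[of _ "barrier_t z - \<theta>t z"] by (intro mult_mono) auto
  qed
qed

definition slab_rate :: "real \<Rightarrow> real \<Rightarrow> real \<times> real \<Rightarrow> real" where
  "slab_rate N \<tau> z = indicator {0..\<tau>} (snd z) * tested_rate N z"

lemma slab_rate_integrable:
  assumes N: "N > 0" and \<tau>: "0 < \<tau>" "\<tau> < T"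
  shows "integrable lborel (slab_rate N \<tau>)"
proof -
  define c where "c = cv * \<rho>max * barrier_max\<^sup>2"
  define d where "d = barrier_max * (decay_rate + exponent_t_max)"
  have cd: "0 \<le> c" "0 \<le> d"
    unfolding c_def d_def using cv_pos \<rho>max_pos barrier_max_pos decay_rate_ge exponent_t_max_nonneg by auto
  have "integrable lborel (\<lambda>z. indicat_real {-N..N} (fst z) * indicat_real {0..\<tau>} (snd z))"
    by (intro integrable_tensor integrable_real_indicator) (auto simp: emeasure_lborel_Icc_eq)
  moreover have "integrable lborel (\<lambda>z. \<bar>indicat_real ({-N..N} \<times> UNIV) z *\<^sub>R \<theta>t z\<bar>)"
    using \<theta>t_slab unfolding slab_integrable_def set_integrable_def by simp
  ultimately have dom: "integrable lborel (\<lambda>z. c * d * (indicat_real {-N..N} (fst z) * indicat_real {0..\<tau>} (snd z))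
      + c * \<bar>indicat_real ({-N..N} \<times> UNIV) z *\<^sub>R \<theta>t z\<bar>)"
    by simp
  show ?thesis
  proof (rule Bochner_Integration.integrable_bound[OF dom])
    show "slab_rate N \<tau> \<in> borel_measurable lborel" unfolding slab_rate_def[abs_def] by measurable
    have "AE z::real \<times> real in lborel. snd z \<noteq> 0" by (rule AE_lborel_snd[OF AE_lborel_singleton])
    then show "AE z in lborel. norm (slab_rate N \<tau> z)
        \<le> norm (c * d * (indicat_real {-N..N} (fst z) * indicat_real {0..\<tau>} (snd z))
          + c * \<bar>indicat_real ({-N..N} \<times> UNIV) z *\<^sub>R \<theta>t z\<bar>)"
      using abs_tested_rate_le[OF N]
    proof eventually_elim
      case (elim z)
      consider (late) "snd z \<notin> {0..\<tau>}" | (outside) "fst z \<notin> {-N<..<N}" | (inside) "snd z \<in> {0..\<tau>}" "fst z \<in> {-N..N}" by force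
      then show ?case
      proof cases
        case late
        then show ?thesis by (simp add: slab_rate_def)
      next
        case outside
        then show ?thesis by (simp add: slab_rate_def tested_rate_def cutoff_eq_0[OF N])
      next
        case inside
        then have "z \<in> strip T" using elim(1) \<tau> by (cases z) (auto simp: strip_def)
        then have "\<bar>tested_rate N z\<bar> \<le> c * (d + \<bar>\<theta>t z\<bar>)" using elim(2) by (simp add: c_def d_def)
        moreover have "0 \<le> c * (d + \<bar>\<theta>t z\<bar>)" using cd by simp
        ultimately show ?thesis using inside by (simp add: slab_rate_def indicator_Times_fst_snd distrib_left)
      qed
    qed
  qed
qed

lemma slab_rate_integral_le:
  assumes N: "N > 0" and \<tau>: "0 < \<tau>" "\<tau> < T"
  shows "(LINT z|lborel. slab_rate N \<tau> z) \<le> T * (flux_constant / N)"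
proof -
  define k where "k = flux_constant / N"
  have k: "0 \<le> k" unfolding k_def using flux_constant_nonneg N by simp
  note int = slab_rate_integrable[OF N \<tau>]
  have "(LINT z|lborel. slab_rate N \<tau> z) = (LINT t|lborel. LINT y|lborel. slab_rate N \<tau> (y, t))"
    by (rule lborel_integral_snd[OF int, symmetric])
  also have "\<dots> \<le> (LINT t|lborel. indicator {0..\<tau>} t * k)"
  proof (rule integral_mono_AE[OF lborel_integrable_snd[OF int]])
    show "integrable lborel (\<lambda>t. indicator {0..\<tau>} t * k)"
      by (intro integrable_mult_left integrable_real_indicator) (auto simp: emeasure_lborel_Icc_eq)
    show "AE t in lborel. (LINT y|lborel. slab_rate N \<tau> (y, t)) \<le> indicator {0..\<tau>} t * k"
      using tested_rate_space_integral_le[OF N] lborel_AE_integrable_snd[OF int] AE_lborel_singleton[of 0]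
    proof eventually_elim
      case (elim t)
      show ?case
      proof (cases "t \<in> {0..\<tau>}")
        case True
        then have "t \<in> {0<..<T}" using elim(3) \<tau> by auto
        then show ?thesis using elim(1,2) True by (simp add: slab_rate_def k_def)
      qed (simp add: slab_rate_def)
    qed
  qed
  also have "\<dots> = \<tau> * k" using \<tau> by simp
  also have "\<dots> \<le> T * k" using \<tau> k by (intro mult_right_mono) auto
  finally show ?thesis by (simp add: k_def)
qed

lemma slab_rate_time_integral:
  assumes \<tau>: "0 < \<tau>"
  shows "AE y in lborel. (LINT t|lborel. slab_rate N \<tau> (y, t)) = cv / 3 * (\<rho>0 y * cutoff N y * excess (y, \<tau>) ^ 3)"
  using primitive_on_temperature_time barrier_initial_le
proof eventually_elim
  case (elim y)
  have "primitive_on UNIV (\<lambda>t. excess (y, t) ^ 3) (\<lambda>t. 3 * (excess (y, t))\<^sup>2 * (barrier_t (y, t) - \<theta>t (y, t)))"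
    unfolding excess_def
    by (intro primitive_on_pos_part_cube primitive_on_diff primitive_on_barrier_time elim(1) is_interval_univ)
  from primitive_onD(2)[OF this UNIV_I UNIV_I less_imp_le[OF \<tau>]]
  have "(LINT t:{0..\<tau>}|lborel. 3 * (excess (y, t))\<^sup>2 * (barrier_t (y, t) - \<theta>t (y, t)))
      = excess (y, \<tau>) ^ 3 - excess (y, 0) ^ 3" by simp
  moreover have "excess (y, 0) = 0" using elim(2) by (simp add: excess_def temperature_def)
  moreover have "(LINT t|lborel. slab_rate N \<tau> (y, t)) = (LINT t|lborel. (cv / 3 * (\<rho>0 y * cutoff N y)) *
      (indicator {0..\<tau>} t *\<^sub>R (3 * (excess (y, t))\<^sup>2 * (barrier_t (y, t) - \<theta>t (y, t)))))"
    by (intro Bochner_Integration.integral_cong refl) (simp add: slab_rate_def tested_rate_def)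
  ultimately show ?case
    unfolding set_lebesgue_integral_def by (simp only: integral_mult_right_zero) simp
qed

lemma cutoff_excess_integral_le:
  assumes N: "N > 0" and \<tau>: "0 < \<tau>" "\<tau> < T"
  shows "(\<integral>\<^sup>+ y. ennreal (\<rho>0 y * cutoff N y * excess (y, \<tau>) ^ 3) \<partial>lborel)
    \<le> ennreal (3 / cv * (T * (flux_constant / N)))"
proof -
  let ?f = "\<lambda>y. \<rho>0 y * cutoff N y * excess (y, \<tau>) ^ 3"
  note int = slab_rate_integrable[OF N \<tau>]
  have eq: "AE y in lborel. 3 / cv * (LINT t|lborel. slab_rate N \<tau> (y, t)) = ?f y"
    using slab_rate_time_integral[OF \<tau>(1), of N]
  proof eventually_elim
    case (elim y)
    show ?case unfolding elim using cv_pos by simp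
  qed
  have rate: "integrable lborel (\<lambda>y. 3 / cv * (LINT t|lborel. slab_rate N \<tau> (y, t)))"
    using lborel_integrable_fst[OF int] by simp
  have f: "integrable lborel ?f"
    by (rule integrable_cong_AE_imp[OF rate _ eq]) measurable
  have "(LINT y|lborel. ?f y) = (LINT y|lborel. 3 / cv * (LINT t|lborel. slab_rate N \<tau> (y, t)))"
    by (rule integral_cong_AE) (use eq f rate in \<open>auto elim!: eventually_mono\<close>)
  also have "\<dots> = 3 / cv * (LINT z|lborel. slab_rate N \<tau> z)"
    using lborel_integral_fst[OF int] by simp
  also have "\<dots> \<le> 3 / cv * (T * (flux_constant / N))"
    using slab_rate_integral_le[OF N \<tau>] cv_pos by (intro mult_left_mono) auto
  finally have le: "(LINT y|lborel. ?f y) \<le> 3 / cv * (T * (flux_constant / N))" .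
  have "0 \<le> ?f y" for y using \<rho>0_pos[of y] cutoff_nonneg[of N y] excess_nonneg[of "(y, \<tau>)"] by simp
  then have "(\<integral>\<^sup>+ y. ennreal (?f y) \<partial>lborel) = ennreal (LINT y|lborel. ?f y)"
    by (intro nn_integral_eq_integral f) auto
  then show ?thesis using ennreal_leI[OF le] by simp
qed

lemma excess_eq_0:
  assumes \<tau>: "0 < \<tau>" "\<tau> < T"
  shows "AE y in lborel. excess (y, \<tau>) = 0"
proof -
  define u where "u n y = ennreal (\<rho>0 y * cutoff (real (Suc n)) y * excess (y, \<tau>) ^ 3)" for n y
  have "AE y in lborel. ennreal (\<rho>0 y * 1 * excess (y, \<tau>) ^ 3) = 0"
  proof (rule Fatou_AE_eq_0[where u = u])
    show "u n \<in> borel_measurable lborel" for n unfolding u_def by measurable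
    show "AE y in lborel. (\<lambda>n. u n y) \<longlonglongrightarrow> ennreal (\<rho>0 y * 1 * excess (y, \<tau>) ^ 3)"
      unfolding u_def by (intro AE_I2 tendsto_intros cutoff_tendsto_1)
    show "(\<lambda>n. \<integral>\<^sup>+ y. u n y \<partial>lborel) \<longlonglongrightarrow> 0"
    proof (rule tendsto_sandwich[OF _ _ tendsto_const])
      have "(\<lambda>n. 3 / cv * (T * (flux_constant * inverse (real (Suc n))))) \<longlonglongrightarrow> 3 / cv * (T * (flux_constant * 0))"
        by (intro tendsto_intros LIMSEQ_inverse_real_of_nat)
      from tendsto_ennrealI[OF this]
      show "(\<lambda>n. ennreal (3 / cv * (T * (flux_constant / real (Suc n))))) \<longlonglongrightarrow> 0"
        by (simp add: divide_inverse)
      show "\<forall>\<^sub>F n in sequentially. (\<integral>\<^sup>+ y. u n y \<partial>lborel) \<le> ennreal (3 / cv * (T * (flux_constant / real (Suc n))))"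
        unfolding u_def by (intro always_eventually allI cutoff_excess_integral_le \<tau>) simp
    qed simp
  qed
  then show ?thesis
  proof eventually_elim
    case (elim y)
    then have "\<rho>0 y * excess (y, \<tau>) ^ 3 \<le> 0" by (simp add: ennreal_eq_0_iff)
    then have "excess (y, \<tau>) ^ 3 \<le> 0" using \<rho>0_pos[of y] by (simp add: mult_le_0_iff)
    then show ?case using excess_nonneg[of "(y, \<tau>)"] by (simp add: power_le_zero_eq)
  qed
qed

lemma temperature_lower_bound:
  "\<exists>c>0. AE z in lborel. z \<in> strip T \<longrightarrow> c * \<rho>0 (fst z) powr \<alpha> \<le> \<theta> z"
proof -
  obtain c where c: "c > 0" "AE y in lborel. \<forall>t\<in>{0..T}. c * \<rho>0 y powr \<alpha> \<le> barrier (y, t)"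
    using barrier_ge by blast
  have meas: "{z. snd z \<in> {0<..<T} \<longrightarrow> excess z = 0} \<in> sets borel" by measurable
  have "AE y in lborel. snd (y, t) \<in> {0<..<T} \<longrightarrow> excess (y, t) = 0" for t
    using excess_eq_0[of t] by (cases "t \<in> {0<..<T}") auto
  then have "AE t in lborel. AE y in lborel. snd (y, t) \<in> {0<..<T} \<longrightarrow> excess (y, t) = 0" by simp
  then have "AE z in lborel. snd z \<in> {0<..<T} \<longrightarrow> excess z = 0"
    using AE_lborel_pair_commute[OF meas] by (intro AE_lborel_pairI[OF meas]) blast
  then have "AE z in lborel. z \<in> strip T \<longrightarrow> c * \<rho>0 (fst z) powr \<alpha> \<le> \<theta> z"
    using AE_lborel_fst[OF c(2)] temperature_eq
  proof eventually_elim
    case (elim z)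
    show ?case
    proof
      assume z: "z \<in> strip T"
      then have t: "snd z \<in> {0<..<T}" by (auto simp: strip_def)
      have "c * \<rho>0 (fst z) powr \<alpha> \<le> barrier z" using bspec[OF elim(2), of "snd z"] t by auto
      also have "\<dots> \<le> temperature z" using elim(1) t by (simp add: excess_def max_def split: if_splits)
      finally show "c * \<rho>0 (fst z) powr \<alpha> \<le> \<theta> z" using elim(3) z by simp
    qed
  qed
  with c(1) show ?thesis by blast
qed

end

section \<open>From solutions to thermal flows\<close>

definition extend_by_zero :: "real \<Rightarrow> (real \<times> real \<Rightarrow> real) \<Rightarrow> real \<times> real \<Rightarrow> real" where
  "extend_by_zero T f z = (if z \<in> strip T then f z else 0)"

lemma extend_by_zero_on [simp]: "z \<in> strip T \<Longrightarrow> extend_by_zero T f z = f z"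
  and extend_by_zero_off [simp]: "z \<notin> strip T \<Longrightarrow> extend_by_zero T f z = 0"
  by (simp_all add: extend_by_zero_def)

lemma strip_borel [measurable]: "strip T \<in> sets borel"
  unfolding strip_def by (intro borel_open open_Times) auto

lemma extend_by_zero_measurable:
  assumes "set_borel_measurable lborel (strip T) f"
  shows "extend_by_zero T f \<in> borel_measurable borel"
proof -
  have "extend_by_zero T f = (\<lambda>z. indicator (strip T) z *\<^sub>R f z)"
    by (auto simp: extend_by_zero_def)
  then show ?thesis using assms by (simp add: set_borel_measurable_def)
qed

lemma extend_by_zero_measurable_weighted:
  assumes "set_borel_measurable lborel (strip T) (\<lambda>(y, t). k y * f (y, t))"
    and [measurable]: "k \<in> borel_measurable borel" and "\<And>y. k y \<noteq> 0"
  shows "extend_by_zero T f \<in> borel_measurable borel"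
proof -
  have [measurable]: "extend_by_zero T (\<lambda>(y, t). k y * f (y, t)) \<in> borel_measurable borel"
    by (rule extend_by_zero_measurable[OF assms(1)])
  have "extend_by_zero T f = (\<lambda>z. extend_by_zero T (\<lambda>(y, t). k y * f (y, t)) z / k (fst z))"
    using assms(3) by (auto simp: extend_by_zero_def fun_eq_iff)
  moreover have "(\<lambda>z. extend_by_zero T (\<lambda>(y, t). k y * f (y, t)) z / k (fst z)) \<in> borel_measurable borel"
    by measurable
  ultimately show ?thesis by (simp only:)
qed

lemma attains_initial_extend_by_zero:
  assumes "attains_initial f f0" "T > 0"
  shows "attains_initial (extend_by_zero T f) f0"
  unfolding attains_initial_def
proof (intro allI impI)
  fix a b \<epsilon> :: real assume "\<epsilon> > 0"
  then obtain \<delta> where \<delta>: "\<delta> > 0" "AE t in lborel. 0 < t \<and> t < \<delta> \<longrightarrow>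
      (\<integral>\<^sup>+ y\<in>{a..b}. ennreal ((f (y, t) - f0 y)\<^sup>2) \<partial>lborel) < ennreal \<epsilon>"
    using assms(1) unfolding attains_initial_def by blast
  have "AE t in lborel. 0 < t \<and> t < min \<delta> T \<longrightarrow>
      (\<integral>\<^sup>+ y\<in>{a..b}. ennreal ((extend_by_zero T f (y, t) - f0 y)\<^sup>2) \<partial>lborel) < ennreal \<epsilon>"
    using \<delta>(2) by eventually_elim (simp add: extend_by_zero_def strip_def)
  then show "\<exists>\<delta>>0. AE t in lborel. 0 < t \<and> t < \<delta> \<longrightarrow>
      (\<integral>\<^sup>+ y\<in>{a..b}. ennreal ((extend_by_zero T f (y, t) - f0 y)\<^sup>2) \<partial>lborel) < ennreal \<epsilon>"
    using \<delta>(1) assms(2) by (intro exI[of _ "min \<delta> T"]) auto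
qed

lemma L_infty_L2_slice_bound:
  assumes "L_infty_L2 T f"
  obtains C where "C \<ge> 0"
    "AE t in lborel. (\<integral>\<^sup>+ y. ennreal ((extend_by_zero T f (y, t))\<^sup>2) \<partial>lborel) \<le> ennreal C"
proof -
  obtain C where C: "AE t in lborel. t \<in> {0<..<T} \<longrightarrow> (\<integral>\<^sup>+ y. ennreal ((f (y, t))\<^sup>2) \<partial>lborel) \<le> ennreal C"
    using assms unfolding L_infty_L2_def by blast
  have "AE t in lborel. (\<integral>\<^sup>+ y. ennreal ((extend_by_zero T f (y, t))\<^sup>2) \<partial>lborel) \<le> ennreal (max C 0)"
    using C
  proof eventually_elim
    case (elim t)
    show ?case
    proof (cases "t \<in> {0<..<T}")
      case True
      then have "extend_by_zero T f (y, t) = f (y, t)" for y by (simp add: extend_by_zero_def strip_def)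
      then show ?thesis using elim True by (auto intro: order_trans ennreal_leI)
    next
      case False
      then have "extend_by_zero T f (y, t) = 0" for y by (auto simp: extend_by_zero_def strip_def)
      then show ?thesis by simp
    qed
  qed
  then show ?thesis by (intro that[of "max C 0"]) auto
qed

lemma L_infty_L2_imp_L2_L2:
  assumes "L_infty_L2 T f"
  shows "L2_L2 T f"
proof -
  obtain C where C: "AE t in lborel. t \<in> {0<..<T} \<longrightarrow> (\<integral>\<^sup>+ y. ennreal ((f (y, t))\<^sup>2) \<partial>lborel) \<le> ennreal C"
    using assms unfolding L_infty_L2_def by auto
  have "(\<integral>\<^sup>+ t\<in>{0<..<T}. (\<integral>\<^sup>+ y. ennreal ((f (y, t))\<^sup>2) \<partial>lborel) \<partial>lborel) \<le> (\<integral>\<^sup>+ t. ennreal C * indicator {0<..<T} t \<partial>lborel)"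
    by (rule nn_integral_mono_AE) (use C in \<open>auto elim!: eventually_mono simp: indicator_def\<close>)
  also have "\<dots> = ennreal C * emeasure lborel {0<..<T}" by (simp add: nn_integral_cmult)
  also have "\<dots> < \<infinity>" by (cases "0 \<le> T") (auto simp: ennreal_mult_less_top)
  finally show ?thesis using assms by (simp add: L2_L2_def L_infty_L2_def)
qed

lemma L2_L2_integrable_square:
  assumes "L2_L2 T f"
  shows "integrable lborel (\<lambda>z. (extend_by_zero T f z)\<^sup>2)"
proof -
  have [measurable]: "extend_by_zero T f \<in> borel_measurable borel"
    using assms by (intro extend_by_zero_measurable) (simp add: L2_L2_def)
  have "(\<integral>\<^sup>+ z. ennreal ((extend_by_zero T f z)\<^sup>2) \<partial>lborel)
      = (\<integral>\<^sup>+ t. (\<integral>\<^sup>+ y. ennreal ((extend_by_zero T f (y, t))\<^sup>2) \<partial>lborel) \<partial>lborel)"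
    using lborel_pair.nn_integral_snd[of "\<lambda>z. ennreal ((extend_by_zero T f z)\<^sup>2)"] by (simp add: lborel_prod)
  also have "\<dots> = (\<integral>\<^sup>+ t\<in>{0<..<T}. (\<integral>\<^sup>+ y. ennreal ((f (y, t))\<^sup>2) \<partial>lborel) \<partial>lborel)"
    by (rule nn_integral_cong) (auto simp: indicator_def extend_by_zero_def strip_def)
  also have "\<dots> < \<infinity>" using assms by (simp add: L2_L2_def)
  finally show ?thesis by (intro integrableI_bounded) auto
qed

lemma L2_L2_slab_integrable:
  assumes "L2_L2 T f"
  shows "slab_integrable (extend_by_zero T f)"
  unfolding slab_integrable_def set_integrable_def
proof
  fix r :: real
  have [measurable]: "extend_by_zero T f \<in> borel_measurable borel"
    using assms by (intro extend_by_zero_measurable) (simp add: L2_L2_def)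
  have "integrable lborel (\<lambda>z. indicat_real {-r..r} (fst z) * indicat_real {0..T} (snd z))"
    by (intro integrable_tensor integrable_real_indicator) (auto simp: emeasure_lborel_Icc_eq)
  with L2_L2_integrable_square[OF assms]
  have dom: "integrable lborel (\<lambda>z. indicat_real {-r..r} (fst z) * indicat_real {0..T} (snd z) + (extend_by_zero T f z)\<^sup>2)"
    by simp
  show "integrable lborel (\<lambda>z. indicat_real ({-r..r} \<times> UNIV) z *\<^sub>R extend_by_zero T f z)"
  proof (rule Bochner_Integration.integrable_bound[OF dom])
    show "(\<lambda>z. indicat_real ({-r..r} \<times> UNIV) z *\<^sub>R extend_by_zero T f z) \<in> borel_measurable lborel"
      unfolding indicator_Times_fst_snd by measurable
    show "AE z in lborel. norm (indicat_real ({-r..r} \<times> UNIV) z *\<^sub>R extend_by_zero T f z)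
        \<le> norm (indicat_real {-r..r} (fst z) * indicat_real {0..T} (snd z) + (extend_by_zero T f z)\<^sup>2)"
    proof (rule AE_I2)
      fix z
      show "norm (indicat_real ({-r..r} \<times> UNIV) z *\<^sub>R extend_by_zero T f z)
          \<le> norm (indicat_real {-r..r} (fst z) * indicat_real {0..T} (snd z) + (extend_by_zero T f z)\<^sup>2)"
      proof (cases "fst z \<in> {-r..r} \<and> z \<in> strip T")
        case True
        then have "snd z \<in> {0..T}" by (auto simp: strip_def)
        then show ?thesis using True abs_le_square_divide_sqrt[of 1 "f z"] by (simp add: indicator_Times_fst_snd)
      next
        case False
        then show ?thesis by (auto simp: indicator_Times_fst_snd)
      qed
    qed
  qed
qed

lemma slab_integrable_divide:
  assumes f: "slab_integrable (\<lambda>z. k (fst z) * f z)"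
    and [measurable]: "f \<in> borel_measurable borel"
    and k: "\<And>r. \<exists>c>0. AE y in lborel. \<bar>y\<bar> \<le> r \<longrightarrow> c \<le> k y"
  shows "slab_integrable f"
  unfolding slab_integrable_def set_integrable_def
proof
  fix r :: real
  obtain c where c: "c > 0" "AE y in lborel. \<bar>y\<bar> \<le> r \<longrightarrow> c \<le> k y" using k by blast
  have dom: "integrable lborel (\<lambda>z. 1 / c * (indicat_real ({-r..r} \<times> UNIV) z *\<^sub>R (k (fst z) * f z)))"
    using f unfolding slab_integrable_def set_integrable_def by simp
  show "integrable lborel (\<lambda>z. indicat_real ({-r..r} \<times> UNIV) z *\<^sub>R f z)"
  proof (rule Bochner_Integration.integrable_bound[OF dom])
    show "(\<lambda>z. indicat_real ({-r..r} \<times> UNIV) z *\<^sub>R f z) \<in> borel_measurable lborel"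
      unfolding indicator_Times_fst_snd by measurable
    show "AE z in lborel. norm (indicat_real ({-r..r} \<times> UNIV) z *\<^sub>R f z)
        \<le> norm (1 / c * (indicat_real ({-r..r} \<times> UNIV) z *\<^sub>R (k (fst z) * f z)))"
      using AE_lborel_fst[OF c(2)]
    proof eventually_elim
      case (elim z)
      show ?case
      proof (cases "fst z \<in> {-r..r}")
        case True
        then have "c \<le> \<bar>k (fst z)\<bar>" using elim by auto
        then have "c * \<bar>f z\<bar> \<le> \<bar>k (fst z)\<bar> * \<bar>f z\<bar>" by (rule mult_right_mono) simp
        then show ?thesis using True c(1) by (simp add: indicator_Times_fst_snd abs_mult field_simps)
      qed (simp add: indicator_Times_fst_snd)
    qed
  qed
qed

lemma L_infty_inverse_imp_bounds:
  assumes pos: "AE z in lborel. z \<in> \<Omega> \<longrightarrow> 0 < J z" and J: "L_infty \<Omega> J" "L_infty \<Omega> (\<lambda>z. inverse (J z))"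
  obtains Jmin Jmax where "Jmin > 0" "AE z in lborel. z \<in> \<Omega> \<longrightarrow> Jmin \<le> J z \<and> J z \<le> Jmax"
proof -
  obtain Jmax where Jmax: "AE z in lborel. z \<in> \<Omega> \<longrightarrow> \<bar>J z\<bar> \<le> Jmax" using J(1) unfolding L_infty_def by blast
  obtain Ji where Ji: "AE z in lborel. z \<in> \<Omega> \<longrightarrow> \<bar>inverse (J z)\<bar> \<le> Ji" using J(2) unfolding L_infty_def by blast
  have "AE z in lborel. z \<in> \<Omega> \<longrightarrow> inverse (max Ji 1) \<le> J z \<and> J z \<le> Jmax"
    using pos Jmax Ji
  proof eventually_elim
    case (elim z)
    show ?case
    proof
      assume z: "z \<in> \<Omega>"
      have "0 < J z" "inverse (J z) \<le> max Ji 1" using elim z by auto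
      then have "inverse (max Ji 1) \<le> inverse (inverse (J z))" by (intro le_imp_inverse_le) auto
      then show "inverse (max Ji 1) \<le> J z \<and> J z \<le> Jmax" using elim z by auto
    qed
  qed
  then show ?thesis by (intro that[of "inverse (max Ji 1)"]) auto
qed

text \<open>Completing the square in the viscous heating term eliminates the velocity.\<close>

lemma viscous_heating_ge:
  fixes \<mu> R x q j :: real
  assumes "\<mu> > 0" "j > 0"
  shows "- (R\<^sup>2 / (4 * \<mu>) * q\<^sup>2 / j) \<le> \<mu> * (x\<^sup>2 / j) - R * q * x / j"
proof -
  have "0 \<le> (2 * \<mu> * x - R * q)\<^sup>2 / (4 * \<mu>)" using assms(1) by simp
  also have "\<dots> = \<mu> * x\<^sup>2 - R * q * x + R\<^sup>2 / (4 * \<mu>) * q\<^sup>2"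
    using assms(1) by (simp add: power2_eq_square field_simps)
  finally have "- (R\<^sup>2 / (4 * \<mu>) * q\<^sup>2) \<le> \<mu> * x\<^sup>2 - R * q * x" by linarith
  then have "- (R\<^sup>2 / (4 * \<mu>) * q\<^sup>2) / j \<le> (\<mu> * x\<^sup>2 - R * q * x) / j"
    using assms(2) by (intro divide_right_mono) auto
  then show ?thesis by (simp add: diff_divide_distrib)
qed

lemma heat_equation_imp_inequality:
  fixes \<mu> R r th x j :: real
  assumes "\<mu> > 0" "j > 0"
    and "cv * r * tht - \<kappa> * Q + R * (r / j) * th * x = \<mu> * (\<bar>x\<bar>\<^sup>2 / j)"
  shows "\<kappa> * Q - R\<^sup>2 / (4 * \<mu>) * r\<^sup>2 * th\<^sup>2 / j \<le> cv * r * tht"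
  using viscous_heating_ge[OF assms(1,2), of R "r * th" x] assms(3)
  by (simp add: power_mult_distrib mult_ac)

lemma L2_L2_weighted_slab_integrable:
  assumes f: "L2_L2 T (\<lambda>(y, t). k y * f (y, t))" and k_meas: "k \<in> borel_measurable borel" and k_ne: "\<And>y. k y \<noteq> 0"
    and k: "\<And>r. \<exists>c>0. AE y in lborel. \<bar>y\<bar> \<le> r \<longrightarrow> c \<le> k y"
  shows "slab_integrable (extend_by_zero T f)"
proof (rule slab_integrable_divide[OF _ _ k])
  have "extend_by_zero T (\<lambda>(y, t). k y * f (y, t)) = (\<lambda>z. k (fst z) * extend_by_zero T f z)"
    by (auto simp: extend_by_zero_def)
  then show "slab_integrable (\<lambda>z. k (fst z) * extend_by_zero T f z)"
    using L2_L2_slab_integrable[OF f] by simp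
  show "extend_by_zero T f \<in> borel_measurable borel"
    using f by (intro extend_by_zero_measurable_weighted[OF _ k_meas k_ne]) (simp add: L2_L2_def)
qed

lemma weak_deriv_extend_by_zero:
  assumes "weak_deriv (strip T) b f g"
  shows "weak_deriv (strip T) b (extend_by_zero T f) (extend_by_zero T g)"
  by (rule weak_deriv_cong[OF assms]) simp_all

lemma NS_solution_heat_inequalityE:
  assumes "\<mu> > 0" and sol: "NS_solution \<mu> \<kappa> cv R \<rho>0 J0 v0 \<theta>0 T J v \<theta>"
  obtains Jt \<theta>t \<theta>y Qy where
    "weak_deriv (strip T) (0, 1) J Jt" "weak_deriv (strip T) (0, 1) \<theta> \<theta>t"
    "weak_deriv (strip T) (1, 0) \<theta> \<theta>y" "weak_deriv (strip T) (1, 0) (\<lambda>z. \<theta>y z / J z) Qy"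
    "L_infty_L2 T Jt" "L_infty_L2 T (\<lambda>(y, t). sqrt (\<rho>0 y) * \<theta> (y, t))" "L2_L2 T \<theta>y"
    "L2_L2 T (\<lambda>(y, t). \<rho>0 y * Qy (y, t))" "L2_L2 T (\<lambda>(y, t). (\<rho>0 y)\<^sup>2 * \<theta>t (y, t))"
    "AE z in lborel. z \<in> strip T \<longrightarrow>
      \<kappa> * Qy z - R\<^sup>2 / (4 * \<mu>) * (\<rho>0 (fst z))\<^sup>2 * (\<theta> z)\<^sup>2 / J z \<le> cv * \<rho>0 (fst z) * \<theta>t z"
proof -
  obtain Jt Jy Jyt vt vy vyy \<theta>t \<theta>y Fy Py Qy where
    weak_derivs: "weak_deriv (strip T) (0, 1) J Jt" "weak_deriv (strip T) (0, 1) \<theta> \<theta>t"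
      "weak_deriv (strip T) (1, 0) \<theta> \<theta>y" "weak_deriv (strip T) (1, 0) (\<lambda>z. \<theta>y z / J z) Qy"
    and norms: "L_infty_L2 T Jt" "L_infty_L2 T (\<lambda>(y, t). sqrt (\<rho>0 y) * \<theta> (y, t))" "L2_L2 T \<theta>y"
      "L2_L2 T (\<lambda>(y, t). \<rho>0 y * Qy (y, t))" "L2_L2 T (\<lambda>(y, t). (\<rho>0 y)\<^sup>2 * \<theta>t (y, t))"
    and system: "AE (y, t) in lborel. (y, t) \<in> strip T \<longrightarrow>
         Jt (y, t) = vy (y, t) \<and>
         \<rho>0 y * vt (y, t) - \<mu> * Fy (y, t) + R * Py (y, t) = 0 \<and>
         cv * \<rho>0 y * \<theta>t (y, t) - \<kappa> * Qy (y, t)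
           + R * (\<rho>0 y / J (y, t)) * \<theta> (y, t) * vy (y, t)
           = \<mu> * (\<bar>vy (y, t)\<bar>\<^sup>2 / J (y, t))"
    using sol unfolding NS_solution_def by (elim conjE exE) (rule that; assumption)
  have J_pos: "AE z in lborel. z \<in> strip T \<longrightarrow> 0 < J z"
    using sol unfolding NS_solution_def by blast
  have "AE z in lborel. z \<in> strip T \<longrightarrow>
      \<kappa> * Qy z - R\<^sup>2 / (4 * \<mu>) * (\<rho>0 (fst z))\<^sup>2 * (\<theta> z)\<^sup>2 / J z \<le> cv * \<rho>0 (fst z) * \<theta>t z"
    using system J_pos
  proof eventually_elim
    case (elim z)
    show ?case
    proof
      assume z: "z \<in> strip T"
      then have "cv * \<rho>0 (fst z) * \<theta>t z - \<kappa> * Qy z + R * (\<rho>0 (fst z) / J z) * \<theta> z * vy z = \<mu> * (\<bar>vy z\<bar>\<^sup>2 / J z)"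
        using elim(1) by (cases z) simp
      with \<open>\<mu> > 0\<close> elim(2) z
      show "\<kappa> * Qy z - R\<^sup>2 / (4 * \<mu>) * (\<rho>0 (fst z))\<^sup>2 * (\<theta> z)\<^sup>2 / J z \<le> cv * \<rho>0 (fst z) * \<theta>t z"
        by (intro heat_equation_imp_inequality) auto
    qed
  qed
  then show thesis by (rule that[OF weak_derivs norms])
qed

lemma thermal_flow_extend_by_zero:
  assumes pos: "\<kappa> > 0" "cv > 0" "T > 0" "Jmin > 0" "Jt_bound \<ge> 0"
    and \<rho>0: "\<And>y. 0 < \<rho>0 y" "integrable lborel \<rho>0" "\<And>r. \<exists>c>0. AE y in lborel. \<bar>y\<bar> \<le> r \<longrightarrow> c \<le> \<rho>0 y"
    and J0: "locally_integrable UNIV J0" and \<theta>0 [measurable]: "\<theta>0 \<in> borel_measurable borel"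
    and J_bounds: "AE z in lborel. z \<in> strip T \<longrightarrow> Jmin \<le> J z \<and> J z \<le> Jmax"
    and \<theta>_nonneg: "AE z in lborel. z \<in> strip T \<longrightarrow> 0 \<le> \<theta> z"
    and initial: "attains_initial J J0" "attains_initial \<theta> \<theta>0"
    and weak_derivs: "weak_deriv (strip T) (0, 1) J Jt" "weak_deriv (strip T) (0, 1) \<theta> \<theta>t"
      "weak_deriv (strip T) (1, 0) \<theta> \<theta>y" "weak_deriv (strip T) (1, 0) (\<lambda>z. \<theta>y z / J z) Qy"
    and J: "L_infty (strip T) J" and \<theta>: "L_infty_L2 T (\<lambda>(y, t). sqrt (\<rho>0 y) * \<theta> (y, t))"
    and \<theta>y: "L2_L2 T \<theta>y" and Qy: "L2_L2 T (\<lambda>(y, t). \<rho>0 y * Qy (y, t))"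
    and \<theta>t: "L2_L2 T (\<lambda>(y, t). (\<rho>0 y)\<^sup>2 * \<theta>t (y, t))" and Jt: "L_infty_L2 T Jt"
    and Jt_bound: "AE t in lborel. (\<integral>\<^sup>+ y. ennreal ((extend_by_zero T Jt (y, t))\<^sup>2) \<partial>lborel) \<le> ennreal Jt_bound"
    and heat: "AE z in lborel. z \<in> strip T \<longrightarrow>
      \<kappa> * Qy z - \<beta> * (\<rho>0 (fst z))\<^sup>2 * (\<theta> z)\<^sup>2 / J z \<le> cv * \<rho>0 (fst z) * \<theta>t z" and "\<beta> \<ge> 0"
  shows "thermal_flow T \<kappa> cv \<beta> Jmin Jmax Jt_bound \<rho>0 J0 \<theta>0 (extend_by_zero T J) (extend_by_zero T Jt)
    (extend_by_zero T \<theta>) (extend_by_zero T \<theta>t) (extend_by_zero T \<theta>y) (extend_by_zero T Qy)"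
proof -
  let ?ext = "extend_by_zero T"
  have [measurable]: "\<rho>0 \<in> borel_measurable borel" "J0 \<in> borel_measurable borel"
    using \<rho>0(2) borel_measurable_locally_integrable[OF J0] by auto
  have \<rho>0_ne: "\<rho>0 y \<noteq> 0" for y using \<rho>0(1)[of y] by simp
  have [measurable]: "?ext J \<in> borel_measurable borel" "?ext Jt \<in> borel_measurable borel" "?ext \<theta>y \<in> borel_measurable borel"
    using J Jt \<theta>y by (auto simp: L_infty_def L_infty_L2_def L2_L2_def intro: extend_by_zero_measurable)
  have [measurable]: "?ext \<theta> \<in> borel_measurable borel" "?ext \<theta>t \<in> borel_measurable borel" "?ext Qy \<in> borel_measurable borel"
    using extend_by_zero_measurable_weighted[of T "\<lambda>y. sqrt (\<rho>0 y)" \<theta>]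
      extend_by_zero_measurable_weighted[of T "\<lambda>y. (\<rho>0 y)\<^sup>2" \<theta>t]
      extend_by_zero_measurable_weighted[of T \<rho>0 Qy] \<theta> \<theta>t Qy \<rho>0_ne
    by (simp_all add: L_infty_L2_def L2_L2_def)
  have "\<exists>c>0. AE y in lborel. \<bar>y\<bar> \<le> r \<longrightarrow> c \<le> (\<rho>0 y)\<^sup>2" for r
  proof -
    obtain c where "c > 0" "AE y in lborel. \<bar>y\<bar> \<le> r \<longrightarrow> c \<le> \<rho>0 y" using \<rho>0(3) by blast
    then show ?thesis by (intro exI[of _ "c\<^sup>2"]) (auto elim!: eventually_mono intro: power_mono)
  qed
  then have slab: "slab_integrable (?ext Jt)" "slab_integrable (?ext \<theta>t)"
    using L2_L2_slab_integrable[OF L_infty_L2_imp_L2_L2[OF Jt]] L2_L2_weighted_slab_integrable[OF \<theta>t] \<rho>0_ne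
    by simp_all
  have ext_derivs: "weak_deriv (strip T) (0, 1) (?ext J) (?ext Jt)" "weak_deriv (strip T) (0, 1) (?ext \<theta>) (?ext \<theta>t)"
    "weak_deriv (strip T) (1, 0) (?ext \<theta>) (?ext \<theta>y)"
    using weak_derivs by (auto intro: weak_deriv_extend_by_zero)
  have ext_flux: "weak_deriv (strip T) (1, 0) (\<lambda>z. ?ext \<theta>y z / ?ext J z) (?ext Qy)"
    by (rule weak_deriv_cong[OF weak_derivs(4)]) simp_all
  show ?thesis
  proof
    show "AE z in lborel. z \<in> strip T \<longrightarrow> Jmin \<le> ?ext J z \<and> ?ext J z \<le> Jmax"
      using J_bounds by eventually_elim simp
    show "AE z in lborel. z \<in> strip T \<longrightarrow> 0 \<le> ?ext \<theta> z" using \<theta>_nonneg by eventually_elim simp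
    show "AE z in lborel. z \<in> strip T \<longrightarrow> ?ext J z = time_primitive J0 (?ext Jt) z"
      "AE z in lborel. z \<in> strip T \<longrightarrow> ?ext \<theta> z = time_primitive \<theta>0 (?ext \<theta>t) z"
      by (intro weak_deriv_attains_initial_time_primitive attains_initial_extend_by_zero pos ext_derivs slab initial;
          measurable)+
    show "AE t in lborel. t \<in> {0<..<T} \<longrightarrow> AE_primitive (\<lambda>y. ?ext \<theta> (y, t)) (\<lambda>y. ?ext \<theta>y (y, t))"
      by (intro weak_deriv_strip_AE_primitive_slice ext_derivs) measurable
    show "AE t in lborel. t \<in> {0<..<T} \<longrightarrow> AE_primitive (\<lambda>y. ?ext \<theta>y (y, t) / ?ext J (y, t)) (\<lambda>y. ?ext Qy (y, t))"
      by (rule weak_deriv_strip_AE_primitive_slice[OF ext_flux]) measurable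
    show "AE z in lborel. z \<in> strip T \<longrightarrow>
        \<kappa> * ?ext Qy z - \<beta> * (\<rho>0 (fst z))\<^sup>2 * (?ext \<theta> z)\<^sup>2 / ?ext J z \<le> cv * \<rho>0 (fst z) * ?ext \<theta>t z"
      using heat by eventually_elim simp
  qed fact+
qed

lemma NS_solution_thermal_flow:
  assumes pos: "\<mu> > 0" "\<kappa> > 0" "cv > 0" "T > 0"
    and \<rho>0: "\<And>y. 0 < \<rho>0 y" "integrable lborel \<rho>0" "\<And>r. \<exists>c>0. AE y in lborel. \<bar>y\<bar> \<le> r \<longrightarrow> c \<le> \<rho>0 y"
    and J0: "locally_integrable UNIV J0" and \<theta>0: "\<theta>0 \<in> borel_measurable borel"
    and sol: "NS_solution \<mu> \<kappa> cv R \<rho>0 J0 v0 \<theta>0 T J v \<theta>"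
  shows "\<exists>Jmin Jmax Jt_bound Jt \<theta>t \<theta>y Qy. thermal_flow T \<kappa> cv (R\<^sup>2 / (4 * \<mu>)) Jmin Jmax Jt_bound \<rho>0 J0 \<theta>0
    (extend_by_zero T J) Jt (extend_by_zero T \<theta>) \<theta>t \<theta>y Qy"
proof -
  obtain Jt \<theta>t \<theta>y Qy where
    weak_derivs: "weak_deriv (strip T) (0, 1) J Jt" "weak_deriv (strip T) (0, 1) \<theta> \<theta>t"
      "weak_deriv (strip T) (1, 0) \<theta> \<theta>y" "weak_deriv (strip T) (1, 0) (\<lambda>z. \<theta>y z / J z) Qy"
    and norms: "L_infty_L2 T Jt" "L_infty_L2 T (\<lambda>(y, t). sqrt (\<rho>0 y) * \<theta> (y, t))" "L2_L2 T \<theta>y"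
      "L2_L2 T (\<lambda>(y, t). \<rho>0 y * Qy (y, t))" "L2_L2 T (\<lambda>(y, t). (\<rho>0 y)\<^sup>2 * \<theta>t (y, t))"
    and heat: "AE z in lborel. z \<in> strip T \<longrightarrow>
      \<kappa> * Qy z - R\<^sup>2 / (4 * \<mu>) * (\<rho>0 (fst z))\<^sup>2 * (\<theta> z)\<^sup>2 / J z \<le> cv * \<rho>0 (fst z) * \<theta>t z"
    by (rule NS_solution_heat_inequalityE[OF pos(1) sol])
  have J_pos: "AE z in lborel. z \<in> strip T \<longrightarrow> 0 < J z" and J: "L_infty (strip T) J"
    and J_inv: "L_infty (strip T) (\<lambda>z. inverse (J z))"
    and \<theta>_nonneg: "AE z in lborel. z \<in> strip T \<longrightarrow> 0 \<le> \<theta> z"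
    and initial: "attains_initial J J0" "attains_initial \<theta> \<theta>0"
    using sol unfolding NS_solution_def by blast+
  obtain Jmin Jmax where J_bounds: "Jmin > 0" "AE z in lborel. z \<in> strip T \<longrightarrow> Jmin \<le> J z \<and> J z \<le> Jmax"
    using L_infty_inverse_imp_bounds[OF J_pos J J_inv] by blast
  obtain Jt_bound where Jt_bound: "Jt_bound \<ge> 0"
    "AE t in lborel. (\<integral>\<^sup>+ y. ennreal ((extend_by_zero T Jt (y, t))\<^sup>2) \<partial>lborel) \<le> ennreal Jt_bound"
    using L_infty_L2_slice_bound[OF norms(1)] by blast
  have "R\<^sup>2 / (4 * \<mu>) \<ge> 0" using pos(1) by simp
  from thermal_flow_extend_by_zero[OF pos(2-4) J_bounds(1) Jt_bound(1) \<rho>0 J0 \<theta>0 J_bounds(2) \<theta>_nonneg initial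
      weak_derivs J norms(2-5,1) Jt_bound(2) heat this]
  show ?thesis by blast
qed

section \<open>The lower bound of the entropy\<close>

lemma entropy_lower_imp_temperature:
  assumes "cv > 0" "R > 0" "A > 0" "0 < r" "0 < j" "j \<le> Jh" "0 \<le> th" and ent: "ereal m \<le> entropy cv R A r j th"
  shows "exp (m / cv - ln (R / A) - (R / cv) * ln Jh) * r powr (R / cv) \<le> th"
proof -
  have th: "th > 0" using ent assms(7) by (auto simp: entropy_def split: if_splits)
  have "m \<le> cv * (ln (R / A) + (R / cv) * ln j + ln th - (R / cv) * ln r)"
    using ent th by (simp add: entropy_def adiabatic_def)
  then have "m / cv \<le> ln (R / A) + (R / cv) * ln j + ln th - (R / cv) * ln r"
    using assms(1) by (simp add: pos_divide_le_eq mult.commute)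
  moreover have "(R / cv) * ln j \<le> (R / cv) * ln Jh"
    using assms(1,2,5,6) by (intro mult_left_mono) auto
  ultimately have "m / cv - ln (R / A) - (R / cv) * ln Jh + (R / cv) * ln r \<le> ln th" by linarith
  then have "exp (m / cv - ln (R / A) - (R / cv) * ln Jh + (R / cv) * ln r) \<le> exp (ln th)" by (simp only: exp_le_cancel_iff)
  then show ?thesis using th assms(4) by (simp add: exp_add powr_def)
qed

lemma temperature_lower_imp_entropy:
  assumes "cv > 0" "R > 0" "A > 0" "0 < r" "0 < jl" "jl \<le> j" "c > 0" and th: "c * r powr (R / cv) \<le> th"
  shows "ereal (cv * (ln (R / A) + (R / cv) * ln jl + ln c)) \<le> entropy cv R A r j th"
proof -
  have cr: "0 < c * r powr (R / cv)" using assms by simp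
  then have th0: "th > 0" using th by linarith
  have "ln c + (R / cv) * ln r = ln (c * r powr (R / cv))"
    using assms by (simp add: ln_mult ln_powr)
  also have "\<dots> \<le> ln th" using th cr th0 by simp
  finally have "ln c \<le> ln th - (R / cv) * ln r" by linarith
  moreover have "(R / cv) * ln jl \<le> (R / cv) * ln j" using assms by (intro mult_left_mono) auto
  ultimately have "cv * (ln (R / A) + (R / cv) * ln jl + ln c) \<le> cv * (ln (R / A) + (R / cv) * ln j + ln th - (R / cv) * ln r)"
    using assms(1) by (intro mult_left_mono) linarith+
  then show ?thesis using th0 by (simp add: entropy_def adiabatic_def)
qed

lemma ess_inf_AE: "AE x in M. ess_inf M f \<le> f x"
  using esssup_AE[of "\<lambda>x. - f x" M]
  by eventually_elim (simp add: ess_inf_def ereal_uminus_le_reorder)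

lemma ess_inf_geI:
  assumes "f \<in> borel_measurable M" "AE x in M. c \<le> f x"
  shows "c \<le> ess_inf M f"
proof -
  have "esssup M (\<lambda>x. - f x) \<le> - c"
    by (rule esssup_I) (use assms in auto)
  then show ?thesis unfolding ess_inf_def by (metis ereal_minus_le_minus ereal_uminus_uminus)
qed

lemma initial_entropy_imp_temperature:
  assumes pos: "cv > 0" "R > 0" "A > 0" "\<And>y. 0 < \<rho>0 y"
    and J0: "Jlow > 0" "AE y in lborel. Jlow \<le> J0 y" "AE y in lborel. \<bar>J0 y\<bar> \<le> Jmax"
    and \<theta>0: "AE y in lborel. 0 \<le> \<theta>0 y"
    and entropy: "ess_inf lborel (\<lambda>y. entropy cv R A (\<rho>0 y) (J0 y) (\<theta>0 y)) > - \<infinity>"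
  shows "\<exists>c>0. AE y in lborel. c * \<rho>0 y powr (R / cv) \<le> \<theta>0 y"
proof -
  obtain m :: real where m: "ereal m < ess_inf lborel (\<lambda>y. entropy cv R A (\<rho>0 y) (J0 y) (\<theta>0 y))"
    using ereal_dense2[OF entropy] by auto
  define c where "c = exp (m / cv - ln (R / A) - (R / cv) * ln Jmax)"
  have "AE y in lborel. c * \<rho>0 y powr (R / cv) \<le> \<theta>0 y"
    using ess_inf_AE[of lborel "\<lambda>y. entropy cv R A (\<rho>0 y) (J0 y) (\<theta>0 y)"] J0(2,3) \<theta>0
  proof eventually_elim
    case (elim y)
    have "ereal m \<le> entropy cv R A (\<rho>0 y) (J0 y) (\<theta>0 y)" using m elim(1) by order
    then show ?case
      unfolding c_def using elim(2-4) J0(1) pos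
      by (intro entropy_lower_imp_temperature) auto
  qed
  moreover have "c > 0" by (simp add: c_def)
  ultimately show ?thesis by blast
qed

lemma temperature_imp_ess_inf_entropy:
  assumes pos: "cv > 0" "R > 0" "A > 0" "\<And>y. 0 < \<rho>0 y" "c > 0" "Jmin > 0"
    and [measurable]: "\<rho>0 \<in> borel_measurable borel"
      "extend_by_zero T J \<in> borel_measurable borel" "extend_by_zero T \<theta> \<in> borel_measurable borel"
    and J: "AE z in lborel. z \<in> strip T \<longrightarrow> Jmin \<le> J z"
    and \<theta>: "AE z in lborel. z \<in> strip T \<longrightarrow> c * \<rho>0 (fst z) powr (R / cv) \<le> \<theta> z"
  shows "ess_inf (restrict_space lborel (strip T))
    (\<lambda>(y, t). entropy cv R A (\<rho>0 y) (J (y, t)) (\<theta> (y, t))) > - \<infinity>"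
proof -
  let ?M = "restrict_space lborel (strip T)"
  let ?s = "\<lambda>(y, t). entropy cv R A (\<rho>0 y) (J (y, t)) (\<theta> (y, t))"
  define m where "m = cv * (ln (R / A) + (R / cv) * ln Jmin + ln c)"
  have "ereal m \<le> ess_inf ?M ?s"
  proof (rule ess_inf_geI)
    have "(\<lambda>z. entropy cv R A (\<rho>0 (fst z)) (extend_by_zero T J z) (extend_by_zero T \<theta> z)) \<in> borel_measurable borel"
      unfolding entropy_def by measurable
    then have "(\<lambda>z. entropy cv R A (\<rho>0 (fst z)) (extend_by_zero T J z) (extend_by_zero T \<theta> z)) \<in> borel_measurable ?M"
      by (intro measurable_restrict_space1) simp
    then show "?s \<in> borel_measurable ?M"
      by (rule measurable_cong[THEN iffD1, rotated]) (auto simp: space_restrict_space)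
    have "AE z in lborel. z \<in> strip T \<longrightarrow> ereal m \<le> ?s z"
      using J \<theta>
    proof eventually_elim
      case (elim z)
      show ?case
        unfolding m_def split_beta prod.collapse
        using elim pos by (intro impI temperature_lower_imp_entropy) auto
    qed
    then show "AE z in ?M. ereal m \<le> ?s z" by (simp add: AE_restrict_space_iff)
  qed
  then show ?thesis using less_le_trans[of "- \<infinity>" "ereal m"] by simp
qed

theorem theorem1p2:
  fixes \<mu> \<kappa> cv R A Jlow :: real
    and \<rho>0 J0 v0 \<theta>0 :: "real \<Rightarrow> real"
    and d\<rho>0 dJ0 dv0 d\<theta>0 d_inv_sqrt_\<rho>0 d_inv_\<rho>0 dd_inv_\<rho>0 :: "real \<Rightarrow> real"
    and J v \<theta> :: "real \<times> real \<Rightarrow> real"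
  assumes "\<mu> > 0" "\<kappa> > 0" "cv > 0" "R > 0" "A > 0"
    and "\<And>y. 0 < \<rho>0 y" "L_infty UNIV \<rho>0" "weak_deriv1 \<rho>0 d\<rho>0" "L_infty UNIV d\<rho>0"
    and "Jlow > 0" "AE y in lborel. Jlow \<le> J0 y" "L_infty UNIV J0"
    and "AE y in lborel. 0 \<le> \<theta>0 y"
    and "weak_deriv1 J0 dJ0" "weak_deriv1 v0 dv0" "weak_deriv1 \<theta>0 d\<theta>0"
    and "L2 (\<lambda>y. sqrt (\<rho>0 y) * v0 y)" "L2 (\<lambda>y. sqrt (\<rho>0 y) * (v0 y)\<^sup>2)"
    and "L2 (\<lambda>y. sqrt (\<rho>0 y) * \<theta>0 y)" "L2 (\<lambda>y. sqrt (\<rho>0 y) * dJ0 y)"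
    and "L2 dv0" "L2 (\<lambda>y. \<rho>0 y powr (3/2) * d\<theta>0 y)"
    and "weak_deriv1 (\<lambda>y. 1 / sqrt (\<rho>0 y)) d_inv_sqrt_\<rho>0" "L_infty UNIV d_inv_sqrt_\<rho>0"
    and "integrable lborel \<rho>0"
    and "L2 (\<lambda>y. sqrt (\<rho>0 y) * d\<theta>0 y)" "L2 (\<lambda>y. dJ0 y / sqrt (\<rho>0 y))"
    and "weak_deriv1 (\<lambda>y. 1 / \<rho>0 y) d_inv_\<rho>0" "weak_deriv1 d_inv_\<rho>0 dd_inv_\<rho>0"
        "L_infty UNIV dd_inv_\<rho>0"
    and "NS_global_solution \<mu> \<kappa> cv R \<rho>0 J0 v0 \<theta>0 J v \<theta>"
    and "ess_inf lborel (\<lambda>y. entropy cv R A (\<rho>0 y) (J0 y) (\<theta>0 y)) > - \<infinity>"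
  shows "\<forall>T>0. ess_inf (restrict_space lborel (strip T))
                 (\<lambda>(y, t). entropy cv R A (\<rho>0 y) (J (y, t)) (\<theta> (y, t))) > - \<infinity>"
proof (intro allI impI)
  fix T :: real assume T: "T > 0"
  note pos = assms(1-5) and \<rho>0_pos = assms(6)
  have \<theta>0: "\<theta>0 \<in> borel_measurable borel" and J0: "locally_integrable UNIV J0"
    using assms(14,16) by (auto simp: weak_deriv_def intro: borel_measurable_locally_integrable)
  have "NS_solution \<mu> \<kappa> cv R \<rho>0 J0 v0 \<theta>0 T J v \<theta>"
    using assms(31) T by (simp add: NS_global_solution_def)
  then obtain Jmin Jmax Jt_bound Jt \<theta>t \<theta>y Qy where
    "thermal_flow T \<kappa> cv (R\<^sup>2 / (4 * \<mu>)) Jmin Jmax Jt_bound \<rho>0 J0 \<theta>0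
      (extend_by_zero T J) Jt (extend_by_zero T \<theta>) \<theta>t \<theta>y Qy"
    using NS_solution_thermal_flow[OF pos(1-3) T \<rho>0_pos assms(25)
        density_locally_bounded_below[OF \<rho>0_pos assms(7,28-30)] J0 \<theta>0] by blast
  then interpret thermal_flow T \<kappa> cv "R\<^sup>2 / (4 * \<mu>)" Jmin Jmax Jt_bound \<rho>0 J0 \<theta>0
      "extend_by_zero T J" Jt "extend_by_zero T \<theta>" \<theta>t \<theta>y Qy .
  have \<alpha>: "R / cv > 0" using pos by simp
  obtain e e' C where weight: "C > 0" "entropy_weight (R / cv) C \<rho>0 J0 e e'"
    using entropy_weight_exists[OF \<alpha> \<rho>0_pos assms(7,25,28-30,10-12,14,27)] by blast
  obtain \<rho>max where \<rho>max: "\<rho>max > 0" "AE y in lborel. \<bar>\<rho>0 y\<bar> \<le> \<rho>max" using L_infty_UNIVE[OF assms(7)] by blast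
  obtain J0max where "AE y in lborel. \<bar>J0 y\<bar> \<le> J0max" using L_infty_UNIVE[OF assms(12)] by blast
  from initial_entropy_imp_temperature[OF pos(3-5) \<rho>0_pos assms(10,11) this assms(13,32)]
  obtain c0 where "c0 > 0" "AE y in lborel. c0 * \<rho>0 y powr (R / cv) \<le> \<theta>0 y" by blast
  with \<alpha> weight \<rho>max interpret weighted_thermal_flow T \<kappa> cv "R\<^sup>2 / (4 * \<mu>)" Jmin Jmax Jt_bound \<rho>0 J0 \<theta>0
      "extend_by_zero T J" Jt "extend_by_zero T \<theta>" \<theta>t \<theta>y Qy "R / cv" C c0 \<rho>max e e'
    by unfold_locales (auto elim!: eventually_mono)
  obtain c where "c > 0" "AE z in lborel. z \<in> strip T \<longrightarrow> c * \<rho>0 (fst z) powr (R / cv) \<le> \<theta> z"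
    using temperature_lower_bound by (auto elim!: eventually_mono)
  moreover have "AE z in lborel. z \<in> strip T \<longrightarrow> Jmin \<le> J z" using J_bounds by eventually_elim simp
  ultimately show "- \<infinity> < ess_inf (restrict_space lborel (strip T))
      (\<lambda>(y, t). entropy cv R A (\<rho>0 y) (J (y, t)) (\<theta> (y, t)))"
    using temperature_imp_ess_inf_entropy pos(3-5) \<rho>0_pos Jmin_pos data_measurable(1) flow_measurable(1,3) by blast
qed

end
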